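(* There is a functor $Z:\mathbf{DFC}^{\mathrm{core}}\to\mathbf{KJBM}$ given on objects by $C\mapsto Z(C)$ and on isomorphisms by $f\mapsto Z(f)$, where $Z(C)$ and $Z(f)$ are the constructions described in the context.
   Context: **Many-to-one posets.** A many-to-one poset (MOP) is a finite set $P$ (of cells) with $\dim:P\to\mathbb N\cup\{-1\}$ (write $P_k=\dim^{-1}(k)$) and maps $\delta,\gamma:P_{k+1}\to\mathcal P(P_k)$ for each $k\ge-1$, such that: if $\dim x\ge 0$ then $\gamma(x)$ is a singleton; if $\delta(x)\cap\gamma(x)\ne\emptyset$ then $\delta(x)=\gamma(x)$; there is a unique cell $\ast$ of dimension $-1$, and $\gamma(x)\setminus\delta(x)=\{\ast\}$ whenever $\dim x=0$. Write $y\prec^- x$ iff $y\in\delta(x)\setminus\gamma(x)$; $y\prec^+x$ iff $y\in\gamma(x)\setminus\delta(x)$; $y\prec^\circ x$ iff $y\in\delta(x)\cap\gamma(x)$ ($x$ is then a loop on $y$); $y\prec x$ iff $y\in\partial(x):=\delta(x)\cup\gamma(x)$. The reflexive transitive closure of $\prec$ is a partial order on $P$. We identify $\gamma(x)$ with its unique element. $\delta$, $\gamma$, $\partial$ extend to sets of cells by unions. Put $\gamma^+(x)=\gamma(x)\setminus\delta(x)$, $\Lambda=P\setminus\gamma^+(P)$, $\Lambda_k=\Lambda\cap P_k$; $N=\{x:\delta(x)=\emptyset\}$. Finally, a MOP carries, for each $x\in\Lambda$ and $z\in\partial^2(x)$, a total order $\triangleleft$ on $\{y\mid z\prec^\circ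 y\prec^- x\}$ (the local order). A morphism of MOPs $f:C\to D$ is a dimension-preserving map such that for every $x$ with $\dim x\ge0$, $f$ restricts to a bijection $\delta(x)\to\delta(f(x))$ and $f(\gamma(x))=\gamma(f(x))$, and $f$ preserves local orders. Signs $+,-,\circ$ are multiplied as $+1,-1,0$. **DFC.** A dendritic face complex (DFC) is a MOP $C$ such that: (greatest element) $C$ has a greatest element, of dimension $\ge0$; (loops) if $z\prec^\circ y$ there is $x$ with $y\prec^+x$; (oriented thinness) if $z\prec^\beta y\prec^\alpha x$ with $\alpha,\beta\neq\circ$, there is a unique $y'\ne y$ with $z\prec^{\beta'}y'\prec^{\alpha'}x$, $\alpha',\beta'\ne\circ$, and it satisfies $\alpha\beta=-\alpha'\beta'$; and if $z\prec^\circ y\prec^-x$ there is $y'$ with $z\prec^\beta y'\prec^\alpha x$ and $(\alpha,\beta)\ne(-,\circ)$; (acyclicity) for $\dim x\ge1$ there are no $p\ge1$ and $y_1,\dots,y_p\prec^-x$ with $\gamma(y_{i+1})\prec^+y_{i+1}$ and $\gamma(y_{i+1})\prec^- y_i$ for all $i$ (indices mod $p$). $\mathbf{DFC}$ is the full subcategory of MOPs on DFCs, $\mathbf{DFC}^{\mathrm{core}}$ its groupoid of isomorphisms. The dimension $n$ of $C$ is the dimension of its greatest element $\omega$. **Trees.** A rooted tree $T$ consists of finite sets $T^\bullet$ of nodes and $E(T)$ of edges; each node has exactly one target edge (it is then the source node of that edge; an edge has at most one source node); each edge $b$ has at most one target node $a$ (then $b$ is called a source of $a$); a distinguished root edge $\rho(T)$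 has no target node; and from every edge there is a descending path to $\rho(T)$. Here a descending path from $x$ to $y$ is an alternating sequence of nodes and edges (possibly of length one) from $x$ to $y$, each term being the target of the previous one; write $x\sqsubseteq y$ if one exists. Leaves ($T^{|}$) are edges without source node; null dots are nodes without sources. A tree is linear if each node has exactly one source. A subdivision $W$ of $T$ is a finite totally ordered set $W(b)$ for each edge $b$; the subdivided tree $T'=(T,W)$ is seen as a rooted tree by inserting the elements of $W(b)$ as nodes on $b$, in increasing order starting nearest the root. Put $\mathrm{blackdots}(T')=T^\bullet$, $\mathrm{whitedots}(T')=\bigsqcup_bW(b)$, $\mathrm{dots}(T')$ their union. **Opetopes.** A constellation $T\to U$ of rooted trees is a subdivision $T'$ of $T$ with bijections $\sigma_\bullet:\mathrm{blackdots}(T')\to U^{|}$ and $\sigma_\circ:\mathrm{whitedots}(T')\to\{\text{null dots of }U\}$ such that, with $\sigma=\sigma_\bullet+\sigma_\circ$, for each node $x$ of $U$ the set $\{t\in\mathrm{dots}(T')\mid\sigma(t)\sqsubseteq x\}$ induces a connected full subgraph of $T'$ (kernel rule). It is exact if $\sigma_\bullet,\sigma_\circ$ are identities. An $n$-opetope is a sequence of exact constellations $T_0\to\cdots\to T_n$ where $T_0$ has one root, one leaf and one node; if $n\ge1$, $T_1$ has the same form; if $n\ge2$, $T_2$ is linear. An isomorphism of $n$-opetopes is a sequence of isomorphisms of (subdivided) trees compatible with the structural maps of the constellations. $\mathbf{KJBM}$ is the category of opetopes and their isomorphisms. **The construction $Z$.** Let $C$ be a DFC of dimension $n$ with greatest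 element $\omega$; $\gamma^{(k)}\omega\in C_k$ is the iterated target of $\omega$. For $2\le k\le n+2$, $T_k$ is the rooted tree with nodes $\Lambda_{k-1}$ (empty if $k=n+2$), edges $C_{k-2}$, root $\gamma^{(k-2)}\omega$; $y$ is a source of $x$ iff $y\prec^-x$ and $y$ is the target of $x$ iff $y\prec^+x$. $T_0,T_1$ are trees with one node, one leaf and one root, chosen (uniquely up to renaming) so that the node of $T_0$ is the leaf of $T_1$ and the node of $T_1$ is the unique leaf of the linear tree $T_2$; they have empty subdivisions. For $2\le k<n+2$, $T_k$ is subdivided by $W_k(y)=\{w\in\Lambda_k\cap N\mid\gamma^2(w)=y\}$, ordered by $w<w'$ iff $\gamma(w)\blacktriangleleft\gamma(w')$, where $\blacktriangleleft$ is as follows. Fix a cell $c$. For loops $b,b'$ on $c$ write $b'\subset b$ if $b\prec^+a$, $b'\prec^-a$ for some $a\in\Lambda$; $\subseteq$ is the reflexive transitive closure. All chains $c\prec^\beta b\prec^\alpha a$ with $a\in\Lambda$, $\alpha,\beta\ne\circ$ are listed by a zig-zag $b_1,a_1,b_2,\dots,a_{q-1},b_q$ with $c\prec^-b_i$ for $i\le p$, $c\prec^+b_i$ for $i>p$; $b_i\prec^-a_i$, $b_{i+1}\prec^+a_i$ for $i<p$; $b_p\prec^-a_p$, $b_{p+1}\prec^-a_p$; $b_i\prec^+a_i$, $b_{i+1}\prec^-a_i$ for $i>p$ (the left part $i\le p$, the right part $i>p$, or everything may be empty). If $c\prec^\circ b\prec^-a_i$, $c\prec^\circ b'\prec^-a_j$,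 $i<j$, $\bar b\subseteq b$, $\bar b'\subseteq b'$, put $\bar b\blacktriangleleft^1\bar b'$. If $c\prec^\circ b\prec^+a$, $c\prec^\circ b'\prec^+a'$ with $b\ne b'$ and $a,a'\in\Lambda\cap N$ are not $\blacktriangleleft^1$-comparable, there are uniquely determined sequences in $\Lambda$, $a=a_0,a_1,\dots,a_p=a''$ and $a'=a'_0,\dots,a'_q=a''$, and loops $b=b_0,\dots,b_{p-1}$, $b'=b'_0,\dots,b'_{q-1}$ on $c$, with $a_i\succ^+b_i\prec^-a_{i+1}$, $a'_i\succ^+b'_i\prec^-a'_{i+1}$ and $b_{p-1}\ne b'_{q-1}$; put $b\blacktriangleleft^2b'$ iff $b_{p-1}\triangleleft b'_{q-1}$. Then $\blacktriangleleft$ is $\blacktriangleleft^1\cup\blacktriangleleft^2$ restricted to the loops $b$ on $c$ with $b\prec^+a$ for some $a\in\Lambda\cap N$. $Z(C)$ is the sequence $T_0\to T_1\to\cdots\to T_n$ with these subdivisions and with identities as structural maps. For an isomorphism $f:C\to D$ of DFCs, $Z(f)$ is given by $f$ on nodes, edges and white dots in degrees $\ge2$ (and in the only possible way in degrees $0,1$). *)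

theory Defs
  imports Main "HOL-Library.FuncSet"
begin

section \<open>Categories and functors\<close>

text \<open>Morphisms are compared by HOL equality, so the hom-sets below always consist of functions
  that are extensional on their domain. Composition carries the three objects involved, because an
  extensional function does not determine its domain.\<close>

record ('o, 'm) category =
  Obj :: "'o set"
  Hom :: "'o \<Rightarrow> 'o \<Rightarrow> 'm set"
  Idn :: "'o \<Rightarrow> 'm"
  Cmp :: "'o \<Rightarrow> 'o \<Rightarrow> 'o \<Rightarrow> 'm \<Rightarrow> 'm \<Rightarrow> 'm"

definition is_category :: "('o, 'm) category \<Rightarrow> bool" where
  "is_category \<C> \<longleftrightarrow>
    (\<forall>X\<in>Obj \<C>. Idn \<C> X \<in> Hom \<C> X X) \<and>
    (\<forall>X\<in>Obj \<C>. \<forall>Y\<in>Obj \<C>. \<forall>Z\<in>Obj \<C>. \<forall>f\<in>Hom \<C> X Y. \<forall>g\<in>Hom \<C> Y Z.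
       Cmp \<C> X Y Z g f \<in> Hom \<C> X Z) \<and>
    (\<forall>X\<in>Obj \<C>. \<forall>Y\<in>Obj \<C>. \<forall>f\<in>Hom \<C> X Y.
       Cmp \<C> X X Y f (Idn \<C> X) = f \<and> Cmp \<C> X Y Y (Idn \<C> Y) f = f) \<and>
    (\<forall>X\<in>Obj \<C>. \<forall>Y\<in>Obj \<C>. \<forall>Z\<in>Obj \<C>. \<forall>V\<in>Obj \<C>.
       \<forall>f\<in>Hom \<C> X Y. \<forall>g\<in>Hom \<C> Y Z. \<forall>h\<in>Hom \<C> Z V.
       Cmp \<C> X Z V h (Cmp \<C> X Y Z g f) = Cmp \<C> X Y V (Cmp \<C> Y Z V h g) f)"

definition full_subcategory :: "('o, 'm) category \<Rightarrow> ('o \<Rightarrow> bool) \<Rightarrow> ('o, 'm) category" where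
  "full_subcategory \<C> Q = \<C>\<lparr>Obj := {X \<in> Obj \<C>. Q X}\<rparr>"

definition core :: "('o, 'm) category \<Rightarrow> ('o, 'm) category" where
  "core \<C> = \<C>\<lparr>Hom := \<lambda>X Y. {f \<in> Hom \<C> X Y. \<exists>g\<in>Hom \<C> Y X.
     Cmp \<C> X Y X g f = Idn \<C> X \<and> Cmp \<C> Y X Y f g = Idn \<C> Y}\<rparr>"

definition is_functor ::
  "('o, 'm) category \<Rightarrow> ('p, 'n) category \<Rightarrow> ('o \<Rightarrow> 'p) \<Rightarrow> ('o \<Rightarrow> 'o \<Rightarrow> 'm \<Rightarrow> 'n) \<Rightarrow> bool" where
  "is_functor \<C> \<D> F0 F1 \<longleftrightarrow>
    is_category \<C> \<and> is_category \<D> \<and>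
    (\<forall>X\<in>Obj \<C>. F0 X \<in> Obj \<D>) \<and>
    (\<forall>X\<in>Obj \<C>. \<forall>Y\<in>Obj \<C>. \<forall>f\<in>Hom \<C> X Y. F1 X Y f \<in> Hom \<D> (F0 X) (F0 Y)) \<and>
    (\<forall>X\<in>Obj \<C>. F1 X X (Idn \<C> X) = Idn \<D> (F0 X)) \<and>
    (\<forall>X\<in>Obj \<C>. \<forall>Y\<in>Obj \<C>. \<forall>Z\<in>Obj \<C>. \<forall>f\<in>Hom \<C> X Y. \<forall>g\<in>Hom \<C> Y Z.
       F1 X Z (Cmp \<C> X Y Z g f) = Cmp \<D> (F0 X) (F0 Y) (F0 Z) (F1 Y Z g) (F1 X Y f))"

section \<open>Many-to-one posets\<close>

text \<open>\<open>lorder C x z\<close> is the strict local order on the loops \<open>y\<close> on \<open>z\<close> with \<open>y \<prec>\<^sup>- x\<close>.\<close>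

record 'a mop =
  cells :: "'a set"
  dim :: "'a \<Rightarrow> int"
  delta :: "'a \<Rightarrow> 'a set"
  gamma :: "'a \<Rightarrow> 'a set"
  lorder :: "'a \<Rightarrow> 'a \<Rightarrow> ('a \<times> 'a) set"

text \<open>\<open>prec C \<alpha> y x\<close> stands for \<open>y \<prec>\<^sup>\<alpha> x\<close>; the signs \<open>+\<close>, \<open>-\<close>, \<open>\<circ>\<close> are the integers
  \<open>1\<close>, \<open>-1\<close>, \<open>0\<close>, so that they are multiplied as integers.\<close>

definition prec :: "'a mop \<Rightarrow> int \<Rightarrow> 'a \<Rightarrow> 'a \<Rightarrow> bool" where
  "prec C \<alpha> y x \<longleftrightarrow> x \<in> cells C \<and>
     (\<alpha> = 1 \<and> y \<in> gamma C x - delta C x \<or>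
      \<alpha> = -1 \<and> y \<in> delta C x - gamma C x \<or>
      \<alpha> = 0 \<and> y \<in> delta C x \<inter> gamma C x)"

definition boundary :: "'a mop \<Rightarrow> 'a \<Rightarrow> 'a set" where
  "boundary C x = delta C x \<union> gamma C x"

definition boundary2 :: "'a mop \<Rightarrow> 'a \<Rightarrow> 'a set" where
  "boundary2 C x = (\<Union>y\<in>boundary C x. boundary C y)"

definition cell_le :: "'a mop \<Rightarrow> 'a \<Rightarrow> 'a \<Rightarrow> bool" where
  "cell_le C = (\<lambda>y x. x \<in> cells C \<and> y \<in> boundary C x)\<^sup>*\<^sup>*"

definition Lam :: "'a mop \<Rightarrow> 'a set" where
  "Lam C = cells C - (\<Union>x\<in>cells C. gamma C x - delta C x)"

definition null_cells :: "'a mop \<Rightarrow> 'a set" where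
  "null_cells C = {x \<in> cells C. delta C x = {}}"

text \<open>The total orders of the paper are strict (\<open>\<triangleleft>\<close>, \<open>\<blacktriangleleft>\<close> and the orders of subdivisions); the
  library's \<open>strict_linear_order_on\<close> does not bound the field of the relation.\<close>

definition strict_total_order :: "'w set \<Rightarrow> ('w \<times> 'w) set \<Rightarrow> bool" where
  "strict_total_order A r \<longleftrightarrow> r \<subseteq> A \<times> A \<and> strict_linear_order_on A r"

text \<open>The second clause makes \<open>delta\<close> and \<open>gamma\<close> empty on the cell of dimension \<open>-1\<close>, where they
  are undefined in the paper. Local orders only exist at \<open>x \<in> \<Lambda>\<close>, \<open>z \<in> \<partial>\<^sup>2(x)\<close>;
  elsewhere \<open>lorder\<close> has the default value \<open>{}\<close>.\<close>

definition is_mop :: "'a mop \<Rightarrow> bool" where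
  "is_mop C \<longleftrightarrow>
    finite (cells C) \<and>
    (\<forall>x\<in>cells C. dim C x \<ge> -1 \<and>
       delta C x \<subseteq> {y \<in> cells C. dim C y = dim C x - 1} \<and>
       gamma C x \<subseteq> {y \<in> cells C. dim C y = dim C x - 1}) \<and>
    (\<forall>x\<in>cells C. dim C x \<ge> 0 \<longrightarrow> is_singleton (gamma C x)) \<and>
    (\<forall>x\<in>cells C. delta C x \<inter> gamma C x \<noteq> {} \<longrightarrow> delta C x = gamma C x) \<and>
    (\<exists>s. {x \<in> cells C. dim C x = -1} = {s} \<and>
       (\<forall>x\<in>cells C. dim C x = 0 \<longrightarrow> gamma C x - delta C x = {s})) \<and>
    (\<forall>x\<in>Lam C. \<forall>z\<in>boundary2 C x.
       strict_total_order {y. prec C 0 z y \<and> prec C (-1) y x} (lorder C x z)) \<and>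
    (\<forall>x z. \<not> (x \<in> Lam C \<and> z \<in> boundary2 C x) \<longrightarrow> lorder C x z = {})"

definition mop_hom :: "'a mop \<Rightarrow> 'b mop \<Rightarrow> ('a \<Rightarrow> 'b) set" where
  "mop_hom C D = {f. f \<in> cells C \<rightarrow>\<^sub>E cells D \<and>
     (\<forall>x\<in>cells C. dim D (f x) = dim C x) \<and>
     (\<forall>x\<in>cells C. dim C x \<ge> 0 \<longrightarrow>
        bij_betw f (delta C x) (delta D (f x)) \<and> f ` gamma C x = gamma D (f x)) \<and>
     (\<forall>x z y y'. (y, y') \<in> lorder C x z \<longrightarrow> (f y, f y') \<in> lorder D (f x) (f z))}"

definition MOP :: "('a mop, 'a \<Rightarrow> 'a) category" where
  "MOP = \<lparr>Obj = {C. is_mop C}, Hom = mop_hom,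
     Idn = (\<lambda>C. restrict id (cells C)),
     Cmp = (\<lambda>C D E g f. compose (cells C) g f)\<rparr>"

section \<open>Dendritic face complexes\<close>

definition is_greatest :: "'a mop \<Rightarrow> 'a \<Rightarrow> bool" where
  "is_greatest C w \<longleftrightarrow> w \<in> cells C \<and> (\<forall>x\<in>cells C. cell_le C x w)"

definition has_greatest :: "'a mop \<Rightarrow> bool" where
  "has_greatest C \<longleftrightarrow> (\<exists>w. is_greatest C w \<and> dim C w \<ge> 0)"

definition loops_axiom :: "'a mop \<Rightarrow> bool" where
  "loops_axiom C \<longleftrightarrow> (\<forall>z y. prec C 0 z y \<longrightarrow> (\<exists>x. prec C 1 y x))"

definition oriented_thinness :: "'a mop \<Rightarrow> bool" where
  "oriented_thinness C \<longleftrightarrow>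
    (\<forall>x y z \<alpha> \<beta>. \<alpha> \<noteq> 0 \<and> \<beta> \<noteq> 0 \<and> prec C \<beta> z y \<and> prec C \<alpha> y x \<longrightarrow>
       (\<exists>y'. y' \<noteq> y \<and>
          (\<exists>\<alpha>' \<beta>'. \<alpha>' \<noteq> 0 \<and> \<beta>' \<noteq> 0 \<and> prec C \<beta>' z y' \<and> prec C \<alpha>' y' x \<and>
             \<alpha> * \<beta> = - (\<alpha>' * \<beta>')) \<and>
          (\<forall>y'' \<alpha>' \<beta>'. y'' \<noteq> y \<and> \<alpha>' \<noteq> 0 \<and> \<beta>' \<noteq> 0 \<and>
             prec C \<beta>' z y'' \<and> prec C \<alpha>' y'' x \<longrightarrow> y'' = y'))) \<and>
    (\<forall>x y z. prec C 0 z y \<and> prec C (-1) y x \<longrightarrow>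
       (\<exists>y' \<alpha> \<beta>. prec C \<beta> z y' \<and> prec C \<alpha> y' x \<and> (\<alpha>, \<beta>) \<noteq> (-1, 0)))"

text \<open>\<open>tgt C x\<close> is the unique element of \<open>\<gamma>(x)\<close> (for \<open>dim x \<ge> 0\<close>).\<close>

definition tgt :: "'a mop \<Rightarrow> 'a \<Rightarrow> 'a" where
  "tgt C x = the_elem (gamma C x)"

definition acyclicity :: "'a mop \<Rightarrow> bool" where
  "acyclicity C \<longleftrightarrow> (\<forall>x\<in>cells C. dim C x \<ge> 1 \<longrightarrow>
     \<not> (\<exists>p \<ge> (1::nat). \<exists>y :: nat \<Rightarrow> 'a. \<forall>i<p. prec C (-1) (y i) x \<and>
          prec C 1 (tgt C (y (Suc i mod p))) (y (Suc i mod p)) \<and>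
          prec C (-1) (tgt C (y (Suc i mod p))) (y i)))"

definition is_dfc :: "'a mop \<Rightarrow> bool" where
  "is_dfc C \<longleftrightarrow> is_mop C \<and> has_greatest C \<and> loops_axiom C \<and> oriented_thinness C \<and> acyclicity C"

definition DFC :: "('a mop, 'a \<Rightarrow> 'a) category" where
  "DFC = full_subcategory MOP is_dfc"

definition DFC_core :: "('a mop, 'a \<Rightarrow> 'a) category" where
  "DFC_core = core DFC"

section \<open>Rooted trees\<close>

text \<open>\<open>is_src T b a\<close>: the edge \<open>b\<close> is a source of the node \<open>a\<close> (\<open>a\<close> is the target node of \<open>b\<close>).
  \<open>is_tgt T b a\<close>: the edge \<open>b\<close> is the target of the node \<open>a\<close> (\<open>a\<close> is the source node of \<open>b\<close>).\<close>

record ('n, 'e) rtree =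
  nodes :: "'n set"
  edges :: "'e set"
  is_src :: "'e \<Rightarrow> 'n \<Rightarrow> bool"
  is_tgt :: "'e \<Rightarrow> 'n \<Rightarrow> bool"
  root :: "'e"

fun down_step :: "('n, 'e) rtree \<Rightarrow> 'n + 'e \<Rightarrow> 'n + 'e \<Rightarrow> bool" where
  "down_step T (Inl a) (Inr b) = is_tgt T b a"
| "down_step T (Inr b) (Inl a) = is_src T b a"
| "down_step T _ _ = False"

definition desc :: "('n, 'e) rtree \<Rightarrow> 'n + 'e \<Rightarrow> 'n + 'e \<Rightarrow> bool" where
  "desc T = (down_step T)\<^sup>*\<^sup>*"

definition rooted_tree :: "('n, 'e) rtree \<Rightarrow> bool" where
  "rooted_tree T \<longleftrightarrow>
    finite (nodes T) \<and> finite (edges T) \<and>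
    (\<forall>b a. is_src T b a \<or> is_tgt T b a \<longrightarrow> b \<in> edges T \<and> a \<in> nodes T) \<and>
    (\<forall>a\<in>nodes T. \<exists>!b. is_tgt T b a) \<and>
    (\<forall>b. \<exists>\<^sub>\<le>\<^sub>1 a. is_tgt T b a) \<and>
    (\<forall>b. \<exists>\<^sub>\<le>\<^sub>1 a. is_src T b a) \<and>
    root T \<in> edges T \<and> (\<nexists>a. is_src T (root T) a) \<and>
    (\<forall>b\<in>edges T. desc T (Inr b) (Inr (root T)))"

definition leaves :: "('n, 'e) rtree \<Rightarrow> 'e set" where
  "leaves T = {b \<in> edges T. \<nexists>a. is_tgt T b a}"

definition null_dots :: "('n, 'e) rtree \<Rightarrow> 'n set" where
  "null_dots T = {a \<in> nodes T. \<nexists>b. is_src T b a}"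

definition linear_tree :: "('n, 'e) rtree \<Rightarrow> bool" where
  "linear_tree T \<longleftrightarrow> (\<forall>a\<in>nodes T. \<exists>!b. is_src T b a)"

definition unit_tree :: "('n, 'e) rtree \<Rightarrow> bool" where
  "unit_tree T \<longleftrightarrow> is_singleton (nodes T) \<and> is_singleton (leaves T)"

section \<open>Subdivisions and constellations\<close>

text \<open>\<open>wless W b\<close> is the strict order on \<open>wset W b\<close>, the smallest element being nearest the root.\<close>

record ('e, 'w) subdiv =
  wset :: "'e \<Rightarrow> 'w set"
  wless :: "'e \<Rightarrow> ('w \<times> 'w) set"

definition is_subdiv :: "('n, 'e) rtree \<Rightarrow> ('e, 'w) subdiv \<Rightarrow> bool" where
  "is_subdiv T W \<longleftrightarrow>
     (\<forall>b\<in>edges T. finite (wset W b) \<and> strict_total_order (wset W b) (wless W b))"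

definition white_dots :: "('n, 'e) rtree \<Rightarrow> ('e, 'w) subdiv \<Rightarrow> ('e \<times> 'w) set" where
  "white_dots T W = Sigma (edges T) (wset W)"

text \<open>An edge \<open>b\<close> with white dots \<open>w\<^sub>1 < \<dots> < w\<^sub>m\<close> is cut into \<open>m + 1\<close> segments: \<open>(b, None)\<close> is the
  one nearest the root and \<open>(b, Some w)\<close> is the one just above \<open>w\<close>, that is, the source
  of \<open>w\<close>. The set \<open>dots_above W b s\<close> consists of the white dots above the segment \<open>(b, s)\<close> on \<open>b\<close>.\<close>

definition segments :: "('n, 'e) rtree \<Rightarrow> ('e, 'w) subdiv \<Rightarrow> ('e \<times> 'w option) set" where
  "segments T W = {(b, s). b \<in> edges T \<and> set_option s \<subseteq> wset W b}"

definition dots_above :: "('e, 'w) subdiv \<Rightarrow> 'e \<Rightarrow> 'w option \<Rightarrow> 'w set" where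
  "dots_above W b s =
     (case s of None \<Rightarrow> wset W b | Some w \<Rightarrow> {w' \<in> wset W b. (w, w') \<in> wless W b})"

definition seg_src ::
  "('n, 'e) rtree \<Rightarrow> ('e, 'w) subdiv \<Rightarrow> 'e \<times> 'w option \<Rightarrow> 'n + ('e \<times> 'w) \<Rightarrow> bool" where
  "seg_src T W g t \<longleftrightarrow> g \<in> segments T W \<and>
     (case g of (b, s) \<Rightarrow>
       (case s of None \<Rightarrow> (\<exists>a. t = Inl a \<and> is_src T b a) | Some w \<Rightarrow> t = Inr (b, w)))"

definition seg_tgt ::
  "('n, 'e) rtree \<Rightarrow> ('e, 'w) subdiv \<Rightarrow> 'e \<times> 'w option \<Rightarrow> 'n + ('e \<times> 'w) \<Rightarrow> bool" where
  "seg_tgt T W g t \<longleftrightarrow> g \<in> segments T W \<and>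
     (case g of (b, s) \<Rightarrow>
       (case t of
          Inl a \<Rightarrow> is_tgt T b a \<and> dots_above W b s = {}
        | Inr (b', w) \<Rightarrow> b' = b \<and> w \<in> dots_above W b s \<and>
            (\<forall>v\<in>dots_above W b s. v = w \<or> (w, v) \<in> wless W b)))"

definition subdivided ::
  "('n, 'e) rtree \<Rightarrow> ('e, 'w) subdiv \<Rightarrow> ('n + ('e \<times> 'w), 'e \<times> 'w option) rtree" where
  "subdivided T W = \<lparr>nodes = nodes T <+> white_dots T W, edges = segments T W,
     is_src = seg_src T W, is_tgt = seg_tgt T W, root = (root T, None)\<rparr>"

definition adjacent :: "('n, 'e) rtree \<Rightarrow> 'n \<Rightarrow> 'n \<Rightarrow> bool" where
  "adjacent T a a' \<longleftrightarrow> (\<exists>b. is_tgt T b a \<and> is_src T b a' \<or> is_src T b a \<and> is_tgt T b a')"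

definition connected_nodes :: "('n, 'e) rtree \<Rightarrow> 'n set \<Rightarrow> bool" where
  "connected_nodes T S \<longleftrightarrow>
     (\<forall>a\<in>S. \<forall>a'\<in>S. (\<lambda>u v. u \<in> S \<and> v \<in> S \<and> adjacent T u v)\<^sup>*\<^sup>* a a')"

text \<open>\<open>sb\<close> and \<open>sw\<close> are \<open>\<sigma>\<^sub>\<bullet>\<close> and \<open>\<sigma>\<^sub>\<circ>\<close>. The first sends nodes of \<open>T\<close> to leaves of \<open>U\<close> (edges), the
  second white dots to null dots of \<open>U\<close> (nodes).\<close>

definition constellation ::
  "('n, 'e) rtree \<Rightarrow> ('e, 'w) subdiv \<Rightarrow> ('n \<Rightarrow> 'f) \<Rightarrow> ('e \<times> 'w \<Rightarrow> 'm) \<Rightarrow> ('m, 'f) rtree \<Rightarrow> bool" where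
  "constellation T W sb sw U \<longleftrightarrow>
    rooted_tree T \<and> rooted_tree U \<and> is_subdiv T W \<and>
    bij_betw sb (nodes T) (leaves U) \<and>
    bij_betw sw (white_dots T W) (null_dots U) \<and>
    (\<forall>x\<in>nodes U. connected_nodes (subdivided T W)
       {t \<in> nodes (subdivided T W).
          desc U (case t of Inl a \<Rightarrow> Inr (sb a) | Inr d \<Rightarrow> Inl (sw d)) (Inl x)})"

text \<open>A white dot \<open>w\<close> on \<open>b\<close> is the pair \<open>(b, w)\<close>, so \<open>\<sigma>\<^sub>\<circ>\<close> is an identity when it is \<open>snd\<close>; its
  injectivity then says that the sets \<open>W(b)\<close> are pairwise disjoint.\<close>

definition exact_constellation ::
  "('v, 'v) rtree \<Rightarrow> ('v, 'v) subdiv \<Rightarrow> ('v, 'v) rtree \<Rightarrow> bool" where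
  "exact_constellation T W U \<longleftrightarrow> constellation T W id snd U"

section \<open>Opetopes\<close>

text \<open>Only \<open>otree k\<close> for \<open>k \<le> n\<close> and \<open>osub k\<close> for \<open>k < n\<close> are part of the data of an
  \<open>n\<close>-opetope.\<close>

record 'v opetope =
  odim :: nat
  otree :: "nat \<Rightarrow> ('v, 'v) rtree"
  osub :: "nat \<Rightarrow> ('v, 'v) subdiv"

definition is_opetope :: "'v opetope \<Rightarrow> bool" where
  "is_opetope P \<longleftrightarrow>
    (\<forall>k\<le>odim P. rooted_tree (otree P k)) \<and>
    (\<forall>k<odim P. exact_constellation (otree P k) (osub P k) (otree P (Suc k))) \<and>
    unit_tree (otree P 0) \<and>
    (odim P \<ge> 1 \<longrightarrow> unit_tree (otree P 1)) \<and>
    (odim P \<ge> 2 \<longrightarrow> linear_tree (otree P 2))"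

definition tree_iso ::
  "('n \<Rightarrow> 'm) \<Rightarrow> ('e \<Rightarrow> 'f) \<Rightarrow> ('n, 'e) rtree \<Rightarrow> ('m, 'f) rtree \<Rightarrow> bool" where
  "tree_iso fn fe T U \<longleftrightarrow>
    bij_betw fn (nodes T) (nodes U) \<and> bij_betw fe (edges T) (edges U) \<and>
    fe (root T) = root U \<and>
    (\<forall>b\<in>edges T. \<forall>a\<in>nodes T.
       (is_src U (fe b) (fn a) \<longleftrightarrow> is_src T b a) \<and> (is_tgt U (fe b) (fn a) \<longleftrightarrow> is_tgt T b a))"

definition subdiv_iso ::
  "('e \<Rightarrow> 'f) \<Rightarrow> ('e \<times> 'w \<Rightarrow> 'f \<times> 'u) \<Rightarrow> ('n, 'e) rtree \<Rightarrow> ('e, 'w) subdiv \<Rightarrow>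
   ('m, 'f) rtree \<Rightarrow> ('f, 'u) subdiv \<Rightarrow> bool" where
  "subdiv_iso fe fw T W U V \<longleftrightarrow>
    bij_betw fw (white_dots T W) (white_dots U V) \<and>
    (\<forall>(b, w)\<in>white_dots T W. fst (fw (b, w)) = fe b) \<and>
    (\<forall>b\<in>edges T. \<forall>w\<in>wset W b. \<forall>w'\<in>wset W b.
       (w, w') \<in> wless W b \<longleftrightarrow> (snd (fw (b, w)), snd (fw (b, w'))) \<in> wless V (fe b))"

definition onodes :: "'v opetope \<Rightarrow> nat \<Rightarrow> 'v set" where
  "onodes P k = (if k \<le> odim P then nodes (otree P k) else {})"

definition oedges :: "'v opetope \<Rightarrow> nat \<Rightarrow> 'v set" where
  "oedges P k = (if k \<le> odim P then edges (otree P k) else {})"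

definition owhite :: "'v opetope \<Rightarrow> nat \<Rightarrow> ('v \<times> 'v) set" where
  "owhite P k = (if k < odim P then white_dots (otree P k) (osub P k) else {})"

record 'v opmap =
  nmap :: "nat \<Rightarrow> 'v \<Rightarrow> 'v"
  emap :: "nat \<Rightarrow> 'v \<Rightarrow> 'v"
  wmap :: "nat \<Rightarrow> 'v \<times> 'v \<Rightarrow> 'v \<times> 'v"

text \<open>The last two clauses are the compatibility with the structural maps \<open>\<sigma>\<^sub>\<bullet> = id\<close> and
  \<open>\<sigma>\<^sub>\<circ> = snd\<close>.\<close>

definition opetope_iso :: "'v opetope \<Rightarrow> 'v opetope \<Rightarrow> 'v opmap set" where
  "opetope_iso P Q = {f. odim P = odim Q \<and>
    (\<forall>k. nmap f k \<in> extensional (onodes P k) \<and> emap f k \<in> extensional (oedges P k) \<and>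
       wmap f k \<in> extensional (owhite P k)) \<and>
    (\<forall>k\<le>odim P. tree_iso (nmap f k) (emap f k) (otree P k) (otree Q k)) \<and>
    (\<forall>k<odim P. subdiv_iso (emap f k) (wmap f k)
       (otree P k) (osub P k) (otree Q k) (osub Q k)) \<and>
    (\<forall>k<odim P. \<forall>a\<in>nodes (otree P k). emap f (Suc k) (id a) = id (nmap f k a)) \<and>
    (\<forall>k<odim P. \<forall>d\<in>white_dots (otree P k) (osub P k).
       nmap f (Suc k) (snd d) = snd (wmap f k d))}"

definition KJBM :: "('v opetope, 'v opmap) category" where
  "KJBM = \<lparr>Obj = {P. is_opetope P}, Hom = opetope_iso,
     Idn = (\<lambda>P. \<lparr>nmap = (\<lambda>k. restrict id (onodes P k)), emap = (\<lambda>k. restrict id (oedges P k)),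
       wmap = (\<lambda>k. restrict id (owhite P k))\<rparr>),
     Cmp = (\<lambda>P Q R g f. \<lparr>nmap = (\<lambda>k. compose (onodes P k) (nmap g k) (nmap f k)),
       emap = (\<lambda>k. compose (oedges P k) (emap g k) (emap f k)),
       wmap = (\<lambda>k. compose (owhite P k) (wmap g k) (wmap f k))\<rparr>)\<rparr>"

section \<open>The order \<open>\<blacktriangleleft>\<close>\<close>

definition loop_subset1 :: "'a mop \<Rightarrow> 'a \<Rightarrow> 'a \<Rightarrow> 'a \<Rightarrow> bool" where
  "loop_subset1 C c b' b \<longleftrightarrow> prec C 0 c b' \<and> prec C 0 c b \<and>
     (\<exists>a\<in>Lam C. prec C 1 b a \<and> prec C (-1) b' a)"

definition loop_subset :: "'a mop \<Rightarrow> 'a \<Rightarrow> 'a \<Rightarrow> 'a \<Rightarrow> bool" where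
  "loop_subset C c = (loop_subset1 C c)\<^sup>*\<^sup>*"

text \<open>The zig-zag \<open>b 1, a 1, b 2, \<dots>, a (q - 1), b q\<close>, with left part \<open>b 1, \<dots>, b p\<close>, lists without
  repetition all chains \<open>c \<prec>\<^sup>\<beta> b \<prec>\<^sup>\<alpha> a\<close> with \<open>a \<in> \<Lambda>\<close> and \<open>\<alpha>, \<beta> \<noteq> \<circ>\<close>. The chains through \<open>a i\<close> are
  those of \<open>b i\<close> and \<open>b (i + 1)\<close>. The left part is empty for \<open>p = 0\<close>, the right part for \<open>p = q\<close>.\<close>

definition zigzag ::
  "'a mop \<Rightarrow> 'a \<Rightarrow> nat \<Rightarrow> nat \<Rightarrow> (nat \<Rightarrow> 'a) \<Rightarrow> (nat \<Rightarrow> 'a) \<Rightarrow> bool" where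
  "zigzag C c p q b a \<longleftrightarrow> p \<le> q \<and>
    (\<forall>i\<in>{1..q}. prec C (if i \<le> p then -1 else 1) c (b i)) \<and>
    (\<forall>i\<in>{1..<q}. a i \<in> Lam C \<and>
       (i < p \<longrightarrow> prec C (-1) (b i) (a i) \<and> prec C 1 (b (Suc i)) (a i)) \<and>
       (i = p \<longrightarrow> prec C (-1) (b i) (a i) \<and> prec C (-1) (b (Suc i)) (a i)) \<and>
       (i > p \<longrightarrow> prec C 1 (b i) (a i) \<and> prec C (-1) (b (Suc i)) (a i))) \<and>
    inj_on a {1..<q} \<and>
    (\<forall>x\<in>Lam C. \<forall>y \<alpha> \<beta>. \<alpha> \<noteq> 0 \<and> \<beta> \<noteq> 0 \<and> prec C \<beta> c y \<and> prec C \<alpha> y x \<longrightarrow>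
       (\<exists>i\<in>{1..<q}. x = a i \<and> (y = b i \<or> y = b (Suc i))))"

definition before1 :: "'a mop \<Rightarrow> 'a \<Rightarrow> 'a \<Rightarrow> 'a \<Rightarrow> bool" where
  "before1 C c u u' \<longleftrightarrow>
    (\<exists>p q b a i j v v'. zigzag C c p q b a \<and>
       i \<in> {1..<q} \<and> j \<in> {1..<q} \<and> i < j \<and>
       prec C 0 c v \<and> prec C (-1) v (a i) \<and> prec C 0 c v' \<and> prec C (-1) v' (a j) \<and>
       loop_subset C c u v \<and> loop_subset C c u' v')"

text \<open>\<open>loop_path C c p a b\<close>: cells \<open>a 0, \<dots>, a p\<close> of \<open>\<Lambda>\<close> and loops \<open>b 0, \<dots>, b (p - 1)\<close> on \<open>c\<close> with
  \<open>a i \<succ>\<^sup>+ b i \<prec>\<^sup>- a (i + 1)\<close>.\<close>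

definition loop_path :: "'a mop \<Rightarrow> 'a \<Rightarrow> nat \<Rightarrow> (nat \<Rightarrow> 'a) \<Rightarrow> (nat \<Rightarrow> 'a) \<Rightarrow> bool" where
  "loop_path C c p a b \<longleftrightarrow> (\<forall>i\<le>p. a i \<in> Lam C) \<and>
     (\<forall>i<p. prec C 0 c (b i) \<and> prec C 1 (b i) (a i) \<and> prec C (-1) (b i) (a (Suc i)))"

definition before2 :: "'a mop \<Rightarrow> 'a \<Rightarrow> 'a \<Rightarrow> 'a \<Rightarrow> bool" where
  "before2 C c u u' \<longleftrightarrow>
    u \<noteq> u' \<and> \<not> before1 C c u u' \<and> \<not> before1 C c u' u \<and>
    (\<exists>p q a b a' b'. p \<ge> 1 \<and> q \<ge> 1 \<and>
       loop_path C c p a b \<and> b 0 = u \<and> a 0 \<in> Lam C \<inter> null_cells C \<and>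
       loop_path C c q a' b' \<and> b' 0 = u' \<and> a' 0 \<in> Lam C \<inter> null_cells C \<and>
       a p = a' q \<and> b (p - 1) \<noteq> b' (q - 1) \<and>
       (b (p - 1), b' (q - 1)) \<in> lorder C (a p) c)"

definition null_loops :: "'a mop \<Rightarrow> 'a \<Rightarrow> 'a set" where
  "null_loops C c = {b. prec C 0 c b \<and> (\<exists>a\<in>Lam C \<inter> null_cells C. prec C 1 b a)}"

definition before :: "'a mop \<Rightarrow> 'a \<Rightarrow> 'a \<Rightarrow> 'a \<Rightarrow> bool" where
  "before C c u u' \<longleftrightarrow> u \<in> null_loops C c \<and> u' \<in> null_loops C c \<and>
     (before1 C c u u' \<or> before2 C c u u')"

section \<open>The construction \<open>Z\<close>\<close>

definition omega :: "'a mop \<Rightarrow> 'a" where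
  "omega C = (THE w. is_greatest C w)"

definition dfc_dim :: "'a mop \<Rightarrow> nat" where
  "dfc_dim C = nat (dim C (omega C))"

definition iter_tgt :: "'a mop \<Rightarrow> nat \<Rightarrow> 'a" where
  "iter_tgt C k = (tgt C ^^ (dfc_dim C - k)) (omega C)"

text \<open>The trees \<open>T\<^sub>0\<close> and \<open>T\<^sub>1\<close> need elements that are not cells: the root and the leaf of each.\<close>

datatype 'a zelt = Cell 'a | Leaf0 | Root0 | Leaf1 | Root1

definition Z_tree_cells :: "'a mop \<Rightarrow> nat \<Rightarrow> ('a zelt, 'a zelt) rtree" where
  "Z_tree_cells C k =
    (let A = {x \<in> Lam C. dim C x = int k - 1}; B = {y \<in> cells C. dim C y = int k - 2} in
     \<lparr>nodes = Cell ` A, edges = Cell ` B,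
      is_src = (\<lambda>b a. \<exists>y\<in>B. \<exists>x\<in>A. b = Cell y \<and> a = Cell x \<and> prec C (-1) y x),
      is_tgt = (\<lambda>b a. \<exists>y\<in>B. \<exists>x\<in>A. b = Cell y \<and> a = Cell x \<and> prec C 1 y x),
      root = Cell (iter_tgt C (k - 2))\<rparr>)"

text \<open>The nodes of \<open>T\<^sub>1\<close> are the leaves of \<open>T\<^sub>2\<close>; that there is exactly one is part of \<open>unit_tree\<close>.
  Similarly the node of \<open>T\<^sub>0\<close> is the leaf of \<open>T\<^sub>1\<close>.\<close>

definition Z_tree :: "'a mop \<Rightarrow> nat \<Rightarrow> ('a zelt, 'a zelt) rtree" where
  "Z_tree C k =
    (if k = 0 then
       \<lparr>nodes = {Leaf1}, edges = {Leaf0, Root0},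
        is_src = (\<lambda>b a. b = Leaf0 \<and> a = Leaf1),
        is_tgt = (\<lambda>b a. b = Root0 \<and> a = Leaf1), root = Root0\<rparr>
     else if k = 1 then
       \<lparr>nodes = leaves (Z_tree_cells C 2), edges = {Leaf1, Root1},
        is_src = (\<lambda>b a. b = Leaf1 \<and> a \<in> leaves (Z_tree_cells C 2)),
        is_tgt = (\<lambda>b a. b = Root1 \<and> a \<in> leaves (Z_tree_cells C 2)), root = Root1\<rparr>
     else Z_tree_cells C k)"

definition Z_dots :: "'a mop \<Rightarrow> nat \<Rightarrow> 'a \<Rightarrow> 'a set" where
  "Z_dots C k y = {w \<in> Lam C \<inter> null_cells C. dim C w = int k \<and> tgt C (tgt C w) = y}"

definition Z_sub :: "'a mop \<Rightarrow> nat \<Rightarrow> ('a zelt, 'a zelt) subdiv" where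
  "Z_sub C k =
    (if k < 2 then \<lparr>wset = (\<lambda>_. {}), wless = (\<lambda>_. {})\<rparr>
     else \<lparr>wset = (\<lambda>e. {Cell w | w y. e = Cell y \<and> w \<in> Z_dots C k y}),
           wless = (\<lambda>e. {(Cell w, Cell w') | w w' y. e = Cell y \<and>
              w \<in> Z_dots C k y \<and> w' \<in> Z_dots C k y \<and> before C y (tgt C w) (tgt C w')})\<rparr>)"

definition Z_obj :: "'a mop \<Rightarrow> 'a zelt opetope" where
  "Z_obj C = \<lparr>odim = dfc_dim C, otree = Z_tree C, osub = Z_sub C\<rparr>"

text \<open>\<open>map_zelt f\<close> is \<open>f\<close> on cells and fixes the roots and leaves of \<open>T\<^sub>0\<close> and \<open>T\<^sub>1\<close>.\<close>

definition Z_map :: "'a mop \<Rightarrow> 'a mop \<Rightarrow> ('a \<Rightarrow> 'a) \<Rightarrow> 'a zelt opmap" where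
  "Z_map C D f =
    \<lparr>nmap = (\<lambda>k. restrict (map_zelt f) (onodes (Z_obj C) k)),
     emap = (\<lambda>k. restrict (map_zelt f) (oedges (Z_obj C) k)),
     wmap = (\<lambda>k. restrict (map_prod (map_zelt f) (map_zelt f)) (owhite (Z_obj C) k))\<rparr>"

end

theory Submission
  imports Defs
begin

text \<open>Write \<open>\<rho>\<^sub>k\<close> for the \<open>k\<close>-dimensional iterated target of the greatest cell. A descending
  induction on the dimension shows that \<open>\<Lambda>\<close> in dimension \<open>k - 1\<close> is \<open>\<delta>(\<rho>\<^sub>k)\<close>: the tree \<open>T\<^sub>k\<close> is
  governed by thinness and acyclicity of the single cell \<open>\<rho>\<^sub>k\<close> (or is a corolla on \<open>\<rho>\<^sub>k\<^sub>-\<^sub>1\<close> when \<open>\<rho>\<^sub>k\<close>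
  is a loop), and its leaves are \<open>\<delta>(\<rho>\<^sub>k\<^sub>-\<^sub>1)\<close>.

  The cells \<open>b\<close> with \<open>c \<prec>\<^sup>- b\<close>, and likewise those with \<open>c \<prec>\<^sup>+ b\<close>, form a chain in the next tree; the two
  chains meet in at most one node, and this gives the zig-zag. Depth in the next tree, counted
  negatively on the left part, is a key that increases along the zig-zag, so that \<open>\<blacktriangleleft>\<close> becomes a
  lexicographic order on the null loops of \<open>c\<close>. For the kernel rule one follows the descending path of
  a dot in the next tree: on every edge other than the target edge the dots above a node form an
  initial segment together with the node below, on the target edge they form an interval, so that all
  but one of them have their parent among them.\<close>

section \<open>Sources and targets in a dendritic face complex\<close>

text \<open>The obstacle is the loops, to which thinness applies only weakly. What tames them is a
  consequence of acyclicity: along a descending path, once an edge is not a loop, no later edge is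
  (\<open>below_pos\<close>). A path that starts at a loop on \<open>c\<close> therefore either runs
  through loops on \<open>c\<close> down to the root, or leaves them for good at exactly one node,
  and that node belongs to the zig-zag of \<open>c\<close>. The exit node gives the first coordinate
  of the lexicographic order. The second is the local order at the node where two paths of loops
  merge. As the root either is a loop or is not, all loops on \<open>c\<close> fall under the same
  alternative, and this is why the order is total.

  Both the order and the kernel rule on \<open>Z_tree C k\<close> are expressed by the single
  relation \<open>below\<close> on the edges of the next tree. A black dot is such an edge, and a
  white dot is represented by its target edge, so the dots above a node \<open>x\<close> become the
  \<open>t\<close> with \<open>below t (tgt C x)\<close>.\<close>

lemma prec_cells:
  assumes "is_mop C" "prec C \<alpha> y x"
  shows "x \<in> cells C" "y \<in> cells C" "dim C y = dim C x - 1" "dim C x \<ge> 0"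
proof -
  show x: "x \<in> cells C" using assms(2) by (auto simp: prec_def)
  have y: "y \<in> delta C x \<union> gamma C x" using assms(2) by (auto simp: prec_def)
  have "delta C x \<subseteq> {y \<in> cells C. dim C y = dim C x - 1}"
    "gamma C x \<subseteq> {y \<in> cells C. dim C y = dim C x - 1}"
    using assms(1) x unfolding is_mop_def by auto
  then show c: "y \<in> cells C" and d: "dim C y = dim C x - 1" using y by auto
  have "dim C y \<ge> -1" using assms(1) c unfolding is_mop_def by auto
  then show "dim C x \<ge> 0" using d by simp
qed

lemma gamma_tgt:
  assumes "is_mop C" "x \<in> cells C" "dim C x \<ge> 0"
  shows "gamma C x = {tgt C x}"
proof -
  have "is_singleton (gamma C x)" using assms unfolding is_mop_def by auto
  then show ?thesis unfolding tgt_def by (metis is_singleton_the_elem)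
qed

locale dfc =
  fixes C :: "'a mop"
  assumes dfc: "is_dfc C"
begin

abbreviation pos where "pos y x \<equiv> prec C 1 y x"
abbreviation neg where "neg y x \<equiv> prec C (-1) y x"
abbreviation lop where "lop y x \<equiv> prec C 0 y x"

lemma mop: "is_mop C" using dfc by (simp add: is_dfc_def)

lemma finite_cells: "finite (cells C)" using mop by (simp add: is_mop_def)

lemma precD:
  assumes "prec C \<alpha> y x"
  shows "x \<in> cells C" "y \<in> cells C" "dim C y = dim C x - 1" "dim C x \<ge> 0"
  using prec_cells[OF mop assms] by auto

lemma dim_ge: "x \<in> cells C \<Longrightarrow> dim C x \<ge> -1" using mop by (simp add: is_mop_def)

lemma gamma_eq: "x \<in> cells C \<Longrightarrow> dim C x \<ge> 0 \<Longrightarrow> gamma C x = {tgt C x}"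
  using gamma_tgt[OF mop] by auto

lemma tgt_cell:
  assumes "x \<in> cells C" "dim C x \<ge> 0"
  shows "tgt C x \<in> cells C" "dim C (tgt C x) = dim C x - 1"
proof -
  have "gamma C x \<subseteq> {y \<in> cells C. dim C y = dim C x - 1}"
    using mop assms unfolding is_mop_def by auto
  then show "tgt C x \<in> cells C" "dim C (tgt C x) = dim C x - 1"
    using gamma_eq[OF assms] by auto
qed

lemma pos_tgt: assumes "pos y x" shows "y = tgt C x"
proof -
  have "y \<in> gamma C x" using assms by (auto simp: prec_def)
  then show ?thesis using gamma_eq precD(1,4)[OF assms] by auto
qed

lemma lop_tgt: assumes "lop y x" shows "y = tgt C x"
proof -
  have "y \<in> gamma C x" using assms by (auto simp: prec_def)
  then show ?thesis using gamma_eq precD(1,4)[OF assms] by auto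
qed

lemma lop_delta: assumes "lop y x" shows "delta C x = {y}"
proof -
  have "delta C x \<inter> gamma C x \<noteq> {}" using assms by (auto simp: prec_def)
  then have "delta C x = gamma C x" using mop precD[OF assms] unfolding is_mop_def by auto
  then show ?thesis using gamma_eq precD[OF assms] lop_tgt[OF assms] by auto
qed

lemma lop_or_pos:
  assumes "x \<in> cells C" "dim C x \<ge> 0"
  shows "lop (tgt C x) x \<or> pos (tgt C x) x"
  using gamma_eq[OF assms] assms by (auto simp: prec_def)

lemma lop_gamma: "lop y x \<Longrightarrow> gamma C x = {y}"
  using gamma_eq[OF precD(1,4)] lop_tgt by metis

lemma not_lop_pos: assumes "lop y x" shows "\<not> pos z x"
  by (simp add: prec_def lop_delta[OF assms] lop_gamma[OF assms])

lemma not_lop_neg: assumes "lop y x" shows "\<not> neg z x"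
  by (simp add: prec_def lop_delta[OF assms] lop_gamma[OF assms])

lemma not_pos_neg: "pos y x \<Longrightarrow> \<not> neg y x" 
  by (auto simp: prec_def)

lemma neg_pos_tgt: "neg y x \<Longrightarrow> pos (tgt C x) x"
  using lop_or_pos[of x] precD[of "-1" y x] not_lop_neg by blast

text \<open>An assumption \<open>pos z x\<close> is the form in which "\<open>x\<close> is not a
  loop" is passed around. Outside loops no source equals the target, so signs and
  \<open>delta\<close> carry the same information.\<close>

lemma delta_neg:
  assumes "pos z x" shows "delta C x = {y. neg y x}"
proof -
  have "pos (tgt C x) x" using assms pos_tgt by metis
  then have "tgt C x \<notin> delta C x" by (auto simp: prec_def)
  then show ?thesis using gamma_eq[of x] precD[OF assms] by (auto simp: prec_def)
qed

lemma prec_sign: "prec C \<alpha> y x \<Longrightarrow> \<alpha> = 1 \<or> \<alpha> = -1 \<or> \<alpha> = 0"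
  by (auto simp: prec_def)

lemma prec_sign_unique: "prec C \<alpha> y x \<Longrightarrow> prec C \<beta> y x \<Longrightarrow> \<alpha> = \<beta>"
  by (auto simp: prec_def)

section \<open>Consequences of oriented thinness\<close>

lemma thin_ex1:
  assumes "\<alpha> \<noteq> 0" "\<beta> \<noteq> 0" "prec C \<beta> z y" "prec C \<alpha> y x"
  obtains y' where "\<exists>\<alpha>' \<beta>'. \<alpha>' \<noteq> 0 \<and> \<beta>' \<noteq> 0 \<and> prec C \<beta>' z y' \<and> prec C \<alpha>' y' x \<and>
             \<alpha> * \<beta> = - (\<alpha>' * \<beta>')" "y' \<noteq> y"
     "\<forall>y'' \<alpha>' \<beta>'. y'' \<noteq> y \<and> \<alpha>' \<noteq> 0 \<and> \<beta>' \<noteq> 0 \<and>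
             prec C \<beta>' z y'' \<and> prec C \<alpha>' y'' x \<longrightarrow> y'' = y'"
proof -
  have "oriented_thinness C" using dfc by (simp add: is_dfc_def)
  from conjunct1[OF this[unfolded oriented_thinness_def], THEN spec[of _ x], THEN spec[of _ y],
      THEN spec[of _ z], THEN spec[of _ \<alpha>], THEN spec[of _ \<beta>], THEN mp] assms that
  show ?thesis by metis
qed

lemma thin:
  assumes "\<alpha> \<noteq> 0" "\<beta> \<noteq> 0" "prec C \<beta> z y" "prec C \<alpha> y x"
  obtains y' \<alpha>' \<beta>' where "y' \<noteq> y" "\<alpha>' \<noteq> 0" "\<beta>' \<noteq> 0" "prec C \<beta>' z y'" "prec C \<alpha>' y' x"
     "\<alpha> * \<beta> = - (\<alpha>' * \<beta>')"
  using thin_ex1[OF assms] by metis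

text \<open>Chains from \<open>z\<close> to \<open>x\<close> without the sign 0 come in pairs. By
  uniqueness of the partner any two distinct ones form such a pair, so the sign rule holds for
  arbitrary two of them.\<close>

lemma thin_opp:
  assumes "\<alpha> \<noteq> 0" "\<beta> \<noteq> 0" "prec C \<beta> z y" "prec C \<alpha> y x"
    "\<alpha>' \<noteq> 0" "\<beta>' \<noteq> 0" "prec C \<beta>' z y'" "prec C \<alpha>' y' x" "y \<noteq> y'"
  shows "\<alpha> * \<beta> = - (\<alpha>' * \<beta>')"
proof -
  obtain w where w: "\<exists>\<alpha>' \<beta>'. \<alpha>' \<noteq> 0 \<and> \<beta>' \<noteq> 0 \<and> prec C \<beta>' z w \<and> prec C \<alpha>' w x \<and>
             \<alpha> * \<beta> = - (\<alpha>' * \<beta>')"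
     and u: "\<forall>y'' \<alpha>' \<beta>'. y'' \<noteq> y \<and> \<alpha>' \<noteq> 0 \<and> \<beta>' \<noteq> 0 \<and>
             prec C \<beta>' z y'' \<and> prec C \<alpha>' y'' x \<longrightarrow> y'' = w"
    using thin_ex1[OF assms(1-4)] .
  have w': "y' = w"
    using u[THEN spec[of _ y'], THEN spec[of _ \<alpha>'], THEN spec[of _ \<beta>']] assms by simp
  obtain \<alpha>2 \<beta>2 where w: "prec C \<beta>2 z w" "prec C \<alpha>2 w x" "\<alpha> * \<beta> = - (\<alpha>2 * \<beta>2)" using w by blast
  have "\<alpha>2 = \<alpha>'" "\<beta>2 = \<beta>'"
    using prec_sign_unique[OF w(1)] prec_sign_unique[OF w(2)] assms(7,8) w' by auto
  then show ?thesis using w(3) by simp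
qed

lemma thin_pos_pos: assumes "pos y x" "pos z y" obtains y' where "neg y' x" "pos z y'"
proof -
  obtain y' \<alpha>' \<beta>' where w: "y' \<noteq> y" "\<alpha>' \<noteq> 0" "\<beta>' \<noteq> 0" "prec C \<beta>' z y'" "prec C \<alpha>' y' x" "1 * 1 = - (\<alpha>' * \<beta>')"
    using thin[OF _ _ assms(2,1)] by (metis one_neq_zero zero_neq_neg_one)
  then have "\<alpha>' \<noteq> 1" using pos_tgt assms by metis
  then show ?thesis using w prec_sign[OF w(4)] prec_sign[OF w(5)] that by auto
qed

lemma thin_pos_neg: assumes "pos y x" "neg z y" obtains y' where "neg y' x" "neg z y'"
proof -
  obtain y' \<alpha>' \<beta>' where w: "y' \<noteq> y" "\<alpha>' \<noteq> 0" "\<beta>' \<noteq> 0" "prec C \<beta>' z y'" "prec C \<alpha>' y' x" "1 * (-1) = - (\<alpha>' * \<beta>')"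
    using thin[OF _ _ assms(2,1)] by (metis one_neq_zero zero_neq_neg_one)
  then have "\<alpha>' \<noteq> 1" using pos_tgt assms by metis
  then show ?thesis using w prec_sign[OF w(4)] prec_sign[OF w(5)] that by auto
qed

lemma thin_neg_pos:
  assumes "neg y x" "pos z y"
  shows "pos (tgt C x) x \<and> pos z (tgt C x) \<or> (\<exists>y'. neg y' x \<and> neg z y')"
proof -
  obtain y' \<alpha>' \<beta>' where w: "y' \<noteq> y" "\<alpha>' \<noteq> 0" "\<beta>' \<noteq> 0" "prec C \<beta>' z y'" "prec C \<alpha>' y' x" "(-1) * 1 = - (\<alpha>' * \<beta>')"
    using thin[OF _ _ assms(2,1)] by (metis one_neq_zero zero_neq_neg_one)
  have "\<alpha>' = 1 \<and> \<beta>' = 1 \<or> \<alpha>' = -1 \<and> \<beta>' = -1"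
    using w prec_sign[OF w(4)] prec_sign[OF w(5)] by auto
  then show ?thesis using w pos_tgt by metis
qed

lemma thin_neg_neg:
  assumes "neg y x" "neg z y"
  shows "pos (tgt C x) x \<and> neg z (tgt C x) \<or> (\<exists>y'. neg y' x \<and> pos z y')"
proof -
  obtain y' \<alpha>' \<beta>' where w: "y' \<noteq> y" "\<alpha>' \<noteq> 0" "\<beta>' \<noteq> 0" "prec C \<beta>' z y'" "prec C \<alpha>' y' x" "(-1) * (-1) = - (\<alpha>' * \<beta>')"
    using thin[OF _ _ assms(2,1)] by (metis one_neq_zero zero_neq_neg_one)
  have "\<alpha>' = 1 \<and> \<beta>' = -1 \<or> \<alpha>' = -1 \<and> \<beta>' = 1"
    using w prec_sign[OF w(4)] prec_sign[OF w(5)] by auto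
  then show ?thesis using w pos_tgt by metis
qed

text \<open>Two distinct middle cells would give equal sign products, against the sign rule. The
  following lemmas exclude sign patterns in the same way.\<close>

lemma neg_pos_unique:
  assumes "neg y x" "neg y' x" "pos z y" "pos z y'" shows "y = y'"
  using thin_opp[of "-1" 1 z y x "-1" 1 y'] assms by auto

lemma neg_neg_unique:
  assumes "neg y x" "neg y' x" "neg z y" "neg z y'" shows "y = y'"
  using thin_opp[of "-1" "-1" z y x "-1" "-1" y'] assms by auto

lemma pos_pos_excl:
  assumes "pos y x" "pos z y" "neg y' x" shows "\<not> neg z y'"
  using thin_opp[of "1" "1" z y x "-1" "-1" y'] assms not_pos_neg by auto

lemma pos_neg_excl:
  assumes "pos y x" "neg z y" "neg y' x" shows "\<not> pos z y'"
  using thin_opp[of "1" "-1" z y x "-1" "1" y'] assms not_pos_neg by auto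

text \<open>A chain through the target would have the same sign product as the chain through
  \<open>y\<close> or the one through \<open>y'\<close>.\<close>

lemma neg_neg_pos_excl:
  assumes "neg y x" "pos z y" "neg y' x" "neg z y'"
  shows "\<not> pos z (tgt C x)" "\<not> neg z (tgt C x)"
  using pos_pos_excl[OF neg_pos_tgt[OF assms(1)]] pos_neg_excl[OF neg_pos_tgt[OF assms(1)]] assms
  by auto

text \<open>Normal form of the loop clause of thinness: if the target of \<open>x\<close> meets
  \<open>z\<close> with a nonzero sign, thinness trades it for a source with the same property, so
  the target is left only with the case where it is itself a loop on \<open>z\<close>.\<close>

lemma thin_lop:
  assumes "lop z y" "neg y x"
  shows "lop z (tgt C x) \<or> (\<exists>y'. neg y' x \<and> (pos z y' \<or> neg z y'))"
proof -
  obtain y' \<alpha> \<beta> where w: "prec C \<beta> z y'" "prec C \<alpha> y' x" "(\<alpha>, \<beta>) \<noteq> (-1, 0)"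
    proof -
    have "oriented_thinness C" using dfc by (simp add: is_dfc_def)
    from conjunct2[OF this[unfolded oriented_thinness_def], THEN spec[of _ x], THEN spec[of _ y],
      THEN spec[of _ z], THEN mp] assms that show ?thesis by blast
  qed
  have a0: "\<alpha> \<noteq> 0" using not_lop_neg assms w by metis
  show ?thesis
  proof (cases "\<alpha> = 1")
    case True
    then have y': "y' = tgt C x" using w pos_tgt by auto
    show ?thesis
    proof (cases "\<beta> = 0")
      case True then show ?thesis using w y' by auto
    next
      case False
      then have "\<beta> = 1 \<or> \<beta> = -1" using prec_sign[OF w(1)] by auto
      then show ?thesis using w True thin_pos_pos[of y' x z] thin_pos_neg[of y' x z] by metis
    qed
  next
    case False
    then have "\<alpha> = -1" using a0 prec_sign[OF w(2)] by auto
    then show ?thesis using w prec_sign[OF w(1)] by auto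
  qed
qed

text \<open>A pair \<open>(y, y')\<close> says that the target of \<open>y'\<close> is a source of
  \<open>y\<close>, so \<open>y\<close> is the one nearer the root. Well-founded induction on this
  relation walks towards the root.\<close>

lemma acyc:
  "acyclic {(y, y'). neg y x \<and> neg y' x \<and> pos (tgt C y') y' \<and> neg (tgt C y') y}" (is "acyclic ?q")
proof (rule ccontr)
  assume "\<not> acyclic ?q"
  then obtain y where "(y, y) \<in> ?q\<^sup>+" by (auto simp: acyclic_def)
  then obtain p where p: "p > 0" "(y, y) \<in> ?q ^^ p" using trancl_power by blast
  then obtain f where f: "f 0 = y" "f p = y" "\<forall>i<p. (f i, f (Suc i)) \<in> ?q"
    by (auto simp: relpow_fun_conv)
  \<comment> \<open>A closed walk has \<open>f p = f 0\<close>, so indices may be read modulo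
    \<open>p\<close>, as in the axiom.\<close>
  have "f (Suc i) = f (Suc i mod p)" if "i < p" for i
    using that f by (cases "Suc i = p") auto
  then have F: "\<forall>i<p. (f i, f (Suc i mod p)) \<in> ?q" using f(3) by auto
  then have n: "neg (f 0) x" using p by auto
  have "dim C (f (Suc 0 mod p)) \<ge> 0" using F p(1) precD(4) by blast
  moreover have "neg (f (Suc 0 mod p)) x" using F p(1) by blast
  ultimately have "dim C x \<ge> 1" using precD by fastforce
  moreover have "x \<in> cells C" using n precD by auto
  ultimately show False using dfc F p(1) unfolding is_dfc_def acyclicity_def
    by (metis (no_types, lifting) One_nat_def Suc_leI case_prodD mem_Collect_eq)
qed

text \<open>Walk towards the root: by thinness the target \<open>z\<close> of a non-loop source of
  \<open>x\<close> is either the target of \<open>tgt C x\<close>, as wanted, or a source of a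
  further source of \<open>x\<close>, which is then not a loop either. Acyclicity ends the
  walk.\<close>

lemma pos_tgt_tgt:
  assumes "neg y x" "pos z y"
  shows "pos (tgt C (tgt C x)) (tgt C x)"
proof -
  let ?q = "{(y, y'). neg y x \<and> neg y' x \<and> pos (tgt C y') y' \<and> neg (tgt C y') y}"
  have "finite ?q"
    by (rule finite_subset[of _ "cells C \<times> cells C"]) (auto simp: finite_cells dest: precD)
  then have wf: "wf ?q" using acyc finite_acyclic_wf by blast
  have "\<And>z. neg y x \<Longrightarrow> pos z y \<Longrightarrow> ?thesis"
  proof (induction y rule: wf_induct_rule[OF wf])
    case (1 y)
    have z: "z = tgt C y" using 1 pos_tgt by auto
    from thin_neg_pos[OF 1(2,3)] show ?case
    proof
      assume "pos (tgt C x) x \<and> pos z (tgt C x)"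
      then show ?thesis using pos_tgt by metis
    next
      assume "\<exists>y'. neg y' x \<and> neg z y'"
      then obtain y' where y': "neg y' x" "neg z y'" by auto
      then have "(y', y) \<in> ?q" using 1 z by auto
      then show ?thesis using 1(1) y' neg_pos_tgt by blast
    qed
  qed
  then show ?thesis using assms by auto
qed

text \<open>By \<open>pos_tgt_tgt\<close>, a loop as target forces every source to be a loop. No
  source then meets anything with a nonzero sign, so \<open>thin_lop\<close> leaves only its first
  alternative, which puts the source and the target over the same cell.\<close>

lemma lop_tgt_sources:
  assumes "lop z (tgt C x)" "neg y x"
  shows "lop z y"
proof -
  have y: "y \<in> cells C" "dim C y \<ge> 0"
    using precD(2,3)[OF assms(2)] precD(3,4)[OF assms(1)] tgt_cell[of x] precD(1,4)[OF assms(2)] by auto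
  have np: "\<not> pos z' y'" if "neg y' x" for y' z'
    using pos_tgt_tgt[OF that] not_lop_pos[OF assms(1)] by metis
  then have l: "lop (tgt C y) y" using lop_or_pos[OF y] assms(2) by blast
  have "neg z' y' \<Longrightarrow> \<not> neg y' x" for y' z' using np neg_pos_tgt by blast
  then have "lop (tgt C y) (tgt C x)" using thin_lop[OF l assms(2)] np by blast
  then show ?thesis using l lop_tgt assms by metis
qed

text \<open>If the target were not a loop, thinness would match its own target with the target of
  some source of \<open>x\<close>, but \<open>x\<close> has no source.\<close>

lemma null_tgt_lop:
  assumes "x \<in> cells C" "dim C x \<ge> 1" "\<And>y. \<not> neg y x" "pos (tgt C x) x"
  shows "lop (tgt C (tgt C x)) (tgt C x)"
proof -
  have "tgt C x \<in> cells C" "dim C (tgt C x) \<ge> 0" using tgt_cell[of x] assms by auto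
  moreover have "\<not> pos (tgt C (tgt C x)) (tgt C x)" using thin_pos_pos[OF assms(4)] assms(3) by blast
  ultimately show ?thesis using lop_or_pos by blast
qed

lemma Lam_iff: "x \<in> Lam C \<longleftrightarrow> x \<in> cells C \<and> (\<forall>a. \<not> pos x a)"
  by (auto simp: Lam_def prec_def)

text \<open>The loops axiom makes every loop the target of some cell, so the nodes of the trees are
  never loops.\<close>

lemma Lam_nonloop: assumes "x \<in> Lam C" shows "\<not> lop y x"
proof -
  have "loops_axiom C" using dfc by (simp add: is_dfc_def)
  then show ?thesis using assms unfolding loops_axiom_def Lam_iff by blast
qed

lemma Lam_cells: "x \<in> Lam C \<Longrightarrow> x \<in> cells C" by (auto simp: Lam_def)

lemma Lam_pos: "x \<in> Lam C \<Longrightarrow> dim C x \<ge> 0 \<Longrightarrow> pos (tgt C x) x"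
  using lop_or_pos Lam_nonloop Lam_cells by blast

section \<open>The greatest cell and its iterated targets\<close>

lemma boundaryD:
  assumes "x \<in> cells C" "y \<in> boundary C x"
  shows "y \<in> cells C" "dim C y = dim C x - 1" "dim C x \<ge> 0"
proof -
  have "delta C x \<subseteq> {y \<in> cells C. dim C y = dim C x - 1}"
    "gamma C x \<subseteq> {y \<in> cells C. dim C y = dim C x - 1}"
    using mop assms unfolding is_mop_def by auto
  then show y: "y \<in> cells C" and d: "dim C y = dim C x - 1" using assms by (auto simp: boundary_def)
  then show "dim C x \<ge> 0" using dim_ge[OF y] by simp
qed

lemma boundary_prec:
  "x \<in> cells C \<Longrightarrow> y \<in> boundary C x \<longleftrightarrow> pos y x \<or> neg y x \<or> lop y x"
  by (auto simp: boundary_def prec_def)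

lemma cell_le_dim: "cell_le C y x \<Longrightarrow> y = x \<or> dim C y < dim C x"
proof -
  assume "cell_le C y x"
  then have "(\<lambda>y x. x \<in> cells C \<and> y \<in> boundary C x)\<^sup>*\<^sup>* y x" by (simp add: cell_le_def)
  then show ?thesis
  proof (induction rule: rtranclp_induct)
    case (step u v)
    then have "dim C u = dim C v - 1" using boundaryD(2) by blast
    then show ?case using step.IH by auto
  qed simp
qed

lemma greatest_dim: "is_greatest C w \<Longrightarrow> x \<in> cells C \<Longrightarrow> x = w \<or> dim C x < dim C w"
  using cell_le_dim by (auto simp: is_greatest_def)

lemma omega_greatest: "is_greatest C (omega C)" and omega_dim: "dim C (omega C) \<ge> 0"
proof -
  have "has_greatest C" using dfc by (simp add: is_dfc_def)
  then obtain w where w: "is_greatest C w" "dim C w \<ge> 0" by (auto simp: has_greatest_def)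
  have u: "w' = w" if w': "is_greatest C w'" for w'
  proof -
    have "w \<in> cells C" "w' \<in> cells C" using w' w by (auto simp: is_greatest_def)
    then show ?thesis using greatest_dim[OF w(1), of w'] greatest_dim[OF w', of w] by auto
  qed
  have o: "omega C = w" unfolding omega_def by (rule the_equality[of "is_greatest C", OF w(1) u])
  show "is_greatest C (omega C)" "dim C (omega C) \<ge> 0" unfolding o by (fact w)+
qed

lemma omega_cell: "omega C \<in> cells C" using omega_greatest by (simp add: is_greatest_def)

lemma dim_omega: "dim C (omega C) = int (dfc_dim C)"
  using omega_dim by (simp add: dfc_dim_def)

lemma dim_le: "x \<in> cells C \<Longrightarrow> dim C x \<le> int (dfc_dim C)"
  using greatest_dim[OF omega_greatest] dim_omega by fastforce

lemma dim_top: "x \<in> cells C \<Longrightarrow> dim C x = int (dfc_dim C) \<Longrightarrow> x = omega C"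
  using greatest_dim[OF omega_greatest] dim_omega by fastforce

text \<open>This is how the greatest element enters the induction on levels: every other cell is a
  face of something, hence gets attached to a tree.\<close>

lemma in_boundary:
  assumes "x \<in> cells C" "x \<noteq> omega C"
  obtains y where "y \<in> cells C" "x \<in> boundary C y"
proof -
  have "cell_le C x (omega C)" using assms omega_greatest by (auto simp: is_greatest_def)
  then show ?thesis using assms(2) that unfolding cell_le_def
    by (metis (no_types, lifting) converse_rtranclpE)
qed

lemma iter_tgt_Suc: "k < dfc_dim C \<Longrightarrow> iter_tgt C k = tgt C (iter_tgt C (Suc k))"
  unfolding iter_tgt_def by (metis Suc_diff_Suc funpow.simps(2) comp_apply)

lemma iter_tgt_top: "iter_tgt C (dfc_dim C) = omega C" by (simp add: iter_tgt_def)

lemma iter_tgt_cell: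
  assumes "k \<le> dfc_dim C"
  shows "iter_tgt C k \<in> cells C" "dim C (iter_tgt C k) = int k"
proof -
  have "iter_tgt C k \<in> cells C \<and> dim C (iter_tgt C k) = int k" using assms
  proof (induction rule: inc_induct)
    case base then show ?case using iter_tgt_top omega_cell dim_omega by auto
  next
    case (step k) then show ?case using tgt_cell[of "iter_tgt C (Suc k)"] iter_tgt_Suc[of k] by auto
  qed
  then show "iter_tgt C k \<in> cells C" "dim C (iter_tgt C k) = int k" by auto
qed

lemma omega_Lam: "omega C \<in> Lam C"
proof -
  have "\<not> pos (omega C) a" for a
  proof
    assume "pos (omega C) a"
    from precD[OF this] dim_le[of a] dim_omega show False by simp
  qed
  then show ?thesis using omega_cell by (simp add: Lam_iff)
qed

end

text \<open>Counting strict predecessors. A numerical rank can be minimised and compared, which is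
  how acyclicity is used from here on.\<close>

lemma finite_acyclic_rank:
  assumes "finite r" "acyclic r"
  shows "\<exists>d :: 'b \<Rightarrow> nat. \<forall>a b. (a, b) \<in> r \<longrightarrow> d a < d b"
proof -
  have fin: "finite {a. (a, b) \<in> r\<^sup>+}" for b
    by (rule finite_subset[of _ "Domain r"]) (use assms in \<open>auto dest: tranclD simp: finite_Domain\<close>)
  have "card {c. (c, a) \<in> r\<^sup>+} < card {c. (c, b) \<in> r\<^sup>+}" if "(a, b) \<in> r" for a b
  proof (rule psubset_card_mono[OF fin])
    have "a \<in> {c. (c, b) \<in> r\<^sup>+}" "a \<notin> {c. (c, a) \<in> r\<^sup>+}" using that assms by (auto simp: acyclic_def)
    then show "{c. (c, a) \<in> r\<^sup>+} \<subset> {c. (c, b) \<in> r\<^sup>+}" using that trancl_into_trancl by fastforce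
  qed
  then show ?thesis by (intro exI[of _ "\<lambda>b. card {c. (c, b) \<in> r\<^sup>+}"]) simp
qed

section \<open>The trees of a dendritic face complex\<close>
context dfc begin

text \<open>What the induction needs about the tree with edges in dimension \<open>j - 1\<close> and
  nodes in dimension \<open>j\<close>: each edge has at most one source node and at most one target
  node, exactly the root has no target node, depth decreases towards the root, and the leaves are
  the sources of \<open>iter_tgt C j\<close>. The last clause says that an edge outside
  \<open>\<Lambda>\<close> is the target of a cell of \<open>\<Lambda>\<close>, not merely of some
  cell.\<close>

definition level :: "nat \<Rightarrow> bool" where
  "level j \<longleftrightarrow>
    (\<forall>a\<in>Lam C. \<forall>a'\<in>Lam C. \<forall>b. dim C b = int j - 1 \<and> pos b a \<and> pos b a' \<longrightarrow> a = a') \<and>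
    (\<forall>a\<in>Lam C. \<forall>a'\<in>Lam C. \<forall>b. dim C b = int j - 1 \<and> neg b a \<and> neg b a' \<longrightarrow> a = a') \<and>
    (\<forall>a\<in>Lam C. \<not> neg (iter_tgt C (j - 1)) a) \<and>
    (\<forall>b\<in>cells C. dim C b = int j - 1 \<and> b \<noteq> iter_tgt C (j - 1) \<longrightarrow> (\<exists>a\<in>Lam C. neg b a)) \<and>
    (\<exists>d :: 'a \<Rightarrow> nat. \<forall>a\<in>Lam C. \<forall>b b'. dim C b = int j - 1 \<and> neg b a \<and> pos b' a \<longrightarrow> d b' < d b) \<and>
    (\<forall>b\<in>cells C. dim C b = int j - 1 \<longrightarrow> (b \<in> Lam C \<longleftrightarrow> b \<in> delta C (iter_tgt C j))) \<and>
    (\<forall>b\<in>cells C. dim C b = int j - 1 \<and> b \<notin> Lam C \<longrightarrow> (\<exists>a\<in>Lam C. pos b a))"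

text \<open>The node set has one of two shapes: a single node (a corolla), or the sources of a cell
  \<open>x\<close> with target \<open>iter_tgt C j\<close>, where thinness and acyclicity at
  \<open>x\<close> give the tree structure. The second shape includes the tree without nodes. The
  assumptions \<open>cover\<close> and \<open>climb\<close> are what has to be brought down from the
  level above.\<close>

lemma level_of_nodes:
  assumes j: "1 \<le> j" "j \<le> dfc_dim C"
    and nodes: "{a \<in> Lam C. dim C a = int j} = {iter_tgt C j} \<or>
      (\<exists>x. pos (iter_tgt C j) x \<and> {a \<in> Lam C. dim C a = int j} = {y. neg y x})"
    and cover: "\<And>b. b \<in> cells C \<Longrightarrow> dim C b = int j - 1 \<Longrightarrow> b \<noteq> iter_tgt C (j - 1) \<Longrightarrow>
      \<exists>a\<in>Lam C. pos b a \<or> neg b a"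
    and climb: "\<And>b a. dim C b = int j - 1 \<Longrightarrow> pos b a \<Longrightarrow> \<exists>a\<in>Lam C. pos b a"
  shows "level j"
proof -
  let ?L = "{a \<in> Lam C. dim C a = int j}"
  let ?r = "iter_tgt C j" and ?s = "iter_tgt C (j - 1)"
  have s: "?s = tgt C ?r" using iter_tgt_Suc[of "j - 1"] j by auto
  have r: "?r \<in> cells C" "dim C ?r = int j" using iter_tgt_cell[of j] j by auto
  have in_L: "a \<in> ?L" if "a \<in> Lam C" "dim C b = int j - 1" "prec C \<alpha> b a" for a b \<alpha>
    using that precD(3)[OF that(3)] by auto
  have Lam_leaf: "b \<in> Lam C \<longleftrightarrow> (\<forall>a\<in>Lam C. \<not> pos b a)" if "b \<in> cells C" "dim C b = int j - 1" for b
    using climb[OF that(2)] that(1) by (auto simp: Lam_iff)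
  have s_dim: "dim C ?s = int j - 1" "?s \<in> cells C" using tgt_cell[of ?r] r j s by auto
  from nodes show ?thesis
  proof
    assume L: "?L = {?r}"
    then have rL: "?r \<in> Lam C" by auto
    have rp: "pos ?s ?r" using Lam_pos[OF rL] r s by auto
    have only: "a = ?r" if "a \<in> Lam C" "dim C b = int j - 1" "prec C \<alpha> b a" for a b \<alpha>
      using in_L[OF that] L by auto
    have leaf: "b \<in> Lam C \<longleftrightarrow> b \<in> delta C ?r" if b: "b \<in> cells C" "dim C b = int j - 1" for b
    proof -
      have "pos b ?r \<longleftrightarrow> \<not> neg b ?r"
      proof (cases "b = ?s")
        case True then show ?thesis using rp not_pos_neg by auto
      next
        case False
        then obtain a where "a \<in> Lam C" "pos b a \<or> neg b a" using cover b by blast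
        then show ?thesis using only[OF _ b(2)] not_pos_neg by blast
      qed
      then show ?thesis using delta_neg[OF rp] Lam_leaf[OF b] only[OF _ b(2)] rL by blast
    qed
    show ?thesis unfolding level_def
    proof (intro conjI)
      show "\<forall>a\<in>Lam C. \<not> neg ?s a" using only[OF _ s_dim(1)] rp not_pos_neg by metis
      show "\<forall>b\<in>cells C. dim C b = int j - 1 \<and> b \<noteq> ?s \<longrightarrow> (\<exists>a\<in>Lam C. neg b a)"
      proof (intro ballI impI)
        fix b assume b: "b \<in> cells C" "dim C b = int j - 1 \<and> b \<noteq> ?s"
        then obtain a where a: "a \<in> Lam C" "pos b a \<or> neg b a" using cover by blast
        then have "\<not> pos b a" using only b pos_tgt s by metis
        then show "\<exists>a\<in>Lam C. neg b a" using a by blast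
      qed
      \<comment> \<open>In a corolla the root edge gets depth 0 and every other edge depth
        1.\<close>
      show "\<exists>d :: 'a \<Rightarrow> nat. \<forall>a\<in>Lam C. \<forall>b b'. dim C b = int j - 1 \<and> neg b a \<and> pos b' a \<longrightarrow> d b' < d b"
      proof (intro exI[of _ "\<lambda>b. if b = ?s then 0 else 1"] ballI allI impI)
        fix a b b' assume a: "a \<in> Lam C" "dim C b = int j - 1 \<and> neg b a \<and> pos b' a"
        then have "a = ?r" using only by blast
        then have "b' = ?s" "b \<noteq> ?s" using a pos_tgt s not_pos_neg rp by metis+
        then show "(if b' = ?s then 0 else 1) < (if b = ?s then 0 else 1 :: nat)" by auto
      qed
    qed (use only leaf Lam_leaf in metis)+
  next
    assume "\<exists>x. pos ?r x \<and> ?L = {y. neg y x}"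
    then obtain x where x: "pos ?r x" "?L = {y. neg y x}" by blast
    have rx: "?r = tgt C x" using x pos_tgt by auto
    have Lx: "neg a x" if "a \<in> Lam C" "dim C b = int j - 1" "prec C \<alpha> b a" for a b \<alpha>
      using in_L[OF that] x(2) by auto
    have xL: "a \<in> Lam C" "dim C a = int j" if "neg a x" for a
      using that x(2) by auto
    have xpos: "pos (tgt C a) a" if "neg a x" for a
      using Lam_pos xL[OF that] by auto
    have rdich: "lop ?s ?r \<or> pos ?s ?r" using lop_or_pos[OF r(1)] r(2) s by auto
    \<comment> \<open>If \<open>?r\<close> is a loop, the sources of \<open>x\<close> would be loops
      on the same cell, which cells of \<open>\<Lambda>\<close> cannot be. So \<open>x\<close> has
      no source and the tree is reduced to its root edge.\<close>
    have rloop: "\<not> neg a x" if "lop ?s ?r" for a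
      using lop_tgt_sources[of ?s x a] that rx Lam_nonloop xL by metis
    have u1: "a = a'" if "a \<in> Lam C" "a' \<in> Lam C" "dim C b = int j - 1" "pos b a" "pos b a'" for a a' b
      using neg_pos_unique[OF Lx[OF that(1,3,4)] Lx[OF that(2,3,5)] that(4,5)] .
    have u2: "a = a'" if "a \<in> Lam C" "a' \<in> Lam C" "dim C b = int j - 1" "neg b a" "neg b a'" for a a' b
      using neg_neg_unique[OF Lx[OF that(1,3,4)] Lx[OF that(2,3,5)] that(4,5)] .
    have no_s: "\<not> neg ?s a" if "a \<in> Lam C" for a
    proof
      assume n: "neg ?s a"
      then have ax: "neg a x" using Lx that s_dim by blast
      then have "pos ?s ?r" using rdich rloop by blast
      then show False using pos_pos_excl[OF x(1) _ ax] n by blast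
    qed
    have tgt_ex: "\<exists>a\<in>Lam C. neg b a" if b: "b \<in> cells C" "dim C b = int j - 1" "b \<noteq> ?s" for b
    proof -
      obtain a where a: "a \<in> Lam C" "pos b a \<or> neg b a" using cover b by blast
      show ?thesis
      proof (cases "neg b a")
        case False
        then have p: "pos b a" using a by auto
        have "neg a x" using Lx[OF a(1) b(2) p] .
        from thin_neg_pos[OF this p] have "\<exists>y'. neg y' x \<and> neg b y'"
          using pos_tgt s rx b(3) by metis
        then show ?thesis using xL by blast
      qed (use a in blast)
    qed
    have leaf: "b \<in> Lam C \<longleftrightarrow> b \<in> delta C ?r" if b: "b \<in> cells C" "dim C b = int j - 1" for b
      using rdich
    proof
      assume l: "lop ?s ?r"
      then have none: "\<not> (\<exists>a\<in>Lam C. prec C \<alpha> b a)" for \<alpha> using Lx[OF _ b(2)] rloop by blast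
      then have "b = ?s" using cover[OF b] by blast
      then show ?thesis using none Lam_leaf[OF b] lop_delta[OF l] by blast
    next
      assume p: "pos ?s ?r"
      have "b \<in> Lam C \<longleftrightarrow> neg b ?r"
      proof
        assume "b \<in> Lam C"
        then have np: "\<not> pos b a" for a by (auto simp: Lam_iff)
        then have "b \<noteq> ?s" using p by auto
        then obtain a where a: "a \<in> Lam C" "neg b a" using tgt_ex b by blast
        from thin_neg_neg[OF Lx[OF a(1) b(2) a(2)] a(2)] show "neg b ?r" using np rx by auto
      next
        assume "neg b ?r"
        then show "b \<in> Lam C" using Lam_leaf[OF b] pos_neg_excl[OF x(1)] Lx[OF _ b(2)] by blast
      qed
      then show ?thesis using delta_neg[OF p] by simp
    qed
    let ?q = "{(y, y'). neg y x \<and> neg y' x \<and> pos (tgt C y') y' \<and> neg (tgt C y') y}"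
    have "finite ?q"
      by (rule finite_subset[of _ "cells C \<times> cells C"]) (auto simp: finite_cells dest: precD)
    from finite_acyclic_rank[OF this acyc]
    obtain dn :: "'a \<Rightarrow> nat" where dn: "\<forall>y y'. (y, y') \<in> ?q \<longrightarrow> dn y < dn y'" ..
    \<comment> \<open>The depth of an edge is read off its unique target node; \<open>Suc\<close>
      reserves the value 0 for an edge without target node.\<close>
    define d where "d b = (if \<exists>a\<in>Lam C. neg b a then Suc (dn (SOME a. a \<in> Lam C \<and> neg b a)) else 0)" for b
    have dneg: "d b = Suc (dn a)" if "a \<in> Lam C" "dim C b = int j - 1" "neg b a" for a b
    proof -
      have "(SOME a. a \<in> Lam C \<and> neg b a) = a"
        by (rule some_equality) (use that u2 in metis)+
      then show ?thesis using that(1,3) unfolding d_def by metis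
    qed
    have dd: "d b' < d b" if a: "a \<in> Lam C" "dim C b = int j - 1" "neg b a" "pos b' a" for a b b'
    proof (cases "\<exists>a\<in>Lam C. neg b' a")
      case True
      then obtain a' where a': "a' \<in> Lam C" "neg b' a'" by blast
      have b': "b' = tgt C a" "dim C b' = int j - 1" 
        using a(2) pos_tgt[OF a(4)] precD(3)[OF a(3)] precD(3)[OF a(4)] by auto
      have "(a', a) \<in> ?q" using Lx[OF a'(1) b'(2) a'(2)] Lx[OF a(1,2,3)] a'(2) a(4) b' by auto
      then show ?thesis using dn dneg[OF a'(1) b'(2) a'(2)] dneg[OF a(1,2,3)] by auto
    next
      case False
      then show ?thesis using dneg[OF a(1,2,3)] by (simp add: d_def)
    qed
    show ?thesis unfolding level_def
      by (intro conjI, (use u1 in metis), (use u2 in metis), (use no_s in metis), (use tgt_ex in metis),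
          (use dd in blast), (use leaf in metis), (use Lam_leaf in metis))
  qed
qed

text \<open>Only the greatest cell has top dimension, so this tree is the corolla on it.\<close>

lemma level_top: 
  assumes "1 \<le> dfc_dim C" shows "level (dfc_dim C)"
proof (rule level_of_nodes)
  let ?n = "dfc_dim C"
  show "{a \<in> Lam C. dim C a = int ?n} = {iter_tgt C ?n} \<or>
      (\<exists>x. pos (iter_tgt C ?n) x \<and> {a \<in> Lam C. dim C a = int ?n} = {y. neg y x})"
    using omega_Lam dim_omega dim_top Lam_cells unfolding iter_tgt_top by blast
  show "\<exists>a\<in>Lam C. pos b a \<or> neg b a" if b: "b \<in> cells C" "dim C b = int ?n - 1" for b
  proof -
    have "b \<noteq> omega C" using b dim_omega by auto
    then obtain y where y: "y \<in> cells C" "b \<in> boundary C y" using in_boundary[OF b(1)] by metis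
    then have "y = omega C" using boundaryD[OF y] b dim_top by simp
    then show ?thesis using y boundary_prec omega_Lam Lam_nonloop by blast
  qed
  show "\<exists>a\<in>Lam C. pos b a" if "dim C b = int ?n - 1" "pos b a" for a b
    using that precD[OF that(2)] dim_top[of a] omega_Lam by auto
qed (use assms in auto)

lemma level_step:
  assumes "level (Suc j)" "1 \<le> j" "Suc j \<le> dfc_dim C" shows "level j"
proof -
  let ?r = "iter_tgt C j"
  have u1: "\<And>a a' b. a \<in> Lam C \<Longrightarrow> a' \<in> Lam C \<Longrightarrow> dim C b = int j \<Longrightarrow> pos b a \<Longrightarrow> pos b a' \<Longrightarrow> a = a'"
    and ex: "\<And>b. b \<in> cells C \<Longrightarrow> dim C b = int j \<Longrightarrow> b \<noteq> ?r \<Longrightarrow> \<exists>a\<in>Lam C. neg b a"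
    and leaf: "\<And>b. b \<in> cells C \<Longrightarrow> dim C b = int j \<Longrightarrow> b \<in> Lam C \<longleftrightarrow> b \<in> delta C (iter_tgt C (Suc j))"
    and nonleaf: "\<And>b. b \<in> cells C \<Longrightarrow> dim C b = int j \<Longrightarrow> b \<notin> Lam C \<Longrightarrow> \<exists>a\<in>Lam C. pos b a"
    using assms(1) unfolding level_def by auto
  obtain d :: "'a \<Rightarrow> nat" where
    "\<forall>a\<in>Lam C. \<forall>b b'. dim C b = int j \<and> neg b a \<and> pos b' a \<longrightarrow> d b' < d b"
    using assms(1) unfolding level_def by auto
  then have d: "\<And>a b b'. a \<in> Lam C \<Longrightarrow> dim C b = int j \<Longrightarrow> neg b a \<Longrightarrow> pos b' a \<Longrightarrow> d b' < d b"
    by blast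
  let ?x = "iter_tgt C (Suc j)"
  have x: "?x \<in> cells C" "dim C ?x = int (Suc j)" using iter_tgt_cell assms by auto
  have rx: "?r = tgt C ?x" using iter_tgt_Suc[of j] assms by auto
  have r: "?r \<in> cells C" "dim C ?r = int j" using iter_tgt_cell assms by auto
  have Lj: "{a \<in> Lam C. dim C a = int j} = delta C ?x"
  proof -
    have "delta C ?x \<subseteq> {y \<in> cells C. dim C y = dim C ?x - 1}"
      using boundaryD[OF x(1)] by (auto simp: boundary_def)
    then show ?thesis using leaf Lam_cells x by auto
  qed
  \<comment> \<open>A cell outside \<open>\<Lambda>\<close> is the target of a node one level up,
    and thinness hands the face \<open>b\<close>, with its sign, to a source of that node. This
    moves away from the root, so it stops, and it can only stop in \<open>\<Lambda>\<close>.\<close>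
  have climb: "\<exists>a'\<in>Lam C. prec C \<beta> b a'"
    if \<beta>: "\<beta> = 1 \<or> \<beta> = -1" and "a \<in> cells C" "dim C a = int j" "prec C \<beta> b a" for a b \<beta>
  proof -
    define D where "D = Max (d ` cells C)"
    have D: "d c \<le> D" if "c \<in> cells C" for c using that finite_cells by (simp add: D_def)
    show ?thesis using that(2-)
    proof (induction "D - d a" arbitrary: a rule: less_induct)
      case less
      show ?case
      proof (cases "a \<in> Lam C")
        case False
        then obtain e where e: "e \<in> Lam C" "pos a e" using nonleaf less.prems by blast
        obtain a' where a': "neg a' e" "prec C \<beta> b a'"
          using less.prems(3) \<beta> thin_pos_pos[OF e(2)] thin_pos_neg[OF e(2)] by metis
        have c': "a' \<in> cells C" "dim C a' = int j" using precD[OF a'(1)] precD[OF e(2)] less.prems by auto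
        have "d a < d a'" using d[OF e(1) c'(2) a'(1) e(2)] .
        then have "D - d a' < D - d a" using D[OF c'(1)] by auto
        then show ?thesis using less.hyps c' a'(2) by blast
      qed (use less.prems in blast)
    qed
  qed
  have cl: "\<exists>a'\<in>Lam C. pos b a' \<or> neg b a'" if "a \<in> cells C" "dim C a = int j" "pos b a \<or> neg b a" for a b
    using climb[of 1 a b] climb[of "-1" a b] that by blast
  \<comment> \<open>For loops thinness moves in the other direction, towards the root: the loop on
    \<open>b\<close> is handed to the target of the next node until some source meets
    \<open>b\<close> with a nonzero sign, or until \<open>?r\<close> is reached, whose target is the
    excluded edge.\<close>
  have cl_lop: "b = iter_tgt C (j - 1) \<or> (\<exists>a'\<in>Lam C. pos b a' \<or> neg b a')"
    if "a \<in> cells C" "dim C a = int j" "lop b a" for a b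
    using that
  proof (induction "d a" arbitrary: a rule: less_induct)
    case less
    show ?case
    proof (cases "a = ?r")
      case True
      then have "b = tgt C ?r" using lop_tgt less.prems by blast
      then show ?thesis using iter_tgt_Suc[of "j - 1"] assms by auto
    next
      case False
      then obtain e where e: "e \<in> Lam C" "neg a e" using ex less.prems by blast
      from thin_lop[OF less.prems(3) e(2)] show ?thesis
      proof
        assume l: "lop b (tgt C e)"
        have p: "pos (tgt C e) e" using neg_pos_tgt[OF e(2)] .
        have "d (tgt C e) < d a" using d[OF e(1) less.prems(2) e(2) p] .
        moreover have "tgt C e \<in> cells C" "dim C (tgt C e) = int j"
          using precD[OF p] precD[OF e(2)] less.prems by auto
        ultimately show ?thesis using less.hyps l by blast
      next
        assume "\<exists>y'. neg y' e \<and> (pos b y' \<or> neg b y')"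
        then obtain y' where y': "neg y' e" "pos b y' \<or> neg b y'" by blast
        have "y' \<in> cells C" "dim C y' = int j"
          using precD[OF y'(1)] precD[OF e(2)] less.prems by auto
        then show ?thesis using cl y' by blast
      qed
    qed
  qed
  show ?thesis
  proof (rule level_of_nodes)
    show "{a \<in> Lam C. dim C a = int j} = {?r} \<or>
      (\<exists>x. pos ?r x \<and> {a \<in> Lam C. dim C a = int j} = {y. neg y x})"
    proof (cases "lop ?r ?x")
      case True then show ?thesis using Lj lop_delta by auto
    next
      case False
      then have "pos ?r ?x" using lop_or_pos[of ?x] x rx by simp
      then show ?thesis using Lj delta_neg by auto
    qed
    show "\<exists>a\<in>Lam C. pos b a \<or> neg b a"
      if b: "b \<in> cells C" "dim C b = int j - 1" "b \<noteq> iter_tgt C (j - 1)" for b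
    proof -
      have "b \<noteq> omega C" using b dim_omega assms by auto
      then obtain a where a: "a \<in> cells C" "b \<in> boundary C a" using in_boundary[OF b(1)] by metis
      then have "dim C a = int j" using boundaryD[OF a] b by simp
      then show ?thesis using a cl cl_lop boundary_prec b by blast
    qed
    show "\<exists>a\<in>Lam C. pos b a" if "dim C b = int j - 1" "pos b a" for a b
      using that precD[OF that(2)] climb[of 1 a b] by simp
  qed (use assms in auto)
qed

lemma level: "1 \<le> j \<Longrightarrow> j \<le> dfc_dim C \<Longrightarrow> level j"
proof -
  assume j: "1 \<le> j" "j \<le> dfc_dim C"
  from j(2,1) show ?thesis
    by (induction rule: inc_induct) (auto intro: level_top level_step)
qed

lemma level_of_dim:
  assumes "a \<in> cells C" "dim C a \<ge> 1"
  shows "level (nat (dim C a))" "int (nat (dim C a)) = dim C a"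
  using assms dim_le[OF assms(1)] by (auto intro!: level)

lemma pos_Lam_unique:
  assumes "a \<in> Lam C" "a' \<in> Lam C" "pos b a" "pos b a'" "dim C b \<ge> 0"
  shows "a = a'"
proof -
  have "level (nat (dim C a))" "int (nat (dim C a)) - 1 = dim C b"
    using level_of_dim[of a] precD[OF assms(3)] assms(5) by auto
  then show ?thesis using assms unfolding level_def by metis
qed

lemma neg_Lam_unique:
  assumes "a \<in> Lam C" "a' \<in> Lam C" "neg b a" "neg b a'" "dim C b \<ge> 0"
  shows "a = a'"
proof -
  have "level (nat (dim C a))" "int (nat (dim C a)) - 1 = dim C b"
    using level_of_dim[of a] precD[OF assms(3)] assms(5) by auto
  then show ?thesis using assms unfolding level_def by metis
qed

lemma iter_tgt_not_neg:
  assumes "a \<in> Lam C" "k < dfc_dim C"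
  shows "\<not> neg (iter_tgt C k) a"
proof -
  have "level (Suc k)" using assms(2) by (intro level) auto
  then show ?thesis using assms(1) unfolding level_def by auto
qed

lemma ex_neg_Lam:
  assumes "b \<in> cells C" "dim C b = int k" "k < dfc_dim C" "b \<noteq> iter_tgt C k"
  obtains a where "a \<in> Lam C" "neg b a"
proof -
  have "level (Suc k)" using assms(3) by (intro level) auto
  then have "\<exists>a\<in>Lam C. neg b a" using assms unfolding level_def by auto
  then show ?thesis using that by blast
qed

lemma ex_pos_Lam:
  assumes "b \<in> cells C" "dim C b \<ge> 0" "b \<notin> Lam C"
  obtains a where "a \<in> Lam C" "pos b a"
proof -
  obtain a where a: "pos b a" using assms by (auto simp: Lam_iff)
  have "level (nat (dim C a))" "int (nat (dim C a)) - 1 = dim C b"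
    using level_of_dim[of a] precD[OF a] assms(2) by auto
  then have "\<exists>a\<in>Lam C. pos b a" using assms unfolding level_def by auto
  then show ?thesis using that by blast
qed

lemma Lam_iff_delta:
  assumes "b \<in> cells C" "dim C b = int k" "k < dfc_dim C"
  shows "b \<in> Lam C \<longleftrightarrow> b \<in> delta C (iter_tgt C (Suc k))"
proof -
  have "level (Suc k)" using assms(3) by (intro level) auto
  then show ?thesis using assms unfolding level_def by auto
qed

text \<open>The levels have disjoint sets of edges, so their depth functions can be glued; an edge
  \<open>b\<close> belongs to level \<open>dim C b + 1\<close>.\<close>

lemma ex_depth:
  "\<exists>d :: 'a \<Rightarrow> nat. \<forall>a\<in>Lam C. \<forall>b b'. dim C b \<ge> 0 \<and> neg b a \<and> pos b' a \<longrightarrow> d b' < d b"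
proof -
  have "\<forall>j. \<exists>d :: 'a \<Rightarrow> nat. level j \<longrightarrow>
     (\<forall>a\<in>Lam C. \<forall>b b'. dim C b = int j - 1 \<and> neg b a \<and> pos b' a \<longrightarrow> d b' < d b)"
    unfolding level_def by blast
  from choice[OF this] obtain d :: "nat \<Rightarrow> 'a \<Rightarrow> nat" where d: "\<forall>j. level j \<longrightarrow>
     (\<forall>a\<in>Lam C. \<forall>b b'. dim C b = int j - 1 \<and> neg b a \<and> pos b' a \<longrightarrow> d j b' < d j b)" by blast
  show ?thesis
  proof (intro exI[of _ "\<lambda>b. d (nat (dim C b + 1)) b"] ballI allI impI)
    fix a b b' assume a: "a \<in> Lam C" and b: "dim C b \<ge> 0 \<and> neg b a \<and> pos b' a"
    have e: "dim C b = dim C a - 1" "dim C b' = dim C a - 1" "a \<in> cells C"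
      using precD b by blast+
    then have "level (nat (dim C a))" "int (nat (dim C a)) - 1 = dim C b"
      using level_of_dim[of a] b by auto
    then have "d (nat (dim C a)) b' < d (nat (dim C a)) b" using d a b by metis
    then show "d (nat (dim C b' + 1)) b' < d (nat (dim C b + 1)) b" using e by simp
  qed
qed

section \<open>Descent from edge to edge\<close>

definition depth :: "'a \<Rightarrow> nat" where
  "depth = (SOME d. \<forall>a\<in>Lam C. \<forall>b b'. dim C b \<ge> 0 \<and> neg b a \<and> pos b' a \<longrightarrow> d b' < d b)"

lemma depth_less:
  assumes "a \<in> Lam C" "neg b a" "pos b' a" "dim C b \<ge> 0"
  shows "depth b' < depth b"
  using someI_ex[OF ex_depth] assms unfolding depth_def[symmetric] by blast

text \<open>One step of a descending path, with the intermediate node suppressed;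
  \<open>below\<close> is the descent order on edges. The bound on the dimension leaves out the cell
  of dimension -1, which is an edge of no \<open>level\<close>.\<close>

definition step :: "'a \<Rightarrow> 'a \<Rightarrow> bool" where
  "step b b' \<longleftrightarrow> dim C b \<ge> 0 \<and> (\<exists>a\<in>Lam C. neg b a \<and> pos b' a)"

abbreviation below :: "'a \<Rightarrow> 'a \<Rightarrow> bool" where "below \<equiv> step\<^sup>*\<^sup>*"

lemma stepI: "a \<in> Lam C \<Longrightarrow> neg b a \<Longrightarrow> dim C b \<ge> 0 \<Longrightarrow> step b (tgt C a)"
  unfolding step_def using neg_pos_tgt by blast

lemma stepD:
  assumes "step b b'"
  obtains a where "a \<in> Lam C" "neg b a" "pos b' a" "b' = tgt C a" "dim C b \<ge> 0"
  using assms pos_tgt unfolding step_def by blast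

lemma step_fun: "step b b' \<Longrightarrow> step b b'' \<Longrightarrow> b' = b''"
  using neg_Lam_unique by (metis stepD)

lemma step_dim: "step b b' \<Longrightarrow> dim C b' = dim C b \<and> b \<in> cells C \<and> b' \<in> cells C"
proof -
  assume "step b b'"
  then obtain a where "neg b a" "pos b' a" by (auto simp: step_def)
  then show ?thesis using precD[of "-1" b a] precD[of 1 b' a] by simp
qed

lemma step_depth: "step b b' \<Longrightarrow> depth b' < depth b"
  unfolding step_def using depth_less by blast

lemma below_dim: "below b b' \<Longrightarrow> dim C b' = dim C b \<and> (b \<in> cells C \<longrightarrow> b' \<in> cells C)"
  by (induction rule: rtranclp_induct) (auto dest: step_dim)

lemma below_depth: "below b b' \<Longrightarrow> b = b' \<or> depth b' < depth b"
  by (induction rule: rtranclp_induct) (auto dest: step_depth)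

lemma below_antisym: "below x y \<Longrightarrow> below y x \<Longrightarrow> x = y"
  using below_depth[of x y] below_depth[of y x] by auto

lemma below_cases:
  assumes "below b g" "b \<noteq> g"
  obtains a where "a \<in> Lam C" "neg b a" "pos (tgt C a) a" "step b (tgt C a)" "below (tgt C a) g" "dim C b \<ge> 0"
  using assms by (metis converse_rtranclpE stepD)

lemma below_neg:
  assumes "below b g" "b \<noteq> g" "a \<in> Lam C" "neg b a" "dim C b \<ge> 0"
  shows "below (tgt C a) g"
  using below_cases[OF assms(1,2)] neg_Lam_unique assms by metis

text \<open>Only the root lacks a target node, and depth drops with every step.\<close>

lemma below_iter_tgt:
  assumes "b \<in> cells C" "dim C b = int k" "k < dfc_dim C"
  shows "below b (iter_tgt C k)"
  using assms
proof (induction "depth b" arbitrary: b rule: less_induct)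
  case less
  show ?case
  proof (cases "b = iter_tgt C k")
    case False
    then obtain a where "a \<in> Lam C" "neg b a" using ex_neg_Lam less.prems by metis
    then have s: "step b (tgt C a)" using stepI less.prems by simp
    then show ?thesis using less.hyps[OF step_depth[OF s]] step_dim[OF s] less.prems
      by (simp add: converse_rtranclp_into_rtranclp)
  qed simp
qed

section \<open>The trees in degrees at least 2: rootedness, leaves, null dots\<close>

lemma Z_tree_cells_simps:
  "nodes (Z_tree_cells C k) = Cell ` {x \<in> Lam C. dim C x = int k - 1}"
  "edges (Z_tree_cells C k) = Cell ` {y \<in> cells C. dim C y = int k - 2}"
  "root (Z_tree_cells C k) = Cell (iter_tgt C (k - 2))"
  "is_src (Z_tree_cells C k) e t \<longleftrightarrow> (\<exists>y x. e = Cell y \<and> t = Cell x \<and> x \<in> Lam C \<and> dim C y = int k - 2 \<and> neg y x)"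
  "is_tgt (Z_tree_cells C k) e t \<longleftrightarrow> (\<exists>y x. e = Cell y \<and> t = Cell x \<and> x \<in> Lam C \<and> dim C y = int k - 2 \<and> pos y x)"
proof -
  show "is_src (Z_tree_cells C k) e t \<longleftrightarrow> (\<exists>y x. e = Cell y \<and> t = Cell x \<and> x \<in> Lam C \<and> dim C y = int k - 2 \<and> neg y x)"
    unfolding Z_tree_cells_def Let_def using precD[of "-1"] by simp force
  show "is_tgt (Z_tree_cells C k) e t \<longleftrightarrow> (\<exists>y x. e = Cell y \<and> t = Cell x \<and> x \<in> Lam C \<and> dim C y = int k - 2 \<and> pos y x)"
    unfolding Z_tree_cells_def Let_def using precD[of 1] by simp force
qed (simp_all add: Z_tree_cells_def Let_def)

lemma step_desc:
  assumes "step b b'" "dim C b = int k - 2"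
  shows "desc (Z_tree_cells C k) (Inr (Cell b)) (Inr (Cell b'))"
proof -
  obtain a where a: "a \<in> Lam C" "neg b a" "pos b' a" using assms by (auto simp: step_def)
  have "dim C b' = int k - 2" using step_dim assms by simp
  then have "down_step (Z_tree_cells C k) (Inr (Cell b)) (Inl (Cell a))"
    "down_step (Z_tree_cells C k) (Inl (Cell a)) (Inr (Cell b'))"
    using a assms by (auto simp: Z_tree_cells_simps)
  then show ?thesis unfolding desc_def by (meson r_into_rtranclp rtranclp_trans)
qed

lemma below_desc:
  assumes "below b b'" "dim C b = int k - 2"
  shows "desc (Z_tree_cells C k) (Inr (Cell b)) (Inr (Cell b'))"
  using assms(1)
proof (induction rule: rtranclp_induct)
  case base then show ?case by (simp add: desc_def)
next
  case (step u v)
  then have "dim C u = int k - 2" using below_dim assms by simp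
  from step_desc[OF step.hyps(2) this] step.IH show ?case unfolding desc_def by (meson rtranclp_trans)
qed

lemma rooted_Z_tree_cells:
  assumes "2 \<le> k" "k \<le> Suc (dfc_dim C)"
  shows "rooted_tree (Z_tree_cells C k)"
  unfolding rooted_tree_def
proof (intro conjI)
  let ?T = "Z_tree_cells C k"
  have fin: "finite {x \<in> Lam C. dim C x = int k - 1}" "finite {y \<in> cells C. dim C y = int k - 2}"
    by (rule finite_subset[OF _ finite_cells], use Lam_cells in blast)+
  then show "finite (nodes ?T)" "finite (edges ?T)" by (auto simp: Z_tree_cells_simps)
  show "\<forall>b a. is_src ?T b a \<or> is_tgt ?T b a \<longrightarrow> b \<in> edges ?T \<and> a \<in> nodes ?T"
    unfolding Z_tree_cells_simps using precD(2,3) by fastforce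
  show "\<forall>a\<in>nodes ?T. \<exists>!b. is_tgt ?T b a"
  proof
    fix a assume "a \<in> nodes ?T"
    then obtain x where x: "a = Cell x" "x \<in> Lam C" "dim C x = int k - 1" by (auto simp: Z_tree_cells_simps)
    then have p: "pos (tgt C x) x" using Lam_pos assms by simp
    show "\<exists>!b. is_tgt ?T b a"
    proof (rule ex1I[of _ "Cell (tgt C x)"])
      show "is_tgt ?T (Cell (tgt C x)) a"
        using x p precD(3)[OF p] by (simp add: Z_tree_cells_simps)
      fix b assume "is_tgt ?T b a"
      then obtain y where y: "b = Cell y" "pos y x" using x(1) by (auto simp: Z_tree_cells_simps)
      show "b = Cell (tgt C x)" using y(1) pos_tgt[OF y(2)] by simp
    qed
  qed
  show "\<forall>b. \<exists>\<^sub>\<le>\<^sub>1 a. is_tgt ?T b a"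
    unfolding Z_tree_cells_simps Uniq_def using pos_Lam_unique assms by auto
  show "\<forall>b. \<exists>\<^sub>\<le>\<^sub>1 a. is_src ?T b a"
    unfolding Z_tree_cells_simps Uniq_def using neg_Lam_unique assms by auto
  have "iter_tgt C (k - 2) \<in> cells C" "dim C (iter_tgt C (k - 2)) = int k - 2"
    using iter_tgt_cell[of "k - 2"] assms by auto
  then show "root ?T \<in> edges ?T" by (simp add: Z_tree_cells_simps)
  show "\<nexists>a. is_src ?T (root ?T) a"
    unfolding Z_tree_cells_simps using iter_tgt_not_neg[of _ "k - 2"] assms by auto
  show "\<forall>b\<in>edges ?T. desc ?T (Inr b) (Inr (root ?T))"
  proof
    fix b assume "b \<in> edges ?T"
    then obtain y where y: "b = Cell y" "y \<in> cells C" "dim C y = int k - 2" by (auto simp: Z_tree_cells_simps)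
    then have "below y (iter_tgt C (k - 2))" using below_iter_tgt[of y "k - 2"] assms by auto
    then show "desc ?T (Inr b) (Inr (root ?T))" using below_desc y by (simp add: Z_tree_cells_simps)
  qed
qed

lemma leaves_Z_tree_cells:
  assumes "2 \<le> k"
  shows "leaves (Z_tree_cells C k) = Cell ` {x \<in> Lam C. dim C x = int k - 2}"
proof -
  let ?T = "Z_tree_cells C k"
  have key: "(\<nexists>a. is_tgt ?T (Cell b) a) \<longleftrightarrow> b \<in> Lam C" if b: "b \<in> cells C" "dim C b = int k - 2" for b
  proof -
    have "(\<nexists>a. is_tgt ?T (Cell b) a) \<longleftrightarrow> \<not> (\<exists>a\<in>Lam C. pos b a)"
      using b(2) by (auto simp: Z_tree_cells_simps)
    moreover have "b \<notin> Lam C \<Longrightarrow> \<exists>a\<in>Lam C. pos b a" using ex_pos_Lam[OF b(1)] b(2) assms by auto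
    moreover have "b \<in> Lam C \<Longrightarrow> \<not> pos b a" for a by (simp add: Lam_iff)
    ultimately show ?thesis by blast
  qed
  show ?thesis
  proof (intro set_eqI iffI)
    fix e assume "e \<in> leaves ?T"
    then show "e \<in> Cell ` {x \<in> Lam C. dim C x = int k - 2}"
      using key by (auto simp: leaves_def Z_tree_cells_simps(2))
  next
    fix e assume "e \<in> Cell ` {x \<in> Lam C. dim C x = int k - 2}"
    then obtain x where "e = Cell x" "x \<in> Lam C" "dim C x = int k - 2" by blast
    then show "e \<in> leaves ?T"
      using key[of x] Lam_cells[of x] by (auto simp: leaves_def Z_tree_cells_simps(2))
  qed
qed

lemma null_iff:
  assumes "x \<in> Lam C" "dim C x \<ge> 0"
  shows "x \<in> null_cells C \<longleftrightarrow> (\<forall>y. \<not> neg y x)"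
  using delta_neg[OF Lam_pos[OF assms]] Lam_cells[OF assms(1)] by (auto simp: null_cells_def)

lemma null_dots_Z_tree_cells:
  assumes "1 \<le> k"
  shows "null_dots (Z_tree_cells C k) = Cell ` {x \<in> Lam C \<inter> null_cells C. dim C x = int k - 1}"
proof -
  let ?T = "Z_tree_cells C k"
  have key: "(\<nexists>b. is_src ?T b (Cell x)) \<longleftrightarrow> x \<in> null_cells C" if x: "x \<in> Lam C" "dim C x = int k - 1" for x
  proof -
    have "neg y x \<Longrightarrow> dim C y = int k - 2" for y using precD(3)[of "-1" y x] x(2) by simp
    then have "(\<exists>b. is_src ?T b (Cell x)) \<longleftrightarrow> (\<exists>y. neg y x)"
      using x(1) by (auto simp: Z_tree_cells_simps)
    moreover have "dim C x \<ge> 0" using x(2) assms by simp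
    ultimately show ?thesis using null_iff[OF x(1)] by simp
  qed
  show ?thesis
  proof (intro set_eqI iffI)
    fix e assume "e \<in> null_dots ?T"
    then show "e \<in> Cell ` {x \<in> Lam C \<inter> null_cells C. dim C x = int k - 1}"
      using key by (auto simp: null_dots_def Z_tree_cells_simps(1))
  next
    fix e assume "e \<in> Cell ` {x \<in> Lam C \<inter> null_cells C. dim C x = int k - 1}"
    then obtain x where "e = Cell x" "x \<in> Lam C" "x \<in> null_cells C" "dim C x = int k - 1" by blast
    then show "e \<in> null_dots ?T"
      using key[of x] by (auto simp: null_dots_def Z_tree_cells_simps(1))
  qed
qed

section \<open>Dimensions 0 and 1: linearity of the tree in degree 2\<close>

lemma point_prec:
  obtains s where "\<And>y. y \<in> cells C \<Longrightarrow> dim C y = 0 \<Longrightarrow> delta C y = {} \<and> pos s y"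
proof -
  obtain s where s: "{x \<in> cells C. dim C x = -1} = {s}"
    "\<forall>x\<in>cells C. dim C x = 0 \<longrightarrow> gamma C x - delta C x = {s}"
    using mop unfolding is_mop_def by blast
  have "delta C y = {} \<and> pos s y" if y: "y \<in> cells C" "dim C y = 0" for y
  proof -
    have "s \<in> gamma C y - delta C y" using s(2) y by blast
    moreover have "delta C y \<subseteq> {s}" using boundaryD[OF y(1)] y(2) s(1) by (auto simp: boundary_def)
    ultimately show ?thesis using y by (auto simp: prec_def)
  qed
  then show ?thesis using that by blast
qed

text \<open>All points have the same target \<open>s\<close>. For an arrow that is not a loop,
  thinness pairs \<open>s\<close> below its target with \<open>s\<close> below a source, and two
  sources would meet \<open>s\<close> with the same sign.\<close>

lemma arrow_source:
  assumes "x \<in> cells C" "dim C x = 1"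
  shows "is_singleton (delta C x)"
proof -
  obtain s where s: "\<And>y. y \<in> cells C \<Longrightarrow> dim C y = 0 \<Longrightarrow> delta C y = {} \<and> pos s y"
    using point_prec by blast
  have "lop (tgt C x) x \<or> pos (tgt C x) x" using lop_or_pos assms by simp
  then show ?thesis
  proof
    assume p: "pos (tgt C x) x"
    then have "pos s (tgt C x)" using s tgt_cell[OF assms(1)] assms(2) by simp
    then obtain y where y: "neg y x" "pos s y" using thin_pos_pos[OF p] by metis
    have "y' = y" if "neg y' x" for y'
      using neg_pos_unique[OF that y(1) _ y(2)] s precD[OF that] assms by simp
    then have "{y. neg y x} = {y}" using y by blast
    then show ?thesis using delta_neg[OF p] by (simp add: is_singleton_def)
  qed (use lop_delta in \<open>auto simp: is_singleton_def\<close>)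
qed

lemma linear_Z_tree_cells: "linear_tree (Z_tree_cells C 2)"
  unfolding linear_tree_def
proof
  fix a assume "a \<in> nodes (Z_tree_cells C 2)"
  then obtain x where x: "a = Cell x" "x \<in> Lam C" "dim C x = 1" by (auto simp: Z_tree_cells_simps)
  then obtain y where "delta C x = {y}" using arrow_source Lam_cells is_singletonE by metis
  then have n: "{y. neg y x} = {y}" using delta_neg[OF Lam_pos[OF x(2)]] x by simp
  have yd: "dim C y = 0" if "neg y x" for y using precD(3)[OF that] x by simp
  have "neg y x" using n by blast
  then show "\<exists>!b. is_src (Z_tree_cells C 2) b a" using n x yd
    by (intro ex1I[of _ "Cell y"]) (auto simp: Z_tree_cells_simps)
qed

lemma leaves_Z_tree_cells_2:
  assumes "1 \<le> dfc_dim C"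
  shows "is_singleton (leaves (Z_tree_cells C 2))"
proof -
  have x: "iter_tgt C 1 \<in> cells C" "dim C (iter_tgt C 1) = 1" using iter_tgt_cell[of 1] assms by auto
  have "{b \<in> Lam C. dim C b = 0} = delta C (iter_tgt C 1)"
    using Lam_iff_delta[of _ 0] Lam_cells assms boundaryD[OF x(1)] x(2) by (auto simp: boundary_def)
  then show ?thesis using arrow_source[OF x] leaves_Z_tree_cells[of 2]
    by (auto simp: is_singleton_def)
qed

end

section \<open>The order on the loops on a cell\<close>

text \<open>Descent is deterministic, so two points reached from the same start are comparable. This
  is applied both to \<open>bstep\<close> and to \<open>lstep\<close>.\<close>

lemma functional_chain:
  assumes "\<And>x y z. r x y \<Longrightarrow> r x z \<Longrightarrow> y = z" "r\<^sup>*\<^sup>* b x" "r\<^sup>*\<^sup>* b y"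
  shows "r\<^sup>*\<^sup>* x y \<or> r\<^sup>*\<^sup>* y x"
  using assms(2)
proof (induction rule: rtranclp_induct)
  case base then show ?case using assms(3) by simp
next
  case (step u v)
  from step.IH show ?case
  proof
    assume "r\<^sup>*\<^sup>* u y"
    then show ?thesis
    proof (cases rule: converse_rtranclpE)
      case base then show ?thesis using step.hyps by blast
    next
      case (step w) then show ?thesis using assms(1)[OF \<open>r u v\<close>] by blast
    qed
  next
    assume "r\<^sup>*\<^sup>* y u" then show ?thesis using step.hyps by (meson rtranclp.rtrancl_into_rtrancl)
  qed
qed

text \<open>\<open>c\<close> is an edge of the tree in degree \<open>m + 2\<close>. The cells having
  \<open>c\<close> as a face are edges of the tree in degree \<open>m + 3\<close>, called the next
  tree; \<open>m_less\<close> ensures that they all descend to its root \<open>R\<close>.\<close>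

locale dfc_edge = dfc +
  fixes c :: 'a and m :: nat
  assumes c_cell: "c \<in> cells C" and c_dim: "dim C c = int m" and m_less: "Suc m < dfc_dim C"
begin

abbreviation R where "R \<equiv> iter_tgt C (Suc m)"

section \<open>The chains of cells that meet \<open>c\<close> with a fixed sign\<close>

definition bstep :: "int \<Rightarrow> 'a \<Rightarrow> 'a \<Rightarrow> bool" where
  "bstep \<beta> x y \<longleftrightarrow> step x y \<and> prec C \<beta> c x \<and> prec C \<beta> c y"

text \<open>The turning node of the zig-zag, the only place where both signs over \<open>c\<close>
  occur among the sources.\<close>

definition mid :: "'a \<Rightarrow> bool" where
  "mid a \<longleftrightarrow> a \<in> Lam C \<and> (\<exists>b. neg b a \<and> neg c b) \<and> (\<exists>b. neg b a \<and> pos c b)"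

definition Ac :: "'a set" where
  "Ac = {a \<in> Lam C. \<exists>b. neg b a \<and> (neg c b \<or> pos c b)}"

lemma up_dim: "prec C \<beta> c b \<Longrightarrow> dim C b = int (Suc m)"
  using precD(3)[of \<beta> c b] c_dim by simp

lemma tgt_prec:
  assumes "\<beta> = 1 \<or> \<beta> = -1" "pos y a" "prec C \<beta> c y"
  obtains b where "neg b a" "prec C \<beta> c b"
  using assms thin_pos_pos thin_pos_neg by metis

lemma neg_prec:
  assumes "\<beta> = 1 \<or> \<beta> = -1" "neg b a" "prec C \<beta> c b" "\<not> prec C \<beta> c (tgt C a)"
  obtains b' where "neg b' a" "prec C (- \<beta>) c b'"
proof -
  have "\<exists>b'. neg b' a \<and> prec C (- \<beta>) c b'"
    using assms(1)
  proof
    assume "\<beta> = 1" then show ?thesis using thin_neg_pos[OF assms(2)] assms(3,4) by auto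
  next
    assume "\<beta> = -1" then show ?thesis using thin_neg_neg[OF assms(2)] assms(3,4) by auto
  qed
  then show ?thesis using that by blast
qed

text \<open>A sign over \<open>c\<close> that the target of the node does not inherit is cancelled,
  by thinness, by the opposite sign on another source. So a chain can be left only at a turning
  node.\<close>

lemma neg_prec_mid:
  assumes "\<beta> = 1 \<or> \<beta> = -1" "a \<in> Lam C" "neg b a" "prec C \<beta> c b" "\<not> prec C \<beta> c (tgt C a)"
  shows "mid a"
proof -
  obtain b' where "neg b' a" "prec C (- \<beta>) c b'" using neg_prec assms by metis
  then show ?thesis using assms unfolding mid_def by auto
qed

lemma mid_not_tgt:
  assumes "mid a" "\<beta> = 1 \<or> \<beta> = -1"
  shows "\<not> prec C \<beta> c (tgt C a)"
proof -
  obtain b b' where b: "neg b a" "neg c b" "neg b' a" "pos c b'" using assms(1) by (auto simp: mid_def)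
  show ?thesis using neg_neg_pos_excl[OF b(3,4) b(1,2)] assms(2) by blast
qed

lemma mid_neg:
  assumes "mid a" "\<beta> = 1 \<or> \<beta> = -1"
  obtains b where "neg b a" "prec C \<beta> c b"
  using assms unfolding mid_def by blast

lemma mid_Ac: "mid a \<Longrightarrow> a \<in> Ac" unfolding mid_def Ac_def by blast

lemma AcI:
  assumes "a \<in> Lam C" "prec C \<alpha> b a" "prec C \<beta> c b" "\<alpha> \<noteq> 0" "\<beta> \<noteq> 0"
  shows "a \<in> Ac"
proof -
  have b: "\<beta> = 1 \<or> \<beta> = -1" using prec_sign assms(3,5) by blast
  have "\<alpha> = 1 \<or> \<alpha> = -1" using prec_sign assms(2,4) by blast
  then obtain b' where "neg b' a" "prec C \<beta> c b'"
    using tgt_prec[OF b _ assms(3)] assms(2,3) by blast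
  then show ?thesis using assms(1) b unfolding Ac_def by blast
qed

lemma Ac_tgt:
  assumes "a \<in> Ac" shows "pos (tgt C (tgt C a)) (tgt C a)"
proof -
  obtain b where "neg b a" "neg c b \<or> pos c b" using assms by (auto simp: Ac_def)
  then show ?thesis using pos_tgt_tgt neg_pos_tgt by blast
qed

lemma Ac_cases:
  assumes "a \<in> Ac" "\<not> mid a"
  shows "neg c (tgt C a) \<or> pos c (tgt C a)"
  using assms neg_prec_mid[of 1 a] neg_prec_mid[of "-1" a] unfolding Ac_def by blast

lemma bstep_fun: "bstep \<beta> x y \<Longrightarrow> bstep \<beta> x z \<Longrightarrow> y = z"
  using step_fun unfolding bstep_def by blast

lemma bstep_below: "(bstep \<beta>)\<^sup>*\<^sup>* x y \<Longrightarrow> below x y"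
  by (rule rtranclp_mono[THEN predicate2D, rotated]) (auto simp: bstep_def)

lemma top_unique:
  assumes "\<beta> = 1 \<or> \<beta> = -1" "x \<in> Lam C" "y \<in> Lam C" "prec C \<beta> c x" "prec C \<beta> c y"
  shows "x = y"
  using assms pos_Lam_unique neg_Lam_unique c_dim by (metis of_nat_0_le_iff)

text \<open>As long as a cell is the target of a node, thinness finds a source of that node with the
  same sign over \<open>c\<close>, at greater depth.\<close>

lemma climb:
  assumes "\<beta> = 1 \<or> \<beta> = -1" "prec C \<beta> c b"
  shows "\<exists>t\<in>Lam C. prec C \<beta> c t \<and> (bstep \<beta>)\<^sup>*\<^sup>* t b"
proof -
  define D where "D = Max (depth ` cells C)"
  have D: "depth x \<le> D" if "x \<in> cells C" for x using that finite_cells by (simp add: D_def)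
  show ?thesis using assms(2)
  proof (induction "D - depth b" arbitrary: b rule: less_induct)
    case less
    show ?case
    proof (cases "b \<in> Lam C")
      case False
      have b: "b \<in> cells C" "dim C b \<ge> 0" using precD[OF less.prems] up_dim[OF less.prems] by auto
      then obtain a where a: "a \<in> Lam C" "pos b a" using ex_pos_Lam False by blast
      obtain b' where b': "neg b' a" "prec C \<beta> c b'" using tgt_prec[OF assms(1) a(2) less.prems] .
      have s: "step b' b" using a b' up_dim[OF b'(2)] unfolding step_def by auto
      then have "D - depth b' < D - depth b" using step_depth[OF s] D[of b'] step_dim[OF s] by auto
      then obtain t where "t \<in> Lam C" "prec C \<beta> c t" "(bstep \<beta>)\<^sup>*\<^sup>* t b'" using less.hyps b'(2) by blast
      moreover have "bstep \<beta> b' b" using s b'(2) less.prems by (simp add: bstep_def)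
      ultimately show ?thesis by (meson rtranclp.rtrancl_into_rtrancl)
    qed (use less.prems in blast)
  qed
qed

text \<open>By \<open>climb\<close> both cells lie below a leaf of the next tree with the same sign
  over \<open>c\<close>. Such a leaf is a node adjacent to \<open>c\<close> in the tree of
  \<open>c\<close>, and there is only one on each side (\<open>top_unique\<close>).\<close>

lemma prec_chain:
  assumes "\<beta> = 1 \<or> \<beta> = -1" "prec C \<beta> c x" "prec C \<beta> c y"
  shows "(bstep \<beta>)\<^sup>*\<^sup>* x y \<or> (bstep \<beta>)\<^sup>*\<^sup>* y x"
proof -
  obtain t where t: "t \<in> Lam C" "prec C \<beta> c t" "(bstep \<beta>)\<^sup>*\<^sup>* t x" using climb assms by blast
  obtain t' where t': "t' \<in> Lam C" "prec C \<beta> c t'" "(bstep \<beta>)\<^sup>*\<^sup>* t' y" using climb assms by blast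
  have "t = t'" using top_unique assms(1) t t' by blast
  then show ?thesis using functional_chain[of "bstep \<beta>" t x y] bstep_fun t(3) t'(3) by blast
qed

lemma bstep_neg:
  assumes "bstep \<beta> x y" "a \<in> Lam C" "neg x a"
  shows "y = tgt C a"
proof -
  have "dim C x \<ge> 0" using assms(1) unfolding bstep_def step_def by blast
  then have "step x (tgt C a)" using stepI assms by blast
  then show ?thesis using step_fun assms(1) unfolding bstep_def by blast
qed

text \<open>A chain that contains a source of \<open>a\<close> has to stop there, because its next
  member would be the target of \<open>a\<close>, which does not meet \<open>c\<close> with that
  sign. So the whole chain lies above \<open>a\<close>.\<close>

lemma prec_below_mid:
  assumes "mid a" "\<beta> = 1 \<or> \<beta> = -1" "prec C \<beta> c x"
  shows "below x (tgt C a)"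
proof -
  have aL: "a \<in> Lam C" using assms(1) by (simp add: mid_def)
  obtain b where b: "neg b a" "prec C \<beta> c b" using mid_neg assms by metis
  have s: "step b (tgt C a)" using stepI[OF aL b(1)] up_dim[OF b(2)] by simp
  from prec_chain[OF assms(2,3) b(2)] show ?thesis
  proof
    assume "(bstep \<beta>)\<^sup>*\<^sup>* x b"
    then show ?thesis using bstep_below s by (meson rtranclp.rtrancl_into_rtrancl)
  next
    assume "(bstep \<beta>)\<^sup>*\<^sup>* b x"
    then show ?thesis
    proof (cases rule: converse_rtranclpE)
      case base then show ?thesis using s by blast
    next
      case (step z)
      then have "z = tgt C a" "prec C \<beta> c z" using bstep_neg aL b(1) by (auto simp: bstep_def)
      then show ?thesis using mid_not_tgt assms by blast
    qed
  qed
qed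

lemma below_mid_not_prec:
  assumes "mid a" "below (tgt C a) g" "\<beta> = 1 \<or> \<beta> = -1"
  shows "\<not> prec C \<beta> c g"
proof
  assume p: "prec C \<beta> c g"
  then have "g = tgt C a" using prec_below_mid[OF assms(1,3) p] below_antisym assms(2) by blast
  then show False using mid_not_tgt assms p by blast
qed

text \<open>The negative sources of two turning nodes lie on one chain. If they differed, one would
  lie past the other's turning node, where nothing meets \<open>c\<close> any more.\<close>

lemma mid_unique:
  assumes "mid a" "mid a'" shows "a = a'"
proof -
  have b1: "(-1::int) = 1 \<or> (-1::int) = -1" by simp
  have L: "a \<in> Lam C" "a' \<in> Lam C" using assms by (auto simp: mid_def)
  obtain b where b: "neg b a" "neg c b" using mid_neg[OF assms(1) b1] .
  obtain b' where b': "neg b' a'" "neg c b'" using mid_neg[OF assms(2) b1] .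
  have s: "below b (tgt C a)" "step b (tgt C a)" "step b' (tgt C a')"
    using stepI[OF L(1) b(1)] stepI[OF L(2) b'(1)] up_dim[OF b(2)] up_dim[OF b'(2)] by auto
  have "\<not> below (tgt C a) b'" "\<not> below (tgt C a') b"
    using below_mid_not_prec[OF assms(1) _ b1] below_mid_not_prec[OF assms(2) _ b1] b b' by blast+
  moreover have "below b b' \<or> below b' b" using prec_chain[OF b1 b(2) b'(2)] bstep_below by blast
  ultimately have "b = b'"
    using below_neg[OF _ _ L(1) b(1)] below_neg[OF _ _ L(2) b'(1)] up_dim[OF b(2)] up_dim[OF b'(2)]
    by fastforce
  then show ?thesis using neg_Lam_unique[OF L b(1)] b'(1) up_dim[OF b(2)] by simp
qed

text \<open>Following the path from \<open>b\<close>, the sign over \<open>c\<close> persists until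
  a turning node is passed.\<close>

lemma prec_below_cases:
  assumes "\<beta> = 1 \<or> \<beta> = -1" "prec C \<beta> c b" "below b g"
  shows "prec C \<beta> c g \<or> (\<exists>a. mid a \<and> below (tgt C a) g)"
  using assms(3)
proof (induction rule: rtranclp_induct)
  case base then show ?case using assms by blast
next
  case (step u v)
  from step.IH show ?case
  proof
    assume u: "prec C \<beta> c u"
    obtain a where a: "a \<in> Lam C" "neg u a" "v = tgt C a" using stepD[OF step.hyps(2)] by metis
    then show ?thesis using neg_prec_mid[OF assms(1) a(1,2) u] by blast
  next
    assume "\<exists>a. mid a \<and> below (tgt C a) u"
    then show ?thesis using step.hyps(2) by (meson rtranclp.rtrancl_into_rtrancl)
  qed
qed

text \<open>The zig-zag on \<open>c\<close> descends in the next tree along its left part and ascends along its right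
  part, so \<open>zkey\<close> increases along it.\<close>

definition zkey :: "'a \<Rightarrow> int" where
  "zkey a = (if neg c (tgt C a) then - 1 - int (depth (tgt C a))
     else if pos c (tgt C a) then 1 + int (depth (tgt C a)) else 0)"

lemma zkey_left: "neg c (tgt C a) \<Longrightarrow> zkey a = - 1 - int (depth (tgt C a))"
  by (simp add: zkey_def)

lemma zkey_right: "pos c (tgt C a) \<Longrightarrow> zkey a = 1 + int (depth (tgt C a))"
  using not_pos_neg by (auto simp: zkey_def)

lemma zkey_mid: "mid a \<Longrightarrow> zkey a = 0"
  using mid_not_tgt[of a 1] mid_not_tgt[of a "-1"] by (simp add: zkey_def)

text \<open>Either the chain continues and the depth drops, which raises the key on the left part,
  or the next node is the turning node, with key 0.\<close>

lemma zkey_less_left: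
  assumes "a \<in> Lam C" "a' \<in> Lam C" "neg c b" "pos b a" "neg b a'"
  shows "zkey a < zkey a'"
proof -
  have b: "b = tgt C a" using pos_tgt assms by blast
  have k: "zkey a = - 1 - int (depth b)" using zkey_left assms b by simp
  show ?thesis
  proof (cases "neg c (tgt C a')")
    case True
    have "depth (tgt C a') < depth b"
      using step_depth[OF stepI[OF assms(2,5)]] up_dim[OF assms(3)] by simp
    then show ?thesis using zkey_left[OF True] k by simp
  next
    case False
    then have "mid a'" using neg_prec_mid[of "-1" a' b] assms by simp
    then show ?thesis using zkey_mid k by simp
  qed
qed

lemma zkey_less_right:
  assumes "a \<in> Lam C" "a' \<in> Lam C" "pos c b" "neg b a" "pos b a'"
  shows "zkey a < zkey a'"
proof -
  have b: "b = tgt C a'" using pos_tgt assms by blast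
  have k: "zkey a' = 1 + int (depth b)" using zkey_right assms b by simp
  show ?thesis
  proof (cases "pos c (tgt C a)")
    case True
    have "depth (tgt C a) < depth b"
      using step_depth[OF stepI[OF assms(1,4)]] up_dim[OF assms(3)] by simp
    then show ?thesis using zkey_right[OF True] k by simp
  next
    case False
    then have "mid a" using neg_prec_mid[of 1 a b] assms by simp
    then show ?thesis using zkey_mid k by simp
  qed
qed

section \<open>Existence of the zig-zag\<close>

definition zzlocal :: "nat \<Rightarrow> nat \<Rightarrow> (nat \<Rightarrow> 'a) \<Rightarrow> (nat \<Rightarrow> 'a) \<Rightarrow> bool" where
  "zzlocal p q b a \<longleftrightarrow>
    (\<forall>i\<in>{1..q}. prec C (if i \<le> p then -1 else 1) c (b i)) \<and>
    (\<forall>i\<in>{1..<q}. a i \<in> Lam C \<and>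
       (i < p \<longrightarrow> prec C (-1) (b i) (a i) \<and> prec C 1 (b (Suc i)) (a i)) \<and>
       (i = p \<longrightarrow> prec C (-1) (b i) (a i) \<and> prec C (-1) (b (Suc i)) (a i)) \<and>
       (i > p \<longrightarrow> prec C 1 (b i) (a i) \<and> prec C (-1) (b (Suc i)) (a i)))"

lemma zzlocalD:
  assumes "zzlocal p q b a" "i \<in> {1..<q}"
  shows "a i \<in> Lam C"
    "i < p \<Longrightarrow> neg c (b (Suc i)) \<and> neg (b i) (a i) \<and> pos (b (Suc i)) (a i)"
    "i = p \<Longrightarrow> pos c (b (Suc i)) \<and> neg (b i) (a i) \<and> neg (b (Suc i)) (a i)"
    "i > p \<Longrightarrow> pos c (b (Suc i)) \<and> pos (b i) (a i) \<and> neg (b (Suc i)) (a i)"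
proof -
  have 1: "prec C (if Suc i \<le> p then -1 else 1) c (b (Suc i))"
  proof -
    have "\<forall>i\<in>{1..q}. prec C (if i \<le> p then -1 else 1) c (b i)"
      using assms(1) unfolding zzlocal_def by (elim conjE)
    from bspec[OF this, of "Suc i"] show ?thesis using assms(2) by simp
  qed
  have 2: "a i \<in> Lam C \<and>
       (i < p \<longrightarrow> neg (b i) (a i) \<and> pos (b (Suc i)) (a i)) \<and>
       (i = p \<longrightarrow> neg (b i) (a i) \<and> neg (b (Suc i)) (a i)) \<and>
       (i > p \<longrightarrow> pos (b i) (a i) \<and> neg (b (Suc i)) (a i))"
    using assms unfolding zzlocal_def by (elim conjE) (rule bspec)
  show "a i \<in> Lam C"
    "i < p \<Longrightarrow> neg c (b (Suc i)) \<and> neg (b i) (a i) \<and> pos (b (Suc i)) (a i)"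
    "i = p \<Longrightarrow> pos c (b (Suc i)) \<and> neg (b i) (a i) \<and> neg (b (Suc i)) (a i)"
    "i > p \<Longrightarrow> pos c (b (Suc i)) \<and> pos (b i) (a i) \<and> neg (b (Suc i)) (a i)"
    using 1 2 by simp_all
qed

lemma zzlocal_zkey_Suc:
  assumes z: "zzlocal p q b a" and i: "1 \<le> i" "Suc i < q"
  shows "zkey (a i) < zkey (a (Suc i))"
proof -
  have I: "i \<in> {1..<q}" "Suc i \<in> {1..<q}" using i by auto
  note L = zzlocalD(1)[OF z I(1)] zzlocalD(1)[OF z I(2)]
  show ?thesis
  proof (cases "Suc i \<le> p")
    case True
    then have "neg (b (Suc i)) (a (Suc i))"
      using zzlocalD(2,3)[OF z I(2)] by (cases "Suc i = p") simp_all
    moreover have "neg c (b (Suc i)) \<and> pos (b (Suc i)) (a i)" using zzlocalD(2)[OF z I(1)] True by simp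
    ultimately show ?thesis using zkey_less_left[OF L] by blast
  next
    case False
    then have "pos (b (Suc i)) (a (Suc i))" using zzlocalD(4)[OF z I(2)] by simp
    moreover have "pos c (b (Suc i)) \<and> neg (b (Suc i)) (a i)"
      using zzlocalD(3,4)[OF z I(1)] False by (cases "i = p") simp_all
    ultimately show ?thesis using zkey_less_right[OF L] by blast
  qed
qed

lemma zzlocal_zkey:
  assumes "zzlocal p q b a" "1 \<le> i" "i < j" "j < q"
  shows "zkey (a i) < zkey (a j)"
  using assms(3,4)
proof (induction j)
  case (Suc j)
  then show ?case
  proof (cases "i = j")
    case True then show ?thesis using zzlocal_zkey_Suc[OF assms(1,2)] Suc.prems by simp
  next
    case False
    then have "zkey (a i) < zkey (a j)" using Suc by simp
    also have "\<dots> < zkey (a (Suc j))" using zzlocal_zkey_Suc[OF assms(1), of j] Suc.prems assms(2) by simp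
    finally show ?thesis .
  qed
qed simp

lemma zzlocal_inj:
  assumes "zzlocal p q b a" shows "inj_on a {1..<q}"
proof (rule inj_onI)
  fix i j assume "i \<in> {1..<q}" "j \<in> {1..<q}" "a i = a j"
  then show "i = j" using zzlocal_zkey[OF assms, of i j] zzlocal_zkey[OF assms, of j i]
    by (cases i j rule: linorder_cases) auto
qed

text \<open>The incidence clauses alone make \<open>zkey\<close> strictly increasing, so injectivity
  of \<open>a\<close> comes for free and only exhaustiveness remains to be checked.\<close>

lemma zigzag_iff:
  "zigzag C c p q b a \<longleftrightarrow> p \<le> q \<and> zzlocal p q b a \<and>
    (\<forall>x\<in>Lam C. \<forall>y \<alpha> \<beta>. \<alpha> \<noteq> 0 \<and> \<beta> \<noteq> 0 \<and> prec C \<beta> c y \<and> prec C \<alpha> y x \<longrightarrow>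
       (\<exists>i\<in>{1..<q}. x = a i \<and> (y = b i \<or> y = b (Suc i))))" (is "_ \<longleftrightarrow> ?r")
proof
  show "zigzag C c p q b a \<Longrightarrow> ?r" unfolding zigzag_def zzlocal_def by (elim conjE) (intro conjI)
  assume r: ?r
  then have "inj_on a {1..<q}" using zzlocal_inj by blast
  then show "zigzag C c p q b a" using r unfolding zigzag_def zzlocal_def
    by (elim conjE) (intro conjI)
qed

text \<open>One half of the zig-zag, read from its leaf downwards with indices from 0;
  \<open>n = 0\<close> is the empty half. The third clause records where a half stops: at the root,
  or above the turning node, where the other half joins.\<close>

definition chain_listing :: "int \<Rightarrow> nat \<Rightarrow> (nat \<Rightarrow> 'a) \<Rightarrow> (nat \<Rightarrow> 'a) \<Rightarrow> bool" where
  "chain_listing \<beta> n h a \<longleftrightarrow> (\<forall>i<n. prec C \<beta> c (h i)) \<and>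
    (\<forall>i. Suc i < n \<longrightarrow> a i \<in> Lam C \<and> neg (h i) (a i) \<and> pos (h (Suc i)) (a i)) \<and>
    (n > 0 \<longrightarrow> h (n - 1) = R \<or> (\<exists>x. mid x \<and> neg (h (n - 1)) x)) \<and>
    (\<forall>x\<in>Lam C. \<forall>y \<alpha>. \<alpha> \<noteq> 0 \<and> prec C \<beta> c y \<and> prec C \<alpha> y x \<longrightarrow>
       (\<exists>i. Suc i < n \<and> x = a i \<and> (y = h i \<or> y = h (Suc i))) \<or> (n > 0 \<and> mid x \<and> y = h (n - 1)))"

lemma chain_listing_exists:
  assumes \<beta>: "\<beta> = 1 \<or> \<beta> = -1"
  shows "\<exists>n h a. chain_listing \<beta> n h a"
proof (cases "\<exists>b. prec C \<beta> c b")
  case False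
  then show ?thesis by (intro exI[of _ 0]) (auto simp: chain_listing_def)
next
  case True
  then obtain b0 where b0: "prec C \<beta> c b0" by blast
  \<comment> \<open>\<open>e\<close> becomes the last cell of the half and the leaf \<open>t\<close>
    above it the first. Minimal depth forbids any continuation past \<open>e\<close>.\<close>
  obtain e where e: "prec C \<beta> c e" "\<And>y. prec C \<beta> c y \<Longrightarrow> depth e \<le> depth y"
    using ex_has_least_nat[of "\<lambda>b. prec C \<beta> c b" b0 depth] b0 by blast
  obtain t where t: "t \<in> Lam C" "prec C \<beta> c t" "(bstep \<beta>)\<^sup>*\<^sup>* t e" using climb[OF \<beta> e(1)] by blast
  obtain N where "(bstep \<beta> ^^ N) t e" using t(3) rtranclp_imp_relpowp by metis
  then obtain h where h: "h 0 = t" "h N = e" "\<forall>i<N. bstep \<beta> (h i) (h (Suc i))"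
    by (auto simp: relpowp_fun_conv)
  have hp: "prec C \<beta> c (h i)" if "i \<le> N" for i
    using that h e(1) by (cases "i = N") (auto simp: bstep_def)
  have "\<forall>i. \<exists>a. i < N \<longrightarrow> a \<in> Lam C \<and> neg (h i) a \<and> pos (h (Suc i)) a"
    using h(3) unfolding bstep_def step_def by blast
  from choice[OF this] obtain a where
    a: "\<And>i. i < N \<Longrightarrow> a i \<in> Lam C" "\<And>i. i < N \<Longrightarrow> neg (h i) (a i)" "\<And>i. i < N \<Longrightarrow> pos (h (Suc i)) (a i)"
    by blast
  have enum: "\<exists>i\<le>N. y = h i" if y: "prec C \<beta> c y" for y
  proof -
    obtain t' where t': "t' \<in> Lam C" "prec C \<beta> c t'" "(bstep \<beta>)\<^sup>*\<^sup>* t' y" using climb[OF \<beta> y] by blast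
    have "t' = t" using top_unique[OF \<beta>] t t' by blast
    with t'(3) have "(bstep \<beta>)\<^sup>*\<^sup>* t y" by simp
    then show ?thesis
    proof (induction rule: rtranclp_induct)
      case base then show ?case using h(1) by blast
    next
      case (step u v)
      then obtain i where i: "i \<le> N" "u = h i" by blast
      have "i \<noteq> N"
      proof
        assume "i = N"
        then have "depth v < depth e" using step.hyps(2) i h(2) step_depth unfolding bstep_def by blast
        moreover have "depth e \<le> depth v" using step.hyps(2) e(2) unfolding bstep_def by blast
        ultimately show False by simp
      qed
      then have "v = h (Suc i)" "Suc i \<le> N" using bstep_fun step.hyps(2) i h(3) by auto
      then show ?case by blast
    qed
  qed
  have last: "mid x" if x: "x \<in> Lam C" "neg e x" for x
  proof (rule neg_prec_mid[OF \<beta> x e(1)])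
    show "\<not> prec C \<beta> c (tgt C x)"
    proof
      assume "prec C \<beta> c (tgt C x)"
      moreover have "depth (tgt C x) < depth e" using step_depth[OF stepI[OF x]] up_dim[OF e(1)] by simp
      ultimately show False using e(2) by fastforce
    qed
  qed
  have neg_case: "(\<exists>i<N. x = a i \<and> y = h i) \<or> mid x \<and> y = h N"
    if x: "x \<in> Lam C" "prec C \<beta> c y" "neg y x" for x y
  proof -
    obtain i where i: "i \<le> N" "y = h i" using enum x by blast
    show ?thesis
    proof (cases "i = N")
      case True then show ?thesis using i h(2) last x by blast
    next
      case False
      then have "i < N" using i by simp
      then show ?thesis using neg_Lam_unique[OF x(1) a(1)] a(2) i x(3) up_dim[OF x(2)] by auto
    qed
  qed
  have cover: "(\<exists>i<N. x = a i \<and> (y = h i \<or> y = h (Suc i))) \<or> mid x \<and> y = h N"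
    if x: "x \<in> Lam C" "\<alpha> \<noteq> 0" "prec C \<beta> c y" "prec C \<alpha> y x" for x y \<alpha>
  proof (cases "\<alpha> = 1")
    case True
    then have p: "pos y x" using x by simp
    obtain b where b: "neg b x" "prec C \<beta> c b" using tgt_prec[OF \<beta> p x(3)] .
    have "\<not> mid x" using mid_not_tgt[OF _ \<beta>] x(3) pos_tgt[OF p] by blast
    then obtain i where i: "i < N" "x = a i" using neg_case[OF x(1) b(2,1)] by blast
    then have "y = h (Suc i)" using a(3)[OF i(1)] pos_tgt p by metis
    then show ?thesis using i by blast
  next
    case False
    then have "neg y x" using x prec_sign[OF x(4)] by auto
    then show ?thesis using neg_case x by blast
  qed
  have ending: "h N = R \<or> (\<exists>x. mid x \<and> neg (h N) x)"
  proof (cases "e = R")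
    case False
    obtain x where "x \<in> Lam C" "neg e x"
      using ex_neg_Lam[of e "Suc m"] precD[OF e(1)] up_dim[OF e(1)] m_less False by metis
    then show ?thesis using last h(2) by blast
  qed (use h in blast)
  have "chain_listing \<beta> (Suc N) h a"
    unfolding chain_listing_def
  proof (intro conjI ballI allI impI)
    fix x y \<alpha> assume "x \<in> Lam C" "\<alpha> \<noteq> 0 \<and> prec C \<beta> c y \<and> prec C \<alpha> y x"
    then show "(\<exists>i. Suc i < Suc N \<and> x = a i \<and> (y = h i \<or> y = h (Suc i))) \<or>
        0 < Suc N \<and> mid x \<and> y = h (Suc N - 1)"
      using cover[of x \<alpha> y] by auto
  qed (use hp a ending in simp_all)
  then show ?thesis by blast
qed

lemma zigzag_exists: "\<exists>p q b a. zigzag C c p q b a"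
proof -
  obtain n1 h1 a1 where l1: "chain_listing (-1) n1 h1 a1"
    using chain_listing_exists[of "-1"] by auto
  have h1: "\<And>i. i < n1 \<Longrightarrow> neg c (h1 i)" and
    a1: "\<And>i. Suc i < n1 \<Longrightarrow> a1 i \<in> Lam C \<and> neg (h1 i) (a1 i) \<and> pos (h1 (Suc i)) (a1 i)" and
    e1: "n1 > 0 \<Longrightarrow> h1 (n1 - 1) = R \<or> (\<exists>x. mid x \<and> neg (h1 (n1 - 1)) x)" 
    using l1 unfolding chain_listing_def by simp_all
  have c1: "(\<exists>i. Suc i < n1 \<and> x = a1 i \<and> (y = h1 i \<or> y = h1 (Suc i))) \<or> (n1 > 0 \<and> mid x \<and> y = h1 (n1 - 1))"
    if "x \<in> Lam C" "\<alpha> \<noteq> 0" "neg c y" "prec C \<alpha> y x" for x y \<alpha>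
    using l1 that unfolding chain_listing_def by blast
  obtain n2 h2 a2 where l2: "chain_listing (1) n2 h2 a2"
    using chain_listing_exists[of "1"] by auto
  have h2: "\<And>i. i < n2 \<Longrightarrow> pos c (h2 i)" and
    a2: "\<And>i. Suc i < n2 \<Longrightarrow> a2 i \<in> Lam C \<and> neg (h2 i) (a2 i) \<and> pos (h2 (Suc i)) (a2 i)" and
    e2: "n2 > 0 \<Longrightarrow> h2 (n2 - 1) = R \<or> (\<exists>x. mid x \<and> neg (h2 (n2 - 1)) x)" 
    using l2 unfolding chain_listing_def by simp_all
  have c2: "(\<exists>i. Suc i < n2 \<and> x = a2 i \<and> (y = h2 i \<or> y = h2 (Suc i))) \<or> (n2 > 0 \<and> mid x \<and> y = h2 (n2 - 1))"
    if "x \<in> Lam C" "\<alpha> \<noteq> 0" "pos c y" "prec C \<alpha> y x" for x y \<alpha>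
    using l2 that unfolding chain_listing_def by blast
  define am where "am = (SOME x. mid x)"
  have am: "mid am" "neg (h1 (n1 - 1)) am" "neg (h2 (n2 - 1)) am" "n1 > 0" "n2 > 0" if ex: "\<exists>x. mid x"
  proof -
    show mm: "mid am" using someI_ex[OF ex] unfolding am_def .
    have aL: "am \<in> Lam C" using mm by (simp add: mid_def)
    obtain y where y: "neg y am" "neg c y" using mm by (auto simp: mid_def)
    have "\<not> pos z am" if "neg c z" for z using mid_not_tgt[OF mm, of "-1"] that pos_tgt by blast
    then have "\<not> (\<exists>i. Suc i < n1 \<and> am = a1 i)" using a1 h1 by blast
    then have "n1 > 0 \<and> y = h1 (n1 - 1)" using c1[OF aL _ y(2,1)] by auto
    then show "n1 > 0" "neg (h1 (n1 - 1)) am" using y by auto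
    obtain y where y: "neg y am" "pos c y" using mm by (auto simp: mid_def)
    have "\<not> pos z am" if "pos c z" for z using mid_not_tgt[OF mm, of 1] that pos_tgt by blast
    then have "\<not> (\<exists>i. Suc i < n2 \<and> am = a2 i)" using a2 h2 by blast
    then have "n2 > 0 \<and> y = h2 (n2 - 1)" using c2[OF aL _ y(2,1)] by auto
    then show "n2 > 0" "neg (h2 (n2 - 1)) am" using y by auto
  qed
  \<comment> \<open>Two nonempty halves cannot both run into the root, since \<open>R\<close> would
    meet \<open>c\<close> with both signs.\<close>
  have both: "\<exists>x. mid x" if "n1 > 0" "n2 > 0"
  proof (rule ccontr)
    assume "\<nexists>x. mid x"
    then have "h1 (n1 - 1) = R" "h2 (n2 - 1) = R" using e1 e2 that by blast+
    then have "neg c R" "pos c R" using h1[of "n1 - 1"] h2[of "n2 - 1"] that by auto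
    then show False using not_pos_neg by blast
  qed
  \<comment> \<open>The negative half is shifted to start at index 1, the positive half is reversed,
    and the node at index \<open>n1\<close> joins them. If one half is empty, \<open>n1\<close>
    falls outside \<open>{1..<q}\<close>.\<close>
  define q where "q = n1 + n2"
  define b where "b i = (if i \<le> n1 then h1 (i - 1) else h2 (q - i))" for i
  define a where "a i = (if i < n1 then a1 (i - 1) else if i = n1 then am else a2 (q - 1 - i))" for i
  have "zzlocal n1 q b a"
    unfolding zzlocal_def
  proof (rule conjI; rule ballI)
    fix i assume i: "i \<in> {1..q}"
    show "prec C (if i \<le> n1 then -1 else 1) c (b i)"
      using h1[of "i - 1"] h2[of "q - i"] i by (auto simp: b_def q_def)
  next
    fix i assume i: "i \<in> {1..<q}"
    show "a i \<in> Lam C \<and>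
       (i < n1 \<longrightarrow> prec C (-1) (b i) (a i) \<and> prec C 1 (b (Suc i)) (a i)) \<and>
       (i = n1 \<longrightarrow> prec C (-1) (b i) (a i) \<and> prec C (-1) (b (Suc i)) (a i)) \<and>
       (i > n1 \<longrightarrow> prec C 1 (b i) (a i) \<and> prec C (-1) (b (Suc i)) (a i))"
    proof (cases i n1 rule: linorder_cases)
      case less
      then have "a i = a1 (i - 1)" "b i = h1 (i - 1)" "b (Suc i) = h1 (Suc (i - 1))"
        using i by (auto simp: a_def b_def)
      then show ?thesis using a1[of "i - 1"] less i by auto
    next
      case equal
      then have "n1 > 0" "n2 > 0" using i by (auto simp: q_def)
      moreover have "a i = am" "b i = h1 (n1 - 1)" "b (Suc i) = h2 (n2 - 1)"
        using equal i by (auto simp: a_def b_def q_def)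
      moreover have "am \<in> Lam C" if "mid am" using that by (simp add: mid_def)
      ultimately show ?thesis using am both equal by auto
    next
      case greater
      then have "a i = a2 (q - 1 - i)" "b i = h2 (Suc (q - 1 - i))" "b (Suc i) = h2 (q - 1 - i)" "Suc (q - 1 - i) < n2"
        using i by (auto simp: a_def b_def q_def Suc_diff_Suc)
      then show ?thesis using a2[of "q - 1 - i"] greater by auto
    qed
  qed
  moreover have "\<exists>i\<in>{1..<q}. x = a i \<and> (y = b i \<or> y = b (Suc i))"
    if x: "x \<in> Lam C" and xy: "\<alpha> \<noteq> 0" "\<beta> \<noteq> 0" "prec C \<beta> c y" "prec C \<alpha> y x" for x y \<alpha> \<beta>
  proof -
    have "\<beta> = 1 \<or> \<beta> = -1" using prec_sign xy by blast
    then show ?thesis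
    proof
      assume "\<beta> = -1"
      then have "neg c y" using xy by simp
      from c1[OF x xy(1) this xy(4)] show ?thesis
      proof
        assume "\<exists>i. Suc i < n1 \<and> x = a1 i \<and> (y = h1 i \<or> y = h1 (Suc i))"
        then obtain i where i: "Suc i < n1" "x = a1 i" "y = h1 i \<or> y = h1 (Suc i)" by blast
        have "a (Suc i) = a1 i" "b (Suc i) = h1 i" "b (Suc (Suc i)) = h1 (Suc i)" "Suc i \<in> {1..<q}"
          using i by (auto simp: a_def b_def q_def)
        then show ?thesis using i by (intro bexI[of _ "Suc i"]) auto
      next
        assume m: "n1 > 0 \<and> mid x \<and> y = h1 (n1 - 1)"
        then have "n2 > 0" "x = am" using am mid_unique by blast+
        then have "a n1 = x" "b n1 = y" "n1 \<in> {1..<q}" using m by (auto simp: a_def b_def q_def)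
        then show ?thesis by (intro bexI[of _ n1]) auto
      qed
    next
      assume "\<beta> = 1"
      then have "pos c y" using xy by simp
      from c2[OF x xy(1) this xy(4)] show ?thesis
      proof
        assume "\<exists>i. Suc i < n2 \<and> x = a2 i \<and> (y = h2 i \<or> y = h2 (Suc i))"
        then obtain i where i: "Suc i < n2" "x = a2 i" "y = h2 i \<or> y = h2 (Suc i)" by blast
        let ?j = "q - 1 - i"
        have "a ?j = a2 i" "b (Suc ?j) = h2 i" "b ?j = h2 (Suc i)" "?j \<in> {1..<q}"
          using i by (auto simp: a_def b_def q_def Suc_diff_Suc)
        then show ?thesis using i by (intro bexI[of _ ?j]) auto
      next
        assume m: "n2 > 0 \<and> mid x \<and> y = h2 (n2 - 1)"
        then have "n1 > 0" "x = am" using am mid_unique by blast+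
        then have "a n1 = x" "b (Suc n1) = y" "n1 \<in> {1..<q}" using m by (auto simp: a_def b_def q_def)
        then show ?thesis by (intro bexI[of _ n1]) auto
      qed
    qed
  qed
  moreover have "n1 \<le> q" by (simp add: q_def)
  ultimately have "zigzag C c n1 q b a" unfolding zigzag_iff by blast
  then show ?thesis by blast
qed

lemma zigzag_Ac:
  assumes "zigzag C c p q b a" "i \<in> {1..<q}"
  shows "a i \<in> Ac"
proof -
  have z: "zzlocal p q b a" using assms zigzag_iff by blast
  consider "i < p" | "i = p" | "i > p" by linarith
  then show ?thesis
  proof cases
    case 1 then show ?thesis using AcI[OF zzlocalD(1)[OF z assms(2)], of 1 _ "-1"] zzlocalD(2)[OF z assms(2)] by auto
  next
    case 2 then show ?thesis using AcI[OF zzlocalD(1)[OF z assms(2)], of "-1" _ 1] zzlocalD(3)[OF z assms(2)] by auto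
  next
    case 3 then show ?thesis using AcI[OF zzlocalD(1)[OF z assms(2)], of "-1" _ 1] zzlocalD(4)[OF z assms(2)] by auto
  qed
qed

lemma Ac_zigzag:
  assumes "zigzag C c p q b a" "x \<in> Ac"
  obtains i where "i \<in> {1..<q}" "x = a i"
proof -
  obtain y where y: "x \<in> Lam C" "neg y x" "neg c y \<or> pos c y" using assms(2) by (auto simp: Ac_def)
  then obtain \<beta> where "\<beta> \<noteq> 0" "prec C \<beta> c y" by (metis zero_neq_one zero_neq_neg_one)
  then have "\<exists>i\<in>{1..<q}. x = a i \<and> (y = b i \<or> y = b (Suc i))"
    using assms(1) y unfolding zigzag_iff by (metis zero_neq_neg_one)
  then show ?thesis using that by blast
qed

text \<open>A zig-zag lists all of \<open>Ac\<close>, and the key, which is defined without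
  reference to it, increases strictly along it.\<close>

lemma zkey_inj:
  assumes "x \<in> Ac" "y \<in> Ac" "zkey x = zkey y" shows "x = y"
proof -
  obtain p q b a where z: "zigzag C c p q b a" using zigzag_exists by blast
  then have zl: "zzlocal p q b a" using zigzag_iff by blast
  obtain i where i: "i \<in> {1..<q}" "x = a i" using Ac_zigzag[OF z assms(1)] .
  obtain j where j: "j \<in> {1..<q}" "y = a j" using Ac_zigzag[OF z assms(2)] .
  show ?thesis using zzlocal_zkey[OF zl, of i j] zzlocal_zkey[OF zl, of j i] i j assms(3)
    by (cases i j rule: linorder_cases) auto
qed

section \<open>Loops on \<open>c\<close> and the nodes through which their paths leave\<close>

abbreviation lsub where "lsub \<equiv> loop_subset C c"

definition lstep :: "'a \<Rightarrow> 'a \<Rightarrow> bool" where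
  "lstep u v \<longleftrightarrow> step u v \<and> lop c u \<and> lop c v"

lemma loop_subset1_iff: "loop_subset1 C c u v \<longleftrightarrow> lstep u v"
  using up_dim[of 0 u] unfolding loop_subset1_def lstep_def step_def by auto

lemma lsub_eq: "lsub = lstep\<^sup>*\<^sup>*"
proof -
  have "loop_subset1 C c = lstep" by (intro ext) (rule loop_subset1_iff)
  then show ?thesis by (simp add: loop_subset_def)
qed

lemma lstep_fun: "lstep x y \<Longrightarrow> lstep x z \<Longrightarrow> y = z"
  using step_fun unfolding lstep_def by blast

lemma lsub_refl: "lsub x x" by (simp add: lsub_eq)

lemma lsub_trans: "lsub x y \<Longrightarrow> lsub y z \<Longrightarrow> lsub x z"
  unfolding lsub_eq by (rule rtranclp_trans)

lemma lsub_step: "lstep x y \<Longrightarrow> lsub x y" unfolding lsub_eq by blast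

lemma lsub_below: "lsub x y \<Longrightarrow> below x y"
  unfolding lsub_eq by (rule rtranclp_mono[THEN predicate2D, rotated]) (auto simp: lstep_def)

lemma lsub_chain: "lsub b x \<Longrightarrow> lsub b y \<Longrightarrow> lsub x y \<or> lsub y x"
  unfolding lsub_eq using functional_chain[of lstep b x y] lstep_fun by blast

lemma lsub_lop_iff: "lsub x y \<Longrightarrow> lop c x \<longleftrightarrow> lop c y"
  unfolding lsub_eq by (induction rule: rtranclp_induct) (auto simp: lstep_def)

lemma lstep_neg:
  assumes "lstep x y" "a \<in> Lam C" "neg x a"
  shows "y = tgt C a"
proof -
  have "step x y" using assms(1) by (simp add: lstep_def)
  moreover have "dim C x \<ge> 0" using assms(1) up_dim[of 0 x] by (simp add: lstep_def)
  ultimately show ?thesis using step_fun stepI assms by blast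
qed

lemma lsub_neg:
  assumes "lsub x y" "x \<noteq> y" "a \<in> Lam C" "neg x a"
  shows "lsub (tgt C a) y" "lstep x (tgt C a)"
proof -
  obtain z where z: "lstep x z" "lsub z y"
    using assms(1,2) unfolding lsub_eq by (metis converse_rtranclpE)
  have "z = tgt C a" using lstep_neg z(1) assms by blast
  then show "lsub (tgt C a) y" "lstep x (tgt C a)" using z by auto
qed

text \<open>\<open>att u v a\<close>: the descending path from \<open>u\<close> leaves the loops on \<open>c\<close> through the node \<open>a\<close> of the
  zig-zag, \<open>v\<close> being the last loop.\<close>

definition att :: "'a \<Rightarrow> 'a \<Rightarrow> 'a \<Rightarrow> bool" where
  "att u v a \<longleftrightarrow> lsub u v \<and> lop c v \<and> neg v a \<and> a \<in> Ac"

lemma Ac_Lam: "a \<in> Ac \<Longrightarrow> a \<in> Lam C" by (simp add: Ac_def)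

lemma Ac_not_lop: "a \<in> Ac \<Longrightarrow> \<not> lop z (tgt C a)"
  using Ac_tgt not_lop_pos by blast

text \<open>The target of a zig-zag node is not a loop, so the chain of loops ends at
  \<open>v\<close>.\<close>

lemma att_top:
  assumes "att u v a" "lsub v w" shows "w = v"
proof (rule ccontr)
  assume "w \<noteq> v"
  then have "lstep v (tgt C a)" using lsub_neg[of v w a] assms Ac_Lam by (auto simp: att_def)
  then show False using Ac_not_lop assms unfolding att_def lstep_def by blast
qed

lemma att_lsub:
  assumes "lsub u t" shows "att u v a \<longleftrightarrow> att t v a"
proof
  assume a: "att u v a"
  then have "lsub v t \<or> lsub t v" using lsub_chain assms unfolding att_def by blast
  then have "lsub t v" using att_top[OF a] lsub_refl by metis
  then show "att t v a" using a by (simp add: att_def)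
next
  assume "att t v a"
  then show "att u v a" using lsub_trans assms unfolding att_def by blast
qed

lemma att_unique:
  assumes "att u v a" "att u v' a'" shows "v = v'" "a = a'"
proof -
  have "lsub v v' \<or> lsub v' v" using lsub_chain assms unfolding att_def by blast
  then show v: "v = v'" using att_top assms by blast
  have "dim C v \<ge> 0" using assms(1) up_dim[of 0 v] by (simp add: att_def)
  then show "a = a'" using neg_Lam_unique assms v Ac_Lam unfolding att_def by blast
qed

definition At :: "'a \<Rightarrow> 'a \<Rightarrow> bool" where "At u a \<longleftrightarrow> (\<exists>v. att u v a)"

lemma At_unique: "At u a \<Longrightarrow> At u a' \<Longrightarrow> a = a'"
  using att_unique unfolding At_def by blast

lemma At_lsub: "lsub u t \<Longrightarrow> At u a \<longleftrightarrow> At t a"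
  using att_lsub unfolding At_def by blast

lemma At_Ac: "At u a \<Longrightarrow> a \<in> Ac" unfolding At_def att_def by blast

text \<open>The loop clause of thinness at a node: the loop on \<open>c\<close> is handed on to the
  target, or some source meets \<open>c\<close> with a nonzero sign and the node belongs to the
  zig-zag.\<close>

lemma lop_neg_cases:
  assumes "lop c v" "a \<in> Lam C" "neg v a"
  shows "lstep v (tgt C a) \<or> a \<in> Ac"
proof -
  have "step v (tgt C a)" using stepI assms(2,3) up_dim[OF assms(1)] by simp
  then show ?thesis using thin_lop[OF assms(1,3)] assms unfolding lstep_def Ac_def by blast
qed

lemma loop_below_cases:
  assumes "lop c u" "below u g"
  shows "lop c g \<and> lsub u g \<or> (\<exists>v a. att u v a \<and> below (tgt C a) g)"
  using assms(2)
proof (induction rule: rtranclp_induct)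
  case base then show ?case using assms(1) lsub_refl by blast
next
  case (step w g)
  from step.IH show ?case
  proof
    assume w: "lop c w \<and> lsub u w"
    obtain a where a: "a \<in> Lam C" "neg w a" "g = tgt C a" using stepD[OF step.hyps(2)] by metis
    from lop_neg_cases[OF conjunct1[OF w] a(1,2)] show ?thesis
    proof
      assume "lstep w (tgt C a)"
      then show ?thesis using w a(3) lsub_step lsub_trans unfolding lstep_def by blast
    next
      assume "a \<in> Ac"
      then have "att u w a" using w a by (simp add: att_def)
      then show ?thesis using a(3) by blast
    qed
  next
    assume "\<exists>v a. att u v a \<and> below (tgt C a) w"
    then show ?thesis using step.hyps(2) by (meson rtranclp.rtrancl_into_rtrancl)
  qed
qed

lemma below_pos:
  assumes "below b g" "pos (tgt C b) b" shows "pos (tgt C g) g"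
  using assms
proof (induction rule: rtranclp_induct)
  case (step u v)
  then obtain a where a: "neg u a" "v = tgt C a" using stepD[OF step.hyps(2)] by metis
  then show ?case using pos_tgt_tgt[OF a(1)] step by blast
qed simp

lemma At_or_root:
  assumes "lop c u" shows "(\<exists>a. At u a) \<or> lsub u R"
proof -
  have "below u R" using below_iter_tgt[of u "Suc m"] precD[OF assms] up_dim[OF assms] m_less by simp
  then show ?thesis using loop_below_cases[OF assms] unfolding At_def by blast
qed

text \<open>Frees the relation from the choice of a zig-zag: positions in any of them are ordered as
  the keys are.\<close>

lemma before1_iff:
  "before1 C c u u' \<longleftrightarrow> (\<exists>a a'. At u a \<and> At u' a' \<and> zkey a < zkey a')"
proof
  assume "before1 C c u u'"
  then obtain p q b a i j v v' where z: "zigzag C c p q b a"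
    "i \<in> {1..<q}" "j \<in> {1..<q}" "i < j" and
    v: "lop c v" "neg v (a i)" "lop c v'" "neg v' (a j)" "lsub u v" "lsub u' v'"
    unfolding before1_def by blast
  have "zkey (a i) < zkey (a j)" using zzlocal_zkey[of p q b a i j] z zigzag_iff[of p q b a] by auto
  moreover have "att u v (a i)" "att u' v' (a j)" using v zigzag_Ac[OF z(1)] z by (auto simp: att_def)
  ultimately show "\<exists>a a'. At u a \<and> At u' a' \<and> zkey a < zkey a'" unfolding At_def by blast
next
  assume "\<exists>a a'. At u a \<and> At u' a' \<and> zkey a < zkey a'"
  then obtain x x' where x: "At u x" "At u' x'" "zkey x < zkey x'" by blast
  obtain p q b a where z: "zigzag C c p q b a" using zigzag_exists by blast
  obtain i where i: "i \<in> {1..<q}" "x = a i" using Ac_zigzag[OF z At_Ac[OF x(1)]] .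
  obtain j where j: "j \<in> {1..<q}" "x' = a j" using Ac_zigzag[OF z At_Ac[OF x(2)]] .
  have "zzlocal p q b a" using z zigzag_iff by blast
  then have "\<not> j \<le> i" using zzlocal_zkey[of p q b a j i] i j x(3) by (auto simp: le_less)
  then have ij: "i < j" by simp
  obtain v v' where v: "att u v (a i)" "att u' v' (a j)" using x(1,2) i j unfolding At_def by blast
  show "before1 C c u u'"
    unfolding before1_def
    by (rule exI[of _ p], rule exI[of _ q], rule exI[of _ b], rule exI[of _ a], rule exI[of _ i],
       rule exI[of _ j], rule exI[of _ v], rule exI[of _ v']) (use z i(1) j(1) ij v in \<open>simp add: att_def\<close>)
qed

text \<open>\<open>lt2\<close> compares two loops at the node where their descending paths meet.\<close>

definition lt2 :: "'a \<Rightarrow> 'a \<Rightarrow> bool" where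
  "lt2 u u' \<longleftrightarrow> (\<exists>v v' a. lsub u v \<and> lsub u' v' \<and> (v, v') \<in> lorder C a c)"

lemma lorder_order:
  assumes "a \<in> Lam C" "c \<in> boundary2 C a"
  shows "strict_total_order {y. lop c y \<and> neg y a} (lorder C a c)"
  using mop assms unfolding is_mop_def by blast

lemma lorderD:
  assumes "(v, v') \<in> lorder C a c"
  shows "a \<in> Lam C" "c \<in> boundary2 C a" "lop c v" "lop c v'" "neg v a" "neg v' a" "v \<noteq> v'"
proof -
  show a: "a \<in> Lam C" "c \<in> boundary2 C a" using mop assms unfolding is_mop_def by (metis empty_iff)+
  have "lorder C a c \<subseteq> {y. lop c y \<and> neg y a} \<times> {y. lop c y \<and> neg y a}" "irrefl (lorder C a c)"
    using lorder_order[OF a] unfolding strict_total_order_def strict_linear_order_on_def by auto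
  then show "lop c v" "lop c v'" "neg v a" "neg v' a" "v \<noteq> v'" using assms by (auto simp: irrefl_def)
qed

lemma lorder_trans: "(x, y) \<in> lorder C a c \<Longrightarrow> (y, z) \<in> lorder C a c \<Longrightarrow> (x, z) \<in> lorder C a c"
  using lorder_order lorderD(1,2) unfolding strict_total_order_def strict_linear_order_on_def trans_def
  by blast

lemma lorder_total:
  assumes "a \<in> Lam C" "lop c v" "lop c v'" "neg v a" "neg v' a" "v \<noteq> v'"
  shows "(v, v') \<in> lorder C a c \<or> (v', v) \<in> lorder C a c"
proof -
  have "v \<in> boundary C a" "c \<in> boundary C v"
    using assms boundary_prec precD(1,2) by blast+
  then have "c \<in> boundary2 C a" unfolding boundary2_def by blast
  from lorder_order[OF assms(1) this] show ?thesis using assms(2-)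
    unfolding strict_total_order_def strict_linear_order_on_def total_on_def by blast
qed

lemma neg_unique_lop: "a \<in> Lam C \<Longrightarrow> a' \<in> Lam C \<Longrightarrow> lop c v \<Longrightarrow> neg v a \<Longrightarrow> neg v a' \<Longrightarrow> a = a'"
  using neg_Lam_unique up_dim[of 0 v] by simp

text \<open>The compared loops are sources of one node. Either both paths leave there, or both
  continue through its target, and from then on they agree.\<close>

lemma lt2_At:
  assumes "lt2 u u'" shows "At u x \<longleftrightarrow> At u' x"
proof -
  obtain v v' a where v: "lsub u v" "lsub u' v'" and o: "(v, v') \<in> lorder C a c"
    using assms unfolding lt2_def by blast
  note d = lorderD[OF o]
  show ?thesis
  proof (cases "a \<in> Ac")
    case True
    then have "att u v a" "att u' v' a" using v d by (auto simp: att_def)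
    then have "At u a" "At u' a" unfolding At_def by blast+
    then show ?thesis using At_unique by blast
  next
    case False
    then have "lstep v (tgt C a)" "lstep v' (tgt C a)"
      using lop_neg_cases[OF d(3,1,5)] lop_neg_cases[OF d(4,1,6)] by auto
    then have "lsub u (tgt C a)" "lsub u' (tgt C a)" using v lsub_step lsub_trans by blast+
    then show ?thesis using At_lsub by blast
  qed
qed

text \<open>Two distinct sources of one node never lie on the same descending path: past the first,
  depth has already dropped below that of the second.\<close>

lemma lt2_irrefl: "\<not> lt2 u u"
proof
  assume "lt2 u u"
  then obtain v v' a where v: "lsub u v" "lsub u v'" and o: "(v, v') \<in> lorder C a c"
    unfolding lt2_def by blast
  note d = lorderD[OF o]
  have False if s: "lsub x y" "x \<noteq> y" "neg x a" "neg y a" "lop c y" for x y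
  proof -
    have "below (tgt C a) y" using lsub_neg[OF s(1,2) d(1) s(3)] lsub_below by blast
    moreover have "step y (tgt C a)" using stepI[OF d(1) s(4)] up_dim[OF s(5)] by simp
    ultimately show False using step_depth below_depth by fastforce
  qed
  then show False using lsub_chain[OF v] d by metis
qed

text \<open>Both comparisons take place on the path of the middle loop \<open>u'\<close>. At the
  same node, the local order is transitive. Otherwise, at the node met first, the path of the outer
  loop joins that of \<open>u'\<close>, so the comparison at the later node holds for the outer loop
  as well.\<close>

lemma lt2_trans:
  assumes "lt2 u u'" "lt2 u' u''" shows "lt2 u u''"
proof -
  obtain v v' a where v: "lsub u v" "lsub u' v'" and o: "(v, v') \<in> lorder C a c"
    using assms unfolding lt2_def by blast
  obtain w' w'' a' where w: "lsub u' w'" "lsub u'' w''" and o': "(w', w'') \<in> lorder C a' c"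
    using assms unfolding lt2_def by blast
  note d = lorderD[OF o] and d' = lorderD[OF o']
  show ?thesis
  proof (cases "v' = w'")
    case True
    then have "a = a'" using neg_unique_lop[OF d(1) d'(1) d(4,6)] d'(5) by simp
    then show ?thesis using o o' True lorder_trans v w unfolding lt2_def by blast
  next
    case False
    from lsub_chain[OF v(2) w(1)] show ?thesis
    proof
      assume "lsub v' w'"
      then have s: "lsub (tgt C a) w'" "lstep v' (tgt C a)" using lsub_neg False d by blast+
      then have "lop c (tgt C a)" by (simp add: lstep_def)
      moreover have "step v (tgt C a)" using stepI[OF d(1,5)] up_dim[OF d(3)] by simp
      ultimately have "lsub u w'" using v(1) s(1) d(3) lsub_step lsub_trans unfolding lstep_def by blast
      then show ?thesis using w o' unfolding lt2_def by blast
    next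
      assume "lsub w' v'"
      then have s: "lsub (tgt C a') v'" "lstep w' (tgt C a')" using lsub_neg False d' by metis+
      then have "lop c (tgt C a')" by (simp add: lstep_def)
      moreover have "step w'' (tgt C a')" using stepI[OF d'(1,6)] up_dim[OF d'(4)] by simp
      ultimately have "lsub u'' v'" using w(2) s(1) d'(4) lsub_step lsub_trans unfolding lstep_def by blast
      then show ?thesis using v o unfolding lt2_def by blast
    qed
  qed
qed

text \<open>At the first edge common to both paths, they arrive through its unique source node but
  from different sources of it.\<close>

lemma lsub_meet:
  assumes "lsub u w" "lsub u' w" "\<not> lsub u u'" "\<not> lsub u' u"
  shows "\<exists>v v' a. a \<in> Lam C \<and> v \<noteq> v' \<and> neg v a \<and> neg v' a \<and> lop c v \<and> lop c v' \<and> lsub u v \<and> lsub u' v'"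
  using assms(1,2) unfolding lsub_eq
proof (induction rule: rtranclp_induct)
  case base then show ?case using assms(4) by (simp add: lsub_eq)
next
  case (step w1 w)
  show ?case
  proof (cases "lsub u' w1")
    case True
    then show ?thesis using step.IH by (simp add: lsub_eq)
  next
    case False
    have uw: "lsub u w" using step.hyps unfolding lsub_eq by (meson rtranclp.rtrancl_into_rtrancl)
    then have "u' \<noteq> w" using assms(3) by blast
    then obtain w2 where w2: "lsub u' w2" "lstep w2 w"
      using step.prems unfolding lsub_eq by (metis rtranclp.cases)
    obtain a1 where a1: "a1 \<in> Lam C" "neg w1 a1" "pos w a1"
      using step.hyps(2) unfolding lstep_def step_def by blast
    obtain a2 where a2: "a2 \<in> Lam C" "neg w2 a2" "pos w a2"
      using w2(2) unfolding lstep_def step_def by blast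
    have "lop c w" using w2(2) by (simp add: lstep_def)
    then have "a1 = a2" using pos_Lam_unique[OF a1(1) a2(1) a1(3) a2(3)] up_dim[of 0 w] by simp
    moreover have "w1 \<noteq> w2" using False w2(1) by blast
    moreover have "lsub u w1" using step.hyps(1) by (simp add: lsub_eq)
    moreover have "lop c w1" "lop c w2" using step.hyps(2) w2(2) by (auto simp: lstep_def)
    ultimately show ?thesis using a1 a2 w2(1) unfolding lsub_eq by blast
  qed
qed

lemma null_loopsD:
  assumes "u \<in> null_loops C c"
  obtains a where "lop c u" "a \<in> Lam C" "a \<in> null_cells C" "pos u a"
  using assms unfolding null_loops_def by blast

text \<open>The source node of a null loop has no sources, so nothing lies above the loop. Distinct
  null loops are therefore incomparable for \<open>lsub\<close>, and when their paths merge they do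
  so as in \<open>lsub_meet\<close>.\<close>

lemma null_loop_minimal:
  assumes "u \<in> null_loops C c" "lsub x u" shows "x = u"
proof (rule ccontr)
  assume "x \<noteq> u"
  then obtain y where y: "lstep y u" using assms(2) unfolding lsub_eq by (metis rtranclp.cases)
  then obtain a where a: "a \<in> Lam C" "neg y a" "pos u a" unfolding lstep_def step_def by blast
  obtain a0 where a0: "lop c u" "a0 \<in> Lam C" "a0 \<in> null_cells C" "pos u a0"
    using null_loopsD[OF assms(1)] .
  have "a = a0" using pos_Lam_unique[OF a(1) a0(2) a(3) a0(4)] up_dim[OF a0(1)] by simp
  then show False using a0 a null_iff precD(4)[OF a(2)] by blast
qed

lemma lt2_total_aux:
  assumes "u \<in> null_loops C c" "u' \<in> null_loops C c" "u \<noteq> u'" "lsub u w" "lsub u' w"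
  shows "lt2 u u' \<or> lt2 u' u"
proof -
  have "\<not> lsub u u'" "\<not> lsub u' u" using null_loop_minimal assms by blast+
  from lsub_meet[OF assms(4,5) this] obtain v v' a where
    v: "a \<in> Lam C" "v \<noteq> v'" "neg v a" "neg v' a" "lop c v" "lop c v'" "lsub u v" "lsub u' v'" by blast
  have "(v, v') \<in> lorder C a c \<or> (v', v) \<in> lorder C a c" using lorder_total v by blast
  then show ?thesis using v(7,8) unfolding lt2_def by blast
qed

definition lt :: "'a \<Rightarrow> 'a \<Rightarrow> bool" where
  "lt u u' \<longleftrightarrow> before1 C c u u' \<or> lt2 u u'"

lemma lt2_not_before1: "lt2 u u' \<Longrightarrow> \<not> before1 C c u u' \<and> \<not> before1 C c u' u"
  unfolding before1_iff using lt2_At At_unique by (metis less_irrefl)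

lemma lt_total:
  assumes "u \<in> null_loops C c" "u' \<in> null_loops C c" "u \<noteq> u'"
  shows "lt u u' \<or> lt u' u"
proof -
  have l: "lop c u" "lop c u'" using assms null_loopsD by metis+
  \<comment> \<open>Past a zig-zag node no edge is a loop. So if one path leaves the loops on
    \<open>c\<close>, then \<open>R\<close> is not a loop and no chain of loops reaches it: either
    all loops on \<open>c\<close> have an exit node, or all have \<open>R\<close> as their last
    loop.\<close>
  have no: "\<not> lsub x R" if A: "At y a" and x: "lop c x" for x y a
  proof
    assume s: "lsub x R"
    then have "lop c R" using lsub_lop_iff x by blast
    have p: "pos (tgt C (tgt C a)) (tgt C a)" using Ac_tgt[OF At_Ac[OF A]] .
    have aL: "a \<in> Lam C" using Ac_Lam[OF At_Ac[OF A]] .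
    obtain v where v: "neg v a" "lop c v" using A unfolding At_def att_def by blast
    have "tgt C a \<in> cells C" "dim C (tgt C a) = int (Suc m)"
      using step_dim[OF stepI[OF aL v(1)]] up_dim[OF v(2)] by auto
    then have "below (tgt C a) R" using below_iter_tgt m_less by blast
    then have "pos (tgt C R) R" using below_pos p by blast
    then show False using not_lop_pos \<open>lop c R\<close> by blast
  qed
  show ?thesis
  proof (cases "\<exists>a. At u a")
    case True
    then obtain a where a: "At u a" by blast
    then obtain a' where a': "At u' a'" using At_or_root[OF l(2)] no[OF a l(2)] by blast
    show ?thesis
    proof (cases "a = a'")
      case False
      then have "zkey a \<noteq> zkey a'" using zkey_inj At_Ac a a' by blast
      then have "before1 C c u u' \<or> before1 C c u' u" unfolding before1_iff using a a' by (metis linorder_neqE)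
      then show ?thesis unfolding lt_def by blast
    next
      case True
      obtain v where v: "att u v a" using a unfolding At_def by blast
      obtain v' where v': "att u' v' a" using a' True unfolding At_def by blast
      show ?thesis
      proof (cases "v = v'")
        case True
        then show ?thesis using lt2_total_aux[OF assms, of v] v v' unfolding lt_def att_def by blast
      next
        case False
        then have "(v, v') \<in> lorder C a c \<or> (v', v) \<in> lorder C a c"
          using lorder_total[of a v v'] v v' Ac_Lam unfolding att_def by blast
        then show ?thesis using v v' unfolding lt_def lt2_def att_def by blast
      qed
    qed
  next
    case False
    then have "\<not> (\<exists>a. At u' a)" "lsub u R" using At_or_root[OF l(1)] no l by blast+
    then have "lsub u' R" using At_or_root[OF l(2)] by blast
    then show ?thesis using lt2_total_aux[OF assms \<open>lsub u R\<close>] unfolding lt_def by blast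
  qed
qed

lemma lt_irrefl: "\<not> lt u u"
  unfolding lt_def before1_iff using lt2_irrefl At_unique by (metis less_irrefl)

lemma lt_trans:
  assumes "lt u u'" "lt u' u''" shows "lt u u''"
proof -
  have b1: "before1 C c u u''" if 1: "before1 C c u u'" and 2: "before1 C c u' u''"
  proof -
    obtain a a' where a: "At u a" "At u' a'" "zkey a < zkey a'" using 1 unfolding before1_iff by blast
    obtain b' b where b: "At u' b'" "At u'' b" "zkey b' < zkey b" using 2 unfolding before1_iff by blast
    have "zkey a < zkey b" using a b At_unique[OF a(2) b(1)] by simp
    then show ?thesis using a(1) b(2) unfolding before1_iff by blast
  qed
  have b2: "before1 C c u u''" if "before1 C c u u'" "lt2 u' u''"
    using that(1) unfolding before1_iff lt2_At[OF that(2)] .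
  have b3: "before1 C c u u''" if "lt2 u u'" "before1 C c u' u''"
    using that(2) unfolding before1_iff lt2_At[OF that(1)] .
  show ?thesis using assms b1 b2 b3 lt2_trans unfolding lt_def by blast
qed

text \<open>Turns the closure \<open>lsub\<close> into a numbered sequence. The nodes run one index
  ahead of the loops, since the sequence starts with the node above \<open>u\<close> and ends with
  the node below \<open>v\<close>.\<close>

lemma loop_path_exists:
  assumes "lsub u v" "lop c u" "pos u a0" "a0 \<in> Lam C" "neg v e" "e \<in> Lam C"
  shows "\<exists>p a b. p \<ge> 1 \<and> loop_path C c p a b \<and> b 0 = u \<and> a 0 = a0 \<and> a p = e \<and> b (p - 1) = v"
  using assms(1,5,6) unfolding lsub_eq
proof (induction arbitrary: e rule: rtranclp_induct)
  case base
  show ?case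
    by (rule exI[of _ 1], rule exI[of _ "\<lambda>i. if i = 0 then a0 else e"], rule exI[of _ "\<lambda>i. u"])
      (use base assms in \<open>auto simp: loop_path_def\<close>)
next
  case (step v v')
  then obtain x where x: "x \<in> Lam C" "neg v x" "pos v' x" unfolding lstep_def step_def by blast
  from step.IH[OF x(2,1)] obtain p a b where p: "p \<ge> 1" "loop_path C c p a b" "b 0 = u" "a 0 = a0"
    "a p = x" "b (p - 1) = v" by blast
  have l: "lop c v'" using step.hyps by (simp add: lstep_def)
  let ?a = "\<lambda>i. if i \<le> p then a i else e" and ?b = "\<lambda>i. if i < p then b i else v'"
  have "loop_path C c (Suc p) ?a ?b"
    using p(2,5) l x(3) step.prems unfolding loop_path_def by (auto simp: less_Suc_eq)
  then show ?case using p
    by (intro exI[of _ "Suc p"] exI[of _ ?a] exI[of _ ?b]) auto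
qed

lemma loop_path_lsub:
  assumes "loop_path C c p a b" "i < p" shows "lsub (b 0) (b i)"
  using assms(2)
proof (induction i)
  case (Suc i)
  have s: "lop c (b i)" "neg (b i) (a (Suc i))" "lop c (b (Suc i))" "pos (b (Suc i)) (a (Suc i))" "a (Suc i) \<in> Lam C"
    using assms(1) Suc.prems unfolding loop_path_def by auto
  then have "lstep (b i) (b (Suc i))" using up_dim[OF s(1)] unfolding lstep_def step_def by auto
  then show ?case using Suc lsub_step lsub_trans by (meson Suc_lessD)
qed (simp add: lsub_refl)

text \<open>\<open>before2\<close> asks for pairs that \<open>before1\<close> does not compare;
  \<open>lt2\<close> implies this by itself, because it forces equal exit nodes. On null loops the
  two therefore coincide, and \<open>lt\<close> is the order to work with.\<close>

lemma before_iff: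
  "before C c u u' \<longleftrightarrow> u \<in> null_loops C c \<and> u' \<in> null_loops C c \<and> lt u u'"
proof -
  have "lt2 u u'" if b: "before2 C c u u'"
  proof -
    obtain p q a b a' b' where p: "p \<ge> 1" "q \<ge> 1" "loop_path C c p a b" "b 0 = u"
      "loop_path C c q a' b'" "b' 0 = u'" "(b (p - 1), b' (q - 1)) \<in> lorder C (a p) c"
      using b unfolding before2_def by blast
    then show ?thesis using loop_path_lsub[of p a b "p - 1"] loop_path_lsub[of q a' b' "q - 1"]
      unfolding lt2_def by fastforce
  qed
  moreover have "before2 C c u u'" if n: "u \<in> null_loops C c" "u' \<in> null_loops C c" and l: "lt2 u u'"
  proof -
    obtain v v' e where v: "lsub u v" "lsub u' v'" and o: "(v, v') \<in> lorder C e c"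
      using l unfolding lt2_def by blast
    note d = lorderD[OF o]
    obtain x where x: "lop c u" "x \<in> Lam C" "x \<in> null_cells C" "pos u x" using null_loopsD[OF n(1)] .
    obtain x' where x': "lop c u'" "x' \<in> Lam C" "x' \<in> null_cells C" "pos u' x'" using null_loopsD[OF n(2)] .
    obtain p a b where p: "p \<ge> 1" "loop_path C c p a b" "b 0 = u" "a 0 = x" "a p = e" "b (p - 1) = v"
      using loop_path_exists[OF v(1) x(1,4,2) d(5,1)] by blast
    obtain q a' b' where q: "q \<ge> 1" "loop_path C c q a' b'" "b' 0 = u'" "a' 0 = x'" "a' q = e" "b' (q - 1) = v'"
      using loop_path_exists[OF v(2) x'(1,4,2) d(6,1)] by blast
    have "u \<noteq> u'" using l lt2_irrefl by blast
    moreover have "\<not> before1 C c u u'" "\<not> before1 C c u' u" using lt2_not_before1 l by blast+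
    moreover have "\<exists>p q a b a' b'. p \<ge> 1 \<and> q \<ge> 1 \<and>
       loop_path C c p a b \<and> b 0 = u \<and> a 0 \<in> Lam C \<inter> null_cells C \<and>
       loop_path C c q a' b' \<and> b' 0 = u' \<and> a' 0 \<in> Lam C \<inter> null_cells C \<and>
       a p = a' q \<and> b (p - 1) \<noteq> b' (q - 1) \<and>
       (b (p - 1), b' (q - 1)) \<in> lorder C (a p) c"
      by (rule exI[of _ p], rule exI[of _ q], rule exI[of _ a], rule exI[of _ b], rule exI[of _ a'],
          rule exI[of _ b']) (use p q x x' o d(7) in simp)
    ultimately show ?thesis unfolding before2_def by blast
  qed
  ultimately show ?thesis unfolding before_def lt_def by blast
qed

text \<open>The dots of \<open>T\<^sub>k\<close> with target edge \<open>c\<close> correspond to \<open>above_dots\<close>: a white dot \<open>w\<close> to the loop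
  \<open>\<gamma>(w)\<close>, a black dot to itself. The dot at the top of \<open>c\<close> is the black one.\<close>

definition above_dots :: "'a set" where
  "above_dots = null_loops C c \<union> {y \<in> Lam C. pos c y}"

definition dless :: "'a \<Rightarrow> 'a \<Rightarrow> bool" where
  "dless s t \<longleftrightarrow> s \<in> null_loops C c \<and> (t \<in> null_loops C c \<and> lt s t \<or> t \<in> Lam C \<and> pos c t)"

text \<open>Sorts the dots on \<open>c\<close> that lie above a non-loop edge \<open>g\<close> by
  the position of \<open>g\<close>: past the turning node, on the right part of the zig-zag, or on
  its left part. Only loops can enter the left part, since the black dot on \<open>c\<close> starts
  the right part.\<close>

lemma above_dots_below:
  assumes "t \<in> above_dots" "below t g" "pos (tgt C g) g"
  shows "(\<exists>a. mid a \<and> below (tgt C a) g) \<or>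
    pos c g \<and> (t \<in> Lam C \<and> pos c t \<or> (\<exists>a. t \<in> null_loops C c \<and> At t a \<and> pos c (tgt C a) \<and> below (tgt C a) g)) \<or>
    neg c g \<and> (\<exists>a. t \<in> null_loops C c \<and> At t a \<and> neg c (tgt C a) \<and> below (tgt C a) g)"
proof (cases "t \<in> null_loops C c")
  case True
  then have "lop c t" using null_loopsD by blast
  moreover have "\<not> lop c g" using assms(3) not_lop_pos by blast
  ultimately obtain v a where a: "att t v a" "below (tgt C a) g" using loop_below_cases assms(2) by blast
  have A: "At t a" using a(1) unfolding At_def by blast
  show ?thesis
  proof (cases "mid a")
    case False
    then have "neg c (tgt C a) \<or> pos c (tgt C a)" using Ac_cases At_Ac[OF A] by blast
    then show ?thesis using prec_below_cases[of 1 "tgt C a" g] prec_below_cases[of "-1" "tgt C a" g] a(2) A True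
      by blast
  qed (use a in blast)
next
  case False
  then show ?thesis using assms prec_below_cases[of 1 t g] unfolding above_dots_def by blast
qed

text \<open>If there is a turning node, the root is not a loop, so every loop on \<open>c\<close>
  leaves through the zig-zag, and both halves of the zig-zag lead down to the turning node.\<close>

lemma above_dots_mid:
  assumes "mid a" "t \<in> above_dots" shows "below t (tgt C a)"
proof (cases "t \<in> null_loops C c")
  case False
  then show ?thesis using prec_below_mid[OF assms(1), of 1 t] assms(2) unfolding above_dots_def by blast
next
  case True
  have aA: "a \<in> Ac" using mid_Ac assms(1) .
  have l: "lop c t" using True null_loopsD by blast
  obtain b where b: "neg b a" "neg c b" using assms(1) by (auto simp: mid_def)
  have st: "step b (tgt C a)" using stepI[OF Ac_Lam[OF aA] b(1)] up_dim[OF b(2)] by simp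
  then have "tgt C a \<in> cells C" "dim C (tgt C a) = int (Suc m)"
    using step_dim[OF st] up_dim[OF b(2)] by auto
  then have "below (tgt C a) R" using below_iter_tgt m_less by blast
  then have "pos (tgt C R) R" using below_pos Ac_tgt[OF aA] by blast
  then have "\<not> lop c R" using not_lop_pos by blast
  moreover have "below t R" using below_iter_tgt[of t "Suc m"] precD[OF l] up_dim[OF l] m_less by simp
  ultimately obtain v x where v: "att t v x" using loop_below_cases[OF l] by blast
  have vx: "lsub t v" "neg v x" "lop c v" "x \<in> Ac" using v by (auto simp: att_def)
  have s: "step v (tgt C x)" using stepI[OF Ac_Lam[OF vx(4)] vx(2)] up_dim[OF vx(3)] by simp
  have "below t (tgt C x)" using lsub_below[OF vx(1)] s by (meson rtranclp.rtrancl_into_rtrancl)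
  moreover have "below (tgt C x) (tgt C a)"
  proof (cases "mid x")
    case True then show ?thesis using mid_unique assms(1) by blast
  next
    case False
    then show ?thesis using Ac_cases[OF vx(4)] prec_below_mid[OF assms(1), of 1 "tgt C x"]
      prec_below_mid[OF assms(1), of "-1" "tgt C x"] by blast
  qed
  ultimately show ?thesis by (meson rtranclp_trans)
qed

lemma ex_bottom:
  assumes "neg c b" shows "\<exists>b1\<in>Lam C. neg c b1 \<and> below b1 b"
  using climb[of "-1" b] assms bstep_below by blast

lemma depth_below:
  assumes "\<beta> = 1 \<or> \<beta> = -1" "prec C \<beta> c x" "prec C \<beta> c y" "depth y \<le> depth x"
  shows "below x y"
proof -
  have "below x y \<or> below y x" using prec_chain[OF assms(1-3)] bstep_below by blast
  then show ?thesis using below_depth[of y x] assms(4) by fastforce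
qed

lemma lt_zkey: "lt s t \<Longrightarrow> At s a \<Longrightarrow> At t b \<Longrightarrow> zkey a \<le> zkey b"
  unfolding lt_def before1_iff using lt2_At At_unique by (metis less_imp_le order_refl)

lemma At_lt: "lt s t \<Longrightarrow> (\<exists>a. At s a) \<longleftrightarrow> (\<exists>b. At t b)"
  unfolding lt_def before1_iff using lt2_At by blast

lemma At_below:
  assumes "At t a" "lop c t" shows "below t (tgt C a)"
proof -
  obtain v where v: "att t v a" using assms(1) unfolding At_def by blast
  then have vx: "lsub t v" "neg v a" "lop c v" "a \<in> Ac" by (auto simp: att_def)
  have "step v (tgt C a)" using stepI[OF Ac_Lam[OF vx(4)] vx(2)] up_dim[OF vx(3)] by simp
  then show ?thesis using lsub_below[OF vx(1)] by (meson rtranclp.rtrancl_into_rtrancl)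
qed

text \<open>If the path of \<open>t\<close> has passed the turning node, everything on
  \<open>c\<close> has. Otherwise \<open>g\<close> is on the left part; a smaller dot has a smaller
  or equal key, so it enters the left part at greater or equal depth and passes through the entry
  point of \<open>t\<close>. In both cases the leaf starting the left part, which is the target node
  of \<open>c\<close>, lies above \<open>g\<close> too.\<close>

lemma kernel_source:
  assumes "g \<in> cells C" "dim C g = int (Suc m)" "c \<noteq> tgt C g" "t \<in> above_dots" "below t g"
  shows "(\<forall>s. dless s t \<longrightarrow> below s g) \<and> (\<exists>b\<in>Lam C. neg c b \<and> below b g)"
proof -
  \<comment> \<open>If \<open>g\<close> were a loop, the path from \<open>t\<close> would never have
    left the loops on \<open>c\<close>, and \<open>c\<close> would be the target of
    \<open>g\<close>.\<close>
  have gp: "pos (tgt C g) g"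
  proof (rule ccontr)
    assume "\<not> ?thesis"
    then have l: "lop (tgt C g) g" using lop_or_pos[OF assms(1)] assms(2) by simp
    show False
    proof (cases "t \<in> null_loops C c")
      case True
      then have "lop c t" using null_loopsD by blast
      then obtain v a where a: "att t v a" "below (tgt C a) g"
        using loop_below_cases[OF _ assms(5)] assms(3) lop_tgt by blast
      then have "pos (tgt C g) g" using below_pos Ac_tgt unfolding att_def by blast
      then show False using l not_lop_pos by blast
    next
      case False
      then have "pos c t" using assms(4) unfolding above_dots_def by blast
      then have "pos (tgt C t) t" using pos_tgt by metis
      then show False using below_pos[OF assms(5)] l not_lop_pos by blast
    qed
  qed
  have ng: "\<not> pos c g" using assms(3) pos_tgt by blast
  have s_dots: "s \<in> above_dots" if "dless s t" for s using that unfolding dless_def above_dots_def by blast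
  show ?thesis
  proof (cases "\<exists>a. mid a \<and> below (tgt C a) g")
    case True
    then obtain a where a: "mid a" "below (tgt C a) g" by blast
    obtain b where b: "neg b a" "neg c b" using a(1) by (auto simp: mid_def)
    have "\<exists>b1\<in>Lam C. neg c b1 \<and> below b1 b" using ex_bottom b(2) .
    moreover have "below b (tgt C a)" using prec_below_mid[OF a(1), of "-1"] b(2) by blast
    ultimately have "\<exists>b\<in>Lam C. neg c b \<and> below b g" using a(2) by (meson rtranclp_trans)
    then show ?thesis using above_dots_mid[OF a(1) s_dots] a(2) by (meson rtranclp_trans)
  next
    case False
    then obtain a where a: "neg c g" "t \<in> null_loops C c" "At t a" "neg c (tgt C a)" "below (tgt C a) g"
      using above_dots_below[OF assms(4,5) gp] ng by blast
    have "below s g" if d: "dless s t" for s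
    proof -
      have s: "s \<in> null_loops C c" "lt s t"
        using d a(2) precD(4) not_lop_pos null_loopsD unfolding dless_def by metis+
      have "lop c s" using s(1) null_loopsD by blast
      obtain x where x: "At s x" using At_lt[OF s(2)] a(3) by blast
      have k: "zkey x \<le> - 1 - int (depth (tgt C a))" using lt_zkey[OF s(2) x a(3)] zkey_left[OF a(4)] by simp
      have "\<not> mid x" using zkey_mid k by fastforce
      moreover have "\<not> pos c (tgt C x)" using zkey_right[of x] k by auto
      ultimately have xn: "neg c (tgt C x)" using Ac_cases At_Ac[OF x] by blast
      have "depth (tgt C a) \<le> depth (tgt C x)" using zkey_left[OF xn] k by simp
      then have "below (tgt C x) (tgt C a)" using depth_below[of "-1"] xn a(4) by simp
      then show ?thesis using At_below[OF x \<open>lop c s\<close>] a(5) by (meson rtranclp_trans)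
    qed
    then show ?thesis using ex_bottom[OF a(1)] by blast
  qed
qed

text \<open>If \<open>g\<close> is a loop on \<open>c\<close>, the paths of \<open>t\<close> and
  \<open>t'\<close> merge at or before \<open>g\<close>. A loop between them then leaves through the
  same node or the same root, and it meets the path of \<open>t\<close> before \<open>g\<close>,
  since otherwise its comparison with \<open>t\<close> would also be one with \<open>t'\<close>. If
  \<open>c\<close> is the target of \<open>g\<close> without a loop, \<open>g\<close> is on the
  right part, and a larger key means entering it further up.\<close>

lemma kernel_target:
  assumes "g \<in> cells C" "dim C g = int (Suc m)" "c = tgt C g" "t \<in> above_dots" "below t g"
    "t' \<in> above_dots" "below t' g" "dless t s" "dless s t'"
  shows "below s g"
proof -
  have tn: "t \<in> null_loops C c" "s \<in> null_loops C c" using assms(8,9) by (auto simp: dless_def)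
  have tl: "lop c t" "lop c s" using tn null_loopsD by metis+
  have ts: "lt t s" using assms(8) tl not_lop_pos unfolding dless_def by blast
  have "lop c g \<or> pos c g" using lop_or_pos[OF assms(1)] assms(2,3) by simp
  then show ?thesis
  proof
    assume g: "lop c g"
    have low: "lsub x g" if "x \<in> null_loops C c" "below x g" for x
    proof -
      have "lop c x" using null_loopsD that(1) by blast
      moreover have "\<not> (att x v a \<and> below (tgt C a) g)" for v a
        using below_pos Ac_tgt g not_lop_pos unfolding att_def by blast
      ultimately show ?thesis using loop_below_cases that(2) by blast
    qed
    have "t' \<in> null_loops C c"
    proof (rule ccontr)
      assume "t' \<notin> null_loops C c"
      then have "pos (tgt C t') t'" using assms(6) pos_tgt unfolding above_dots_def by blast
      then show False using below_pos[OF assms(7)] g not_lop_pos by blast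
    qed
    then have l: "lsub t g" "lsub t' g" using low tn assms by blast+
    have st: "lt s t'" using assms(9) \<open>t' \<in> null_loops C c\<close> null_loopsD not_lop_pos unfolding dless_def by metis
    have AA: "At t a \<longleftrightarrow> At t' a" for a using At_lsub[OF l(1)] At_lsub[OF l(2)] by simp
    have "\<not> before1 C c t s"
    proof
      assume "before1 C c t s"
      then obtain a b where a: "At t a" "At s b" "zkey a < zkey b" unfolding before1_iff by blast
      then have "zkey b \<le> zkey a" using lt_zkey[OF st a(2)] AA by blast
      then show False using a by simp
    qed
    then have "lt2 t s" using ts unfolding lt_def by blast
    then obtain v v' a where v: "lsub t v" "lsub s v'" "(v, v') \<in> lorder C a c" unfolding lt2_def by blast
    note d = lorderD[OF v(3)]
    show ?thesis
    proof (cases "lsub g v")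
      case True
      then have "lt2 t' s" using lsub_trans[OF l(2)] v unfolding lt2_def by blast
      then have "lt t' t'" using lt_trans[of t' s t'] st unfolding lt_def by blast
      then show ?thesis using lt_irrefl by blast
    next
      case False
      then have "lsub v g" "v \<noteq> g" using lsub_chain[OF v(1) l(1)] lsub_refl by auto
      then have s1: "lsub (tgt C a) g" "lstep v (tgt C a)" using lsub_neg d by blast+
      have "step v' (tgt C a)" using stepI[OF d(1,6)] up_dim[OF d(4)] by simp
      then have "lstep v' (tgt C a)" using s1(2) d(4) by (simp add: lstep_def)
      then have "lsub s g" using s1(1) v(2) lsub_step lsub_trans by blast
      then show ?thesis using lsub_below by blast
    qed
  next
    assume g: "pos c g"
    then have gp: "pos (tgt C g) g" using assms(3) by simp
    have nm: "\<not> (\<exists>a. mid a \<and> below (tgt C a) g)" using below_mid_not_prec[of _ g 1] g by blast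
    have "t \<notin> Lam C \<or> \<not> pos c t" using tl not_lop_pos by blast
    then obtain a where a: "At t a" "pos c (tgt C a)" "below (tgt C a) g"
      using above_dots_below[OF assms(4,5) gp] nm g not_pos_neg by blast
    obtain x where x: "At s x" using At_lt[OF ts] a(1) by blast
    have k: "1 + int (depth (tgt C a)) \<le> zkey x" using lt_zkey[OF ts a(1) x] zkey_right[OF a(2)] by simp
    have "\<not> mid x" using zkey_mid k by fastforce
    moreover have "\<not> neg c (tgt C x)" using zkey_left[of x] k by auto
    ultimately have xn: "pos c (tgt C x)" using Ac_cases At_Ac[OF x] by blast
    have "depth (tgt C a) \<le> depth (tgt C x)" using zkey_right[OF xn] k by simp
    then have "below (tgt C x) (tgt C a)" using depth_below[of 1] xn a(2) by simp
    then show ?thesis using At_below[OF x tl(2)] a(3) by (meson rtranclp_trans)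
  qed
qed

end

section \<open>The opetope of a dendritic face complex\<close>

text \<open>A parent function with a single exception \<open>r\<close> connects everything to
  \<open>r\<close>. That \<open>r\<close> lies in \<open>S\<close> is not assumed: for nonempty
  \<open>S\<close> the descent ends there.\<close>

lemma connected_nodesI:
  assumes "wf R" "\<And>t. t \<in> S \<Longrightarrow> t = r \<or> (\<exists>t'\<in>S. adjacent T t t' \<and> (t', t) \<in> R)"
  shows "connected_nodes T S"
proof -
  let ?A = "\<lambda>u v. u \<in> S \<and> v \<in> S \<and> adjacent T u v"
  have sym: "?A\<^sup>*\<^sup>* u v \<Longrightarrow> ?A\<^sup>*\<^sup>* v u" for u v
  proof (induction rule: rtranclp_induct)
    case (step x y)
    then have "?A y x" by (auto simp: adjacent_def)
    then show ?case using step.IH by (rule converse_rtranclp_into_rtranclp)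
  qed simp
  have "t \<in> S \<Longrightarrow> ?A\<^sup>*\<^sup>* t r" for t
  proof (induction t rule: wf_induct_rule[OF assms(1)])
    case (1 t)
    show ?case
    proof (cases "t = r")
      case False
      then obtain t' where t': "t' \<in> S" "adjacent T t t'" "(t', t) \<in> R" using assms(2) 1(2) by blast
      then have "?A t t'" using 1(2) by blast
      then show ?thesis using 1(1)[OF t'(3,1)] by (rule converse_rtranclp_into_rtranclp)
    qed simp
  qed
  then show ?thesis unfolding connected_nodes_def using sym by (meson rtranclp_trans)
qed

context dfc_edge begin

lemma dless_null_loops: "dless s t \<Longrightarrow> s \<in> null_loops C c" by (simp add: dless_def)

lemma dless_trans: "dless x s \<Longrightarrow> dless s t \<Longrightarrow> dless x t"
  using lt_trans not_lop_pos null_loopsD unfolding dless_def by metis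

lemma dless_irrefl: "\<not> dless s s"
  using lt_irrefl not_lop_pos null_loopsD unfolding dless_def by metis

lemma dless_total:
  assumes "s \<in> above_dots" "t \<in> above_dots" "s \<noteq> t" shows "dless s t \<or> dless t s"
  using assms lt_total top_unique[of 1 s t] unfolding above_dots_def dless_def by blast

definition drank :: "'a \<Rightarrow> nat" where "drank t = card {s. dless s t}"

lemma drank_less: assumes "dless s t" shows "drank s < drank t"
  unfolding drank_def
proof (rule psubset_card_mono)
  have "{s. dless s t} \<subseteq> cells C"
    using dless_null_loops null_loopsD precD(1) by (metis mem_Collect_eq subsetI)
  then show "finite {s. dless s t}" using finite_cells finite_subset by blast
  show "{x. dless x s} \<subset> {x. dless x t}" using assms dless_trans dless_irrefl by blast
qed

lemma dless_pred:
  assumes "dless s0 t"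
  obtains s where "dless s t" "\<And>x. dless x t \<Longrightarrow> x = s \<or> dless x s"
proof -
  have bd: "\<forall>x. dless x t \<longrightarrow> drank x < drank t" using drank_less by blast
  obtain s where s: "dless s t" "\<And>x. dless x t \<Longrightarrow> drank x \<le> drank s"
    using ex_has_greatest_nat[of "\<lambda>x. dless x t" s0 drank "drank t", OF assms bd] by blast
  have "x = s \<or> dless x s" if x: "dless x t" for x
  proof (rule ccontr)
    assume a: "\<not> ?thesis"
    then have "dless s x" using dless_total[of x s] dless_null_loops x s(1) unfolding above_dots_def by blast
    then show False using drank_less s(2)[OF x] by fastforce
  qed
  then show ?thesis using that s(1) by blast
qed

end

context dfc begin

section \<open>White dots and segments of the subdivided trees\<close>

lemma Z_sub_simps:
  assumes "2 \<le> k"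
  shows "wset (Z_sub C k) (Cell c) = Cell ` Z_dots C k c"
    "(Cell w, Cell w') \<in> wless (Z_sub C k) (Cell c) \<longleftrightarrow>
      w \<in> Z_dots C k c \<and> w' \<in> Z_dots C k c \<and> before C c (tgt C w) (tgt C w')"
    "wless (Z_sub C k) (Cell c) \<subseteq> Cell ` Z_dots C k c \<times> Cell ` Z_dots C k c"
  using assms by (auto simp: Z_sub_def)

lemma Z_dotsD:
  assumes "2 \<le> k" "w \<in> Z_dots C k c"
  shows "w \<in> Lam C" "w \<in> null_cells C" "dim C w = int k" "tgt C (tgt C w) = c" "pos (tgt C w) w"
    "lop c (tgt C w)" "tgt C w \<in> null_loops C c" "dim C (tgt C w) = int k - 1" "dim C c = int k - 2" "c \<in> cells C"
proof -
  show w: "w \<in> Lam C" "w \<in> null_cells C" "dim C w = int k" "tgt C (tgt C w) = c"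
    using assms by (auto simp: Z_dots_def)
  show p: "pos (tgt C w) w" using Lam_pos w assms(1) by simp
  have n: "\<not> neg y w" for y using null_iff w assms(1) by simp
  show l: "lop c (tgt C w)" using null_tgt_lop[OF _ _ n p] w assms(1) Lam_cells by auto
  show "tgt C w \<in> null_loops C c" unfolding null_loops_def using w p l by blast
  show "dim C (tgt C w) = int k - 1" using precD(3)[OF p] w by simp
  then show "dim C c = int k - 2" using precD(3)[OF l] by simp
  show "c \<in> cells C" using precD(2)[OF l] .
qed

text \<open>An edge has one source node, so a white dot is determined by its target loop. This
  allows the order on white dots to be studied on null loops.\<close>

lemma Z_dots_inj: "2 \<le> k \<Longrightarrow> w \<in> Z_dots C k c \<Longrightarrow> w' \<in> Z_dots C k c' \<Longrightarrow> tgt C w = tgt C w' \<Longrightarrow> w = w'"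
  by (rule pos_Lam_unique[of w w' "tgt C w"]) (simp_all add: Z_dotsD(1,8), metis Z_dotsD(5), metis Z_dotsD(5))

lemma null_loops_Z_dots:
  assumes "u \<in> null_loops C c" "dim C c = int k - 2"
  obtains w where "w \<in> Z_dots C k c" "tgt C w = u"
proof -
  obtain w where w: "lop c u" "w \<in> Lam C" "w \<in> null_cells C" "pos u w"
    using assms(1) unfolding null_loops_def by blast
  have u: "u = tgt C w" "c = tgt C u" using pos_tgt lop_tgt w by blast+
  have "dim C w = int k" using precD(3)[OF w(1)] precD(3)[OF w(4)] assms(2) by simp
  then have "w \<in> Z_dots C k c" using w u by (simp add: Z_dots_def)
  then show ?thesis using that u by blast
qed

lemma edge_interp:
  assumes "2 \<le> k" "k < dfc_dim C" "c \<in> cells C" "dim C c = int k - 2"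
  shows "dfc_edge C c (k - 2)"
  using assms by unfold_locales auto

lemma is_subdiv_Z_sub:
  assumes "2 \<le> k" "k < dfc_dim C"
  shows "is_subdiv (Z_tree_cells C k) (Z_sub C k)"
  unfolding is_subdiv_def
proof
  fix e assume "e \<in> edges (Z_tree_cells C k)"
  then obtain c where c: "e = Cell c" "c \<in> cells C" "dim C c = int k - 2" by (auto simp: Z_tree_cells_simps)
  interpret E: dfc_edge C c "k - 2" using edge_interp assms c by blast
  have fin: "finite (Z_dots C k c)"
    by (rule finite_subset[OF _ finite_cells]) (use Lam_cells in \<open>auto simp: Z_dots_def\<close>)
  let ?r = "wless (Z_sub C k) (Cell c)" and ?D = "Z_dots C k c"
  have r: "(x, y) \<in> ?r \<longleftrightarrow> (\<exists>w w'. x = Cell w \<and> y = Cell w' \<and> w \<in> ?D \<and> w' \<in> ?D \<and> E.lt (tgt C w) (tgt C w'))" for x y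
    using assms(1) E.before_iff Z_dotsD(7) by (auto simp: Z_sub_def)
  have "strict_total_order (Cell ` ?D) ?r"
    unfolding strict_total_order_def strict_linear_order_on_def
  proof (intro conjI)
    show "?r \<subseteq> Cell ` ?D \<times> Cell ` ?D" using Z_sub_simps(3) assms by blast
    show "trans ?r" unfolding trans_def r using E.lt_trans by blast
    show "irrefl ?r" unfolding irrefl_def r using E.lt_irrefl by blast
    show "total_on (Cell ` ?D) ?r"
    proof (rule total_onI)
      fix x y assume "x \<in> Cell ` ?D" "y \<in> Cell ` ?D" "x \<noteq> y"
      then obtain w w' where w: "x = Cell w" "y = Cell w'" "w \<in> ?D" "w' \<in> ?D" "w \<noteq> w'" by blast
      then have "tgt C w \<noteq> tgt C w'" using Z_dots_inj assms by blast
      then have "E.lt (tgt C w) (tgt C w') \<or> E.lt (tgt C w') (tgt C w)" using E.lt_total Z_dotsD(7) assms w by blast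
      then show "(x, y) \<in> ?r \<or> (y, x) \<in> ?r" unfolding r using w by blast
    qed
  qed
  then show "finite (wset (Z_sub C k) e) \<and> strict_total_order (wset (Z_sub C k) e) (wless (Z_sub C k) e)"
    using fin c Z_sub_simps(1) assms by simp
qed

lemma white_dots_Z:
  assumes "2 \<le> k"
  shows "white_dots (Z_tree_cells C k) (Z_sub C k) = {(Cell c, Cell w) | c w. w \<in> Z_dots C k c}"
  unfolding white_dots_def Z_tree_cells_simps
  using Z_dotsD(9,10)[OF assms] Z_sub_simps(1)[OF assms] by auto

text \<open>\<open>c\<close> is the target edge of the dot \<open>d\<close>, and \<open>t\<close> is
  the edge of the next tree that represents it: a black dot is itself a leaf there, a white dot is a
  null node represented by its target edge.\<close>

definition is_dot :: "nat \<Rightarrow> 'a \<Rightarrow> 'a \<Rightarrow> 'a zelt + 'a zelt \<times> 'a zelt \<Rightarrow> bool" where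
  "is_dot k c t d \<longleftrightarrow> t \<in> Lam C \<and> pos c t \<and> dim C c = int k - 2 \<and> d = Inl (Cell t) \<or>
    (\<exists>w\<in>Z_dots C k c. t = tgt C w \<and> d = Inr (Cell c, Cell w))"

lemma ex_is_dot:
  assumes "2 \<le> k" "d \<in> nodes (subdivided (Z_tree_cells C k) (Z_sub C k))"
  shows "\<exists>c t. is_dot k c t d"
proof (cases d)
  case (Inl e)
  then obtain y where y: "e = Cell y" "y \<in> Lam C" "dim C y = int k - 1"
    using assms by (auto simp: subdivided_def Z_tree_cells_simps)
  then have p: "pos (tgt C y) y" using Lam_pos assms by simp
  then have "is_dot k (tgt C y) y d" using y Inl precD(3)[OF p] by (simp add: is_dot_def)
  then show ?thesis by blast
next
  case (Inr e)
  then show ?thesis using assms white_dots_Z[OF assms(1)] by (auto simp: subdivided_def is_dot_def)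
qed

lemma is_dot_node:
  assumes "2 \<le> k" "is_dot k c t d"
  shows "d \<in> nodes (subdivided (Z_tree_cells C k) (Z_sub C k))"
  using assms(2) precD(3)[of 1 c t] white_dots_Z[OF assms(1)]
  by (auto simp: is_dot_def subdivided_def Z_tree_cells_simps)

lemma is_dot_unique:
  assumes "2 \<le> k" "is_dot k c t d" "is_dot k c' t' d" shows "c = c' \<and> t = t'"
  using assms(2,3) pos_tgt unfolding is_dot_def by auto

lemma is_dot_inj:
  assumes "2 \<le> k" "is_dot k c t d" "is_dot k c' t d'" shows "d = d'"
  using assms(2,3) not_lop_pos Z_dotsD(4,6)[OF assms(1)] Z_dots_inj[OF assms(1)] unfolding is_dot_def by metis

lemma is_dotD:
  assumes "2 \<le> k" "is_dot k c t d"
  shows "c \<in> cells C" "dim C c = int k - 2" "t \<in> null_loops C c \<or> t \<in> Lam C \<and> pos c t"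
  using assms(2) Z_dotsD(7,9,10)[OF assms(1)] precD(2) unfolding is_dot_def by blast+

lemma seg_src_Z:
  assumes "2 \<le> k"
  shows "w \<in> Z_dots C k c \<Longrightarrow> seg_src (Z_tree_cells C k) (Z_sub C k) (Cell c, Some (Cell w)) (Inr (Cell c, Cell w))"
    "b \<in> Lam C \<Longrightarrow> neg c b \<Longrightarrow> dim C c = int k - 2 \<Longrightarrow>
      seg_src (Z_tree_cells C k) (Z_sub C k) (Cell c, None) (Inl (Cell b))"
  using Z_dotsD(9,10)[OF assms] Z_sub_simps(1)[OF assms] precD(2)
  by (auto simp: seg_src_def segments_def Z_tree_cells_simps)

text \<open>The hypotheses say that the segment ends directly below the dot represented by
  \<open>t\<close>: nothing lies between the white dot named by \<open>s\<close>, or the root end of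
  \<open>c\<close> for \<open>None\<close>, and \<open>t\<close>.\<close>

lemma seg_tgt_Z:
  assumes k: "2 \<le> k" "k < dfc_dim C" and d: "is_dot k c t d"
    and s: "\<And>w. s = Some w \<Longrightarrow> \<exists>w'\<in>Z_dots C k c. w = Cell w' \<and> dfc_edge.dless C c (tgt C w') t"
    and no: "\<And>u. dfc_edge.dless C c u t \<Longrightarrow> \<exists>w\<in>Z_dots C k c. s = Some (Cell w) \<and> (u = tgt C w \<or> dfc_edge.dless C c u (tgt C w))"
  shows "seg_tgt (Z_tree_cells C k) (Z_sub C k) (Cell c, s) d"
proof -
  let ?T = "Z_tree_cells C k" and ?W = "Z_sub C k"
  note c = is_dotD[OF k(1) d]
  interpret E: dfc_edge C c "k - 2" using edge_interp k c by blast
  have dl: "E.dless (tgt C w) (tgt C w') \<longleftrightarrow> (Cell w, Cell w') \<in> wless ?W (Cell c)"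
    if "w \<in> Z_dots C k c" "w' \<in> Z_dots C k c" for w w'
    using that Z_sub_simps(2)[OF k(1)] E.before_iff Z_dotsD(6,7)[OF k(1)] not_lop_pos
    unfolding E.dless_def by blast
  have seg: "(Cell c, s) \<in> segments ?T ?W"
    using c s Z_sub_simps(1)[OF k(1)] by (cases s) (auto simp: segments_def Z_tree_cells_simps)
  have da: "Cell w \<in> dots_above ?W (Cell c) s \<longleftrightarrow> \<not> (\<exists>x\<in>Z_dots C k c. s = Some (Cell x) \<and> \<not> E.dless (tgt C x) (tgt C w))"
    if "w \<in> Z_dots C k c" for w
  proof (cases s)
    case None
    then show ?thesis using that Z_sub_simps(1)[OF k(1)] by (simp add: dots_above_def)
  next
    case (Some e)
    then obtain x where x: "x \<in> Z_dots C k c" "e = Cell x" using s by blast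
    then show ?thesis using that Some dl[OF x(1) that] Z_sub_simps(1)[OF k(1)] by (auto simp: dots_above_def)
  qed
  have da_sub: "dots_above ?W (Cell c) s \<subseteq> Cell ` Z_dots C k c"
    using Z_sub_simps(1)[OF k(1)] by (auto simp: dots_above_def split: option.splits)
  have nb: "\<not> E.dless (tgt C w) t" if w: "w \<in> Z_dots C k c" "Cell w \<in> dots_above ?W (Cell c) s" for w
  proof
    assume "E.dless (tgt C w) t"
    then obtain x where x: "x \<in> Z_dots C k c" "s = Some (Cell x)" "tgt C w = tgt C x \<or> E.dless (tgt C w) (tgt C x)"
      using no by blast
    then have "E.dless (tgt C x) (tgt C w)" using da w by blast
    then show False using x(3) E.dless_irrefl E.dless_trans by metis
  qed
  from d show ?thesis unfolding is_dot_def
  proof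
    assume t: "t \<in> Lam C \<and> pos c t \<and> dim C c = int k - 2 \<and> d = Inl (Cell t)"
    have "dots_above ?W (Cell c) s = {}"
    proof (rule ccontr)
      assume "dots_above ?W (Cell c) s \<noteq> {}"
      then obtain w where w: "w \<in> Z_dots C k c" "Cell w \<in> dots_above ?W (Cell c) s" using da_sub by blast
      moreover have "E.dless (tgt C w) t" using Z_dotsD(7)[OF k(1) w(1)] t by (simp add: E.dless_def)
      ultimately show False using nb by blast
    qed
    then show ?thesis using t seg by (auto simp: seg_tgt_def Z_tree_cells_simps)
  next
    assume "\<exists>w\<in>Z_dots C k c. t = tgt C w \<and> d = Inr (Cell c, Cell w)"
    then obtain w where w: "w \<in> Z_dots C k c" "t = tgt C w" "d = Inr (Cell c, Cell w)" by blast
    have "Cell w \<in> dots_above ?W (Cell c) s" using da[OF w(1)] s w(2) by blast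
    moreover have "v = Cell w \<or> (Cell w, v) \<in> wless ?W (Cell c)" if v: "v \<in> dots_above ?W (Cell c) s" for v
    proof (cases "v = Cell w")
      case ne: False
      obtain x where x: "v = Cell x" "x \<in> Z_dots C k c" using v da_sub by blast
      then have "tgt C x \<noteq> t" using ne Z_dots_inj[OF k(1) x(2) w(1)] w(2) by blast
      then have "E.dless t (tgt C x)"
        using E.dless_total[of t "tgt C x"] nb[OF x(2)] v x Z_dotsD(7)[OF k(1)] w
        unfolding E.above_dots_def by blast
      then show ?thesis using dl[OF w(1) x(2)] w(2) x(1) by simp
    qed simp
    ultimately show ?thesis using seg w(3) by (auto simp: seg_tgt_def)
  qed
qed

lemma connected_above:
  assumes k: "2 \<le> k" "k < dfc_dim C" and g: "g \<in> cells C" "dim C g = int k - 1"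
  shows "connected_nodes (subdivided (Z_tree_cells C k) (Z_sub C k)) {d. \<exists>c t. is_dot k c t d \<and> below t g}"
    (is "connected_nodes ?T ?S")
proof -
  define base where "base d = (THE c. \<exists>t. is_dot k c t d)" for d
  define ev where "ev d = (THE t. \<exists>c. is_dot k c t d)" for d
  have be: "base d = c" "ev d = t" if "is_dot k c t d" for c t d
    unfolding base_def ev_def using is_dot_unique[OF k(1) that] that by blast+
  \<comment> \<open>Lexicographic: leaving \<open>c\<close> at its lower end lowers the depth of the
    edge, moving down on \<open>c\<close> lowers the rank.\<close>
  define R where "R = measures [\<lambda>d. depth (base d), \<lambda>d. dfc_edge.drank C (base d) (ev d)]"
  have wfR: "wf R" by (simp add: R_def)
  have adj: "adjacent ?T d d'" if "seg_tgt (Z_tree_cells C k) (Z_sub C k) e d"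
    "seg_src (Z_tree_cells C k) (Z_sub C k) e d'" for d d' e
    unfolding adjacent_def subdivided_def using that by (intro exI[of _ e]) simp
  let ?B = "{d \<in> ?S. base d = tgt C g}"
  \<comment> \<open>The lowest dot of the set on the edge \<open>tgt C g\<close>, the only one whose
    parent may be missing. If there is no dot on that edge, \<open>r\<close> is arbitrary.\<close>
  define r where "r = (SOME d. d \<in> ?B \<and> (\<forall>d'\<in>?B. dfc_edge.drank C (tgt C g) (ev d) \<le> dfc_edge.drank C (tgt C g) (ev d')))"
  have r: "r \<in> ?B \<and> (\<forall>d'\<in>?B. dfc_edge.drank C (tgt C g) (ev r) \<le> dfc_edge.drank C (tgt C g) (ev d'))"
    if "d0 \<in> ?B" for d0
    unfolding r_def
    by (rule someI_ex)
      (use ex_has_least_nat[of "\<lambda>d. d \<in> ?B" d0 "\<lambda>d. dfc_edge.drank C (tgt C g) (ev d)"] that in blast)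
  show ?thesis
  proof (rule connected_nodesI[OF wfR, of _ r])
    fix d assume dS: "d \<in> ?S"
    then obtain c t where d: "is_dot k c t d" "below t g" by blast
    note c = is_dotD[OF k(1) d(1)]
    interpret E: dfc_edge C c "k - 2" using edge_interp k c by blast
    have tA: "t \<in> E.above_dots" using c(3) by (simp add: E.above_dots_def)
    have pred: "\<exists>d'\<in>?S. adjacent ?T d d' \<and> (d', d) \<in> R"
      if s: "E.dless s t" "\<And>x. E.dless x t \<Longrightarrow> x = s \<or> E.dless x s" "below s g" for s
    proof -
      obtain w where w: "w \<in> Z_dots C k c" "tgt C w = s"
        using null_loops_Z_dots[OF E.dless_null_loops[OF s(1)] c(2)] .
      let ?d' = "Inr (Cell c, Cell w)"
      have d': "is_dot k c s ?d'" using w by (auto simp: is_dot_def)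
      have "seg_tgt (Z_tree_cells C k) (Z_sub C k) (Cell c, Some (Cell w)) d"
      proof (rule seg_tgt_Z[OF k d(1)])
        show "\<exists>w'\<in>Z_dots C k c. v = Cell w' \<and> E.dless (tgt C w') t" if "Some (Cell w) = Some v" for v
          using that w s(1) by blast
        show "\<exists>w'\<in>Z_dots C k c. Some (Cell w) = Some (Cell w') \<and> (u = tgt C w' \<or> E.dless u (tgt C w'))"
          if "E.dless u t" for u using s(2)[OF that] w by blast
      qed
      then have a: "adjacent ?T d ?d'" using adj seg_src_Z(1)[OF k(1) w(1)] by blast
      have m: "(?d', d) \<in> R" using be[OF d(1)] be[OF d'] E.drank_less[OF s(1)] by (simp add: R_def)
      have "?d' \<in> ?S" using d' s(3) by blast
      then show ?thesis using a m by (intro bexI[of _ ?d'] conjI)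
    qed
    show "d = r \<or> (\<exists>d'\<in>?S. adjacent ?T d d' \<and> (d', d) \<in> R)"
    proof (cases "c = tgt C g")
      case False
      have ks: "(\<forall>s. E.dless s t \<longrightarrow> below s g) \<and> (\<exists>b\<in>Lam C. neg c b \<and> below b g)"
        using E.kernel_source[OF g(1) _ False tA d(2)] g(2) k by simp
      show ?thesis
      proof (cases "\<exists>s. E.dless s t")
        case True
        then obtain s where "E.dless s t" "\<And>x. E.dless x t \<Longrightarrow> x = s \<or> E.dless x s" using E.dless_pred by metis
        then show ?thesis using pred ks by blast
      next
        case none: False
        \<comment> \<open>\<open>d\<close> is the lowest dot on \<open>c\<close>, so its parent is
          the target node of \<open>c\<close>, a black dot.\<close>
        obtain b where b: "b \<in> Lam C" "neg c b" "below b g" using ks by blast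
        let ?d' = "Inl (Cell b)"
        have p: "pos (tgt C b) b" using neg_pos_tgt[OF b(2)] .
        have st: "step c (tgt C b)" using stepI[OF b(1,2)] c(2) k by simp
        have d': "is_dot k (tgt C b) b ?d'" using b(1) p step_dim[OF st] c(2) by (simp add: is_dot_def)
        have "seg_tgt (Z_tree_cells C k) (Z_sub C k) (Cell c, None) d"
          by (rule seg_tgt_Z[OF k d(1)]) (use none in auto)
        then have a: "adjacent ?T d ?d'" using adj seg_src_Z(2)[OF k(1) b(1,2) c(2)] by blast
        have m: "(?d', d) \<in> R" using be[OF d(1)] be[OF d'] step_depth[OF st] by (simp add: R_def)
        have "?d' \<in> ?S" using d' b(3) by blast
        then show ?thesis using a m by (intro disjI2 bexI[of _ ?d'] conjI)
      qed
    next
      case True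
      show ?thesis
      proof (cases "d = r")
        case False
        have d0: "d \<in> ?B" using dS be[OF d(1)] True by simp
        from r[OF d0] have rS: "r \<in> ?S" "base r = c" "E.drank (ev r) \<le> E.drank t"
          using True d0 be[OF d(1)] by auto
        then obtain c' t' where "is_dot k c' t' r" "below t' g" by blast
        then have r': "is_dot k c t' r" "below t' g" "ev r = t'" using be rS(2) by blast+
        have tA': "t' \<in> E.above_dots" using is_dotD[OF k(1) r'(1)] by (simp add: E.above_dots_def)
        have "t' \<noteq> t" using is_dot_inj[OF k(1) d(1)] r'(1) False by blast
        then have rt: "E.dless t' t"
          using E.dless_total[OF tA' tA] E.drank_less[of t t'] rS(3) r'(3) by auto
        then obtain s where s: "E.dless s t" "\<And>x. E.dless x t \<Longrightarrow> x = s \<or> E.dless x s"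
          using E.dless_pred by metis
        have "below s g"
        proof (cases "t' = s")
          case True then show ?thesis using r'(2) by simp
        next
          case False
          then have "E.dless t' s" using s(2)[OF rt] by blast
          \<comment> \<open>\<open>s\<close> lies between the lowest dot \<open>t'\<close> of the
            set and \<open>t\<close>, so convexity on the target edge applies.\<close>
          then show ?thesis using E.kernel_target[OF g(1) _ \<open>c = tgt C g\<close> tA' r'(2) tA d(2) _ s(1)] g(2) k by simp
        qed
        then show ?thesis using pred s by blast
      qed simp
    qed
  qed
qed

section \<open>Descending paths into a node and the kernel rule\<close>

lemma below_last:
  assumes "below b g" "b \<noteq> g" obtains b' where "below b b'" "step b' g"
  using assms by (metis rtranclp.cases)

lemma desc_edge_iff:
  assumes "2 \<le> k" "dim C b = int k - 2"
  shows "desc (Z_tree_cells C k) (Inr (Cell b)) (Inl (Cell x)) \<longleftrightarrow>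
    x \<in> Lam C \<and> (\<exists>b'. below b b' \<and> neg b' x)"
proof
  let ?T = "Z_tree_cells C k"
  have inv: "(case z of Inr e \<Rightarrow> \<exists>b'. e = Cell b' \<and> below b b'
     | Inl a \<Rightarrow> \<exists>x b'. a = Cell x \<and> x \<in> Lam C \<and> below b b' \<and> neg b' x)"
    if "(down_step ?T)\<^sup>*\<^sup>* (Inr (Cell b)) z" for z
    using that
  proof (induction rule: rtranclp_induct)
    case (step y z)
    show ?case
    proof (cases y)
      case (Inl a)
      then obtain x b' where x: "a = Cell x" "x \<in> Lam C" "below b b'" "neg b' x"
        using step.IH by auto
      obtain e where e: "z = Inr e" using step.hyps(2) Inl by (cases z) auto
      then obtain y' where y': "e = Cell y'" "pos y' x"
        using step.hyps(2) Inl x(1) by (auto simp: Z_tree_cells_simps)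
      have "dim C b' \<ge> 0" using below_dim[OF x(3)] assms by simp
      then have "step b' y'" using x y' unfolding step_def by blast
      then have "below b y'" using x(3) by (meson rtranclp.rtrancl_into_rtrancl)
      then show ?thesis using e y'(1) by simp
    next
      case (Inr e)
      then obtain b' where b': "e = Cell b'" "below b b'" using step.IH by auto
      obtain a where a: "z = Inl a" using step.hyps(2) Inr by (cases z) auto
      then have "\<exists>x. a = Cell x \<and> x \<in> Lam C \<and> neg b' x"
        using step.hyps(2) Inr b'(1) by (auto simp: Z_tree_cells_simps)
      then show ?thesis using a b'(2) by auto
    qed
  qed simp
  assume "desc ?T (Inr (Cell b)) (Inl (Cell x))"
  from inv[OF this[unfolded desc_def]] show "x \<in> Lam C \<and> (\<exists>b'. below b b' \<and> neg b' x)" by auto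
next
  let ?T = "Z_tree_cells C k"
  assume "x \<in> Lam C \<and> (\<exists>b'. below b b' \<and> neg b' x)"
  then obtain b' where b': "x \<in> Lam C" "below b b'" "neg b' x" by blast
  have "dim C b' = int k - 2" using below_dim[OF b'(2)] assms by simp
  then have "down_step ?T (Inr (Cell b')) (Inl (Cell x))" using b' by (auto simp: Z_tree_cells_simps)
  then show "desc ?T (Inr (Cell b)) (Inl (Cell x))"
    using below_desc[OF b'(2) assms(2)] unfolding desc_def by (rule rtranclp.rtrancl_into_rtrancl[rotated])
qed

text \<open>Lets the kernel rule at \<open>x\<close> be stated through the edge
  \<open>tgt C x\<close>: that edge itself is the only one below which it lies without descending to
  \<open>x\<close>.\<close>

lemma below_tgt_iff:
  assumes "x \<in> Lam C" "pos (tgt C x) x" "dim C b \<ge> 0"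
  shows "below b (tgt C x) \<longleftrightarrow> b = tgt C x \<or> (\<exists>b'. below b b' \<and> neg b' x)"
proof
  assume l: "below b (tgt C x)"
  show "b = tgt C x \<or> (\<exists>b'. below b b' \<and> neg b' x)"
  proof (cases "b = tgt C x")
    case False
    then obtain b' where b': "below b b'" "step b' (tgt C x)" using below_last l by blast
    then obtain a where a: "a \<in> Lam C" "neg b' a" "pos (tgt C x) a" unfolding step_def by blast
    have "dim C (tgt C x) \<ge> 0" using below_dim[OF l] assms(3) by simp
    then have "a = x" using pos_Lam_unique a assms by blast
    then show ?thesis using a b' by blast
  qed simp
next
  assume "b = tgt C x \<or> (\<exists>b'. below b b' \<and> neg b' x)"
  then show "below b (tgt C x)"
  proof
    assume "\<exists>b'. below b b' \<and> neg b' x"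
    then obtain b' where b': "below b b'" "neg b' x" by blast
    have "step b' (tgt C x)" using stepI[OF assms(1) b'(2)] below_dim[OF b'(1)] assms(3) by simp
    then show ?thesis using b'(1) by (meson rtranclp.rtrancl_into_rtrancl)
  qed simp
qed

lemma desc_node_iff:
  assumes "2 \<le> k" "w \<in> Lam C" "x \<in> Lam C" "dim C w = int k - 1" "dim C x = int k - 1"
  shows "desc (Z_tree_cells C k) (Inl (Cell w)) (Inl (Cell x)) \<longleftrightarrow> below (tgt C w) (tgt C x)"
proof -
  let ?T = "Z_tree_cells C k"
  have p: "pos (tgt C w) w" "pos (tgt C x) x" using Lam_pos assms by auto
  have d: "dim C (tgt C w) = int k - 2" using precD(3)[OF p(1)] assms by simp
  have "desc ?T (Inl (Cell w)) (Inl (Cell x)) \<longleftrightarrow> w = x \<or> desc ?T (Inr (Cell (tgt C w))) (Inl (Cell x))"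
  proof
    assume "desc ?T (Inl (Cell w)) (Inl (Cell x))"
    then have "(down_step ?T)\<^sup>*\<^sup>* (Inl (Cell w)) (Inl (Cell x))" by (simp add: desc_def)
    then show "w = x \<or> desc ?T (Inr (Cell (tgt C w))) (Inl (Cell x))"
    proof (cases rule: converse_rtranclpE)
      case (step z)
      then obtain e where e: "z = Inr e" by (cases z) auto
      then obtain y where "e = Cell y" "pos y w" using step(1) by (auto simp: Z_tree_cells_simps)
      then show ?thesis using step(2) e pos_tgt unfolding desc_def by metis
    qed simp
  next
    assume "w = x \<or> desc ?T (Inr (Cell (tgt C w))) (Inl (Cell x))"
    then show "desc ?T (Inl (Cell w)) (Inl (Cell x))"
    proof
      assume a: "desc ?T (Inr (Cell (tgt C w))) (Inl (Cell x))"
      have "down_step ?T (Inl (Cell w)) (Inr (Cell (tgt C w)))"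
        using assms(2) p(1) d by (auto simp: Z_tree_cells_simps)
      then show ?thesis using a unfolding desc_def by (rule converse_rtranclp_into_rtranclp)
    qed (simp add: desc_def)
  qed
  also have "\<dots> \<longleftrightarrow> below (tgt C w) (tgt C x)"
  proof -
    have "tgt C w = tgt C x \<longleftrightarrow> w = x"
      using pos_Lam_unique[OF assms(2,3), of "tgt C w"] p d assms(1) by auto
    then show ?thesis using desc_edge_iff[OF assms(1) d] below_tgt_iff[OF assms(3) p(2), of "tgt C w"] d assms(1,3) by auto
  qed
  finally show ?thesis .
qed

lemma exact_constellation_Z_cells:
  assumes k: "2 \<le> k" "k < dfc_dim C"
  shows "exact_constellation (Z_tree_cells C k) (Z_sub C k) (Z_tree_cells C (Suc k))"
  unfolding exact_constellation_def constellation_def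
proof (intro conjI ballI)
  let ?T = "Z_tree_cells C k" and ?U = "Z_tree_cells C (Suc k)" and ?W = "Z_sub C k"
  show "rooted_tree ?T" "rooted_tree ?U" using rooted_Z_tree_cells k by auto
  show "is_subdiv ?T ?W" using is_subdiv_Z_sub k .
  have "leaves ?U = nodes ?T" using leaves_Z_tree_cells[of "Suc k"] k by (simp add: Z_tree_cells_simps)
  then show "bij_betw id (nodes ?T) (leaves ?U)" by simp
  show "bij_betw snd (white_dots ?T ?W) (null_dots ?U)"
    unfolding bij_betw_def
  proof
    have "c = c'" if "w \<in> Z_dots C k c" "w \<in> Z_dots C k c'" for w c c'
      using that by (simp add: Z_dots_def)
    then show "inj_on snd (white_dots ?T ?W)" unfolding white_dots_Z[OF k(1)] by (auto simp: inj_on_def)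
    have "null_dots ?U = Cell ` {x \<in> Lam C \<inter> null_cells C. dim C x = int k}"
      using null_dots_Z_tree_cells[of "Suc k"] by simp
    also have "\<dots> = snd ` white_dots ?T ?W"
      unfolding white_dots_Z[OF k(1)] by (force simp: Z_dots_def)
    finally show "snd ` white_dots ?T ?W = null_dots ?U" by simp
  qed
  fix e assume "e \<in> nodes ?U"
  then obtain x where x: "e = Cell x" "x \<in> Lam C" "dim C x = int k" by (auto simp: Z_tree_cells_simps)
  have px: "pos (tgt C x) x" using Lam_pos x by simp
  have g: "tgt C x \<in> cells C" "dim C (tgt C x) = int k - 1" using precD[OF px] x(3) by auto
  have key: "desc ?U (case d of Inl a \<Rightarrow> Inr (id a) | Inr d \<Rightarrow> Inl (snd d)) (Inl e) \<longleftrightarrow> below t (tgt C x)"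
    if d: "is_dot k c t d" for c t d
    using d unfolding is_dot_def
  proof
    assume t: "t \<in> Lam C \<and> pos c t \<and> dim C c = int k - 2 \<and> d = Inl (Cell t)"
    then have td: "dim C t = int (Suc k) - 2" using precD(3)[of 1 c t] by simp
    \<comment> \<open>A black dot is a leaf of the next tree, so the exceptional edge of
      \<open>below_tgt_iff\<close> does not occur.\<close>
    have "t \<noteq> tgt C x" using t px by (auto simp: Lam_iff)
    then show ?thesis using t x desc_edge_iff[OF _ td] below_tgt_iff[OF x(2) px, of t] td k(1) by simp
  next
    assume "\<exists>w\<in>Z_dots C k c. t = tgt C w \<and> d = Inr (Cell c, Cell w)"
    then obtain w where w: "w \<in> Z_dots C k c" "t = tgt C w" "d = Inr (Cell c, Cell w)" by blast
    then show ?thesis using desc_node_iff[of "Suc k" w x] Z_dotsD(1,3)[OF k(1) w(1)] x k(1) by simp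
  qed
  have "{t \<in> nodes (subdivided ?T ?W). desc ?U (case t of Inl a \<Rightarrow> Inr (id a) | Inr d \<Rightarrow> Inl (snd d)) (Inl e)}
    = {d. \<exists>c t. is_dot k c t d \<and> below t (tgt C x)}"
  proof (intro set_eqI iffI)
    fix d assume d: "d \<in> {t \<in> nodes (subdivided ?T ?W). desc ?U (case t of Inl a \<Rightarrow> Inr (id a) | Inr d \<Rightarrow> Inl (snd d)) (Inl e)}"
    then obtain c t where "is_dot k c t d" using ex_is_dot[OF k(1)] by blast
    then show "d \<in> {d. \<exists>c t. is_dot k c t d \<and> below t (tgt C x)}" using key d by blast
  next
    fix d assume "d \<in> {d. \<exists>c t. is_dot k c t d \<and> below t (tgt C x)}"
    then obtain c t where "is_dot k c t d" "below t (tgt C x)" by blast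
    then show "d \<in> {t \<in> nodes (subdivided ?T ?W). desc ?U (case t of Inl a \<Rightarrow> Inr (id a) | Inr d \<Rightarrow> Inl (snd d)) (Inl e)}"
      using key is_dot_node[OF k(1)] by blast
  qed
  then show "connected_nodes (subdivided ?T ?W)
       {t \<in> nodes (subdivided ?T ?W). desc ?U (case t of Inl a \<Rightarrow> Inr (id a) | Inr d \<Rightarrow> Inl (snd d)) (Inl e)}"
    using connected_above[OF k g] by simp
qed

end

section \<open>The trees in degrees 0 and 1\<close>

lemma one_node_tree:
  assumes "nodes T = {a}" "edges T = {l, r}" "l \<noteq> r" "root T = r"
    "\<And>b x. is_src T b x \<longleftrightarrow> b = l \<and> x = a" "\<And>b x. is_tgt T b x \<longleftrightarrow> b = r \<and> x = a"
  shows "rooted_tree T" "leaves T = {l}" "null_dots T = {}"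
proof -
  have "down_step T (Inr l) (Inl a)" "down_step T (Inl a) (Inr r)" using assms by auto
  then have "desc T (Inr l) (Inr r)" unfolding desc_def by (meson r_into_rtranclp rtranclp_trans)
  moreover have "desc T (Inr r) (Inr r)" by (simp add: desc_def)
  ultimately show "rooted_tree T" using assms unfolding rooted_tree_def by (auto simp: Uniq_def)
  show "leaves T = {l}" "null_dots T = {}" using assms by (auto simp: leaves_def null_dots_def)
qed

lemma connected_nodes_subsingleton:
  assumes "\<And>x y. x \<in> S \<Longrightarrow> y \<in> S \<Longrightarrow> x = y" shows "connected_nodes T S"
  unfolding connected_nodes_def using assms by blast

text \<open>With a single dot the kernel rule is trivial; this handles the first two constellations,
  whose subdivisions are empty.\<close>

lemma constellation_one_node:
  assumes "rooted_tree T" "rooted_tree U" "nodes T = {a}" "leaves U = {a}" "null_dots U = {}"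
    "\<And>b. wset W b = {}" "\<And>b. wless W b = {}"
  shows "exact_constellation T W U"
proof -
  have wd: "white_dots T W = {}" using assms(6) by (auto simp: white_dots_def)
  have "is_subdiv T W" using assms(6,7)
    by (simp add: is_subdiv_def strict_total_order_def strict_linear_order_on_def)
  moreover have "connected_nodes (subdivided T W) {t \<in> nodes (subdivided T W). Q t}" for Q
    by (rule connected_nodes_subsingleton) (auto simp: subdivided_def assms(3) wd)
  ultimately show ?thesis unfolding exact_constellation_def constellation_def using assms wd by (simp add: bij_betw_def)
qed

context dfc begin

lemma Z_tree_0:
  shows "rooted_tree (Z_tree C 0)" "leaves (Z_tree C 0) = {Leaf0}" "nodes (Z_tree C 0) = {Leaf1}"
proof -
  note t = one_node_tree[of "Z_tree C 0" Leaf1 Leaf0 Root0]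
  show "rooted_tree (Z_tree C 0)" "leaves (Z_tree C 0) = {Leaf0}" "nodes (Z_tree C 0) = {Leaf1}"
    using t by (simp_all add: Z_tree_def)
qed

lemma Z_tree_1:
  assumes "1 \<le> dfc_dim C"
  obtains l where "rooted_tree (Z_tree C 1)" "leaves (Z_tree C 1) = {Leaf1}" "nodes (Z_tree C 1) = {l}"
    "null_dots (Z_tree C 1) = {}" "leaves (Z_tree_cells C 2) = {l}"
proof -
  obtain l where l: "leaves (Z_tree_cells C 2) = {l}"
    using leaves_Z_tree_cells_2[OF assms] by (auto simp: is_singleton_def)
  note t = one_node_tree[of "Z_tree C 1" l Leaf1 Root1]
  have "rooted_tree (Z_tree C 1)" "leaves (Z_tree C 1) = {Leaf1}" "nodes (Z_tree C 1) = {l}"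
    "null_dots (Z_tree C 1) = {}"
    using t by (simp_all add: Z_tree_def l)
  then show ?thesis using that l by blast
qed

lemma rooted_Z_tree:
  assumes "k \<le> dfc_dim C" shows "rooted_tree (Z_tree C k)"
proof -
  consider "k = 0" | "k = 1" | "2 \<le> k" by linarith
  then show ?thesis
  proof cases
    case 1 then show ?thesis using Z_tree_0 by simp
  next
    case 2 then show ?thesis using Z_tree_1 assms by metis
  next
    case 3 then show ?thesis using rooted_Z_tree_cells assms by (simp add: Z_tree_def)
  qed
qed

lemma exact_constellation_Z:
  assumes "k < dfc_dim C" shows "exact_constellation (Z_tree C k) (Z_sub C k) (Z_tree C (Suc k))"
proof -
  have n: "1 \<le> dfc_dim C" using assms by simp
  obtain l where l: "rooted_tree (Z_tree C 1)" "leaves (Z_tree C 1) = {Leaf1}" "nodes (Z_tree C 1) = {l}"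
    "null_dots (Z_tree C 1) = {}" "leaves (Z_tree_cells C 2) = {l}" using Z_tree_1[OF n] .
  consider "k = 0" | "k = 1" | "2 \<le> k" by linarith
  then show ?thesis
  proof cases
    case 1
    then show ?thesis using constellation_one_node[of "Z_tree C 0" "Z_tree C 1" Leaf1 "Z_sub C 0"] Z_tree_0 l
      by (simp add: Z_sub_def)
  next
    case 2
    have "null_dots (Z_tree_cells C 2) = {}"
      using linear_Z_tree_cells unfolding linear_tree_def null_dots_def by blast
    moreover have "rooted_tree (Z_tree C (Suc 1))" using rooted_Z_tree[of "Suc 1"] 2 assms by simp
    moreover have "Z_tree C (Suc 1) = Z_tree_cells C 2" by (simp add: Z_tree_def numeral_2_eq_2)
    ultimately show ?thesis using constellation_one_node[of "Z_tree C 1" "Z_tree C (Suc 1)" l "Z_sub C 1"] l 2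
      by (simp add: Z_sub_def)
  next
    case 3
    then show ?thesis using exact_constellation_Z_cells[OF _ assms] by (simp add: Z_tree_def)
  qed
qed

lemma is_opetope_Z_obj: "is_opetope (Z_obj C)"
  unfolding is_opetope_def Z_obj_def opetope.simps
proof (intro conjI allI impI)
  show "rooted_tree (Z_tree C k)" if "k \<le> dfc_dim C" for k using rooted_Z_tree that .
  show "exact_constellation (Z_tree C k) (Z_sub C k) (Z_tree C (Suc k))" if "k < dfc_dim C" for k
    using exact_constellation_Z that .
  show "unit_tree (Z_tree C 0)" using Z_tree_0 by (simp add: unit_tree_def)
  show "unit_tree (Z_tree C 1)" if "1 \<le> dfc_dim C"
    using Z_tree_1[OF that] by (metis unit_tree_def is_singletonI)
  show "linear_tree (Z_tree C 2)" if "2 \<le> dfc_dim C"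
    using linear_Z_tree_cells by (simp add: Z_tree_def)
qed

end

section \<open>Transport along isomorphisms\<close>

lemma bij_betw_Cell:
  assumes "inj_on f A" "f ` A = B" shows "bij_betw (map_zelt f) (Cell ` A) (Cell ` B)"
  using assms by (auto simp: bij_betw_def inj_on_def image_iff)

text \<open>The inverse is carried along so that \<open>swap\<close> turns every preservation
  statement into the corresponding reflection.\<close>

locale dfc_iso = C: dfc C + D: dfc D for C D :: "'a mop" +
  fixes f g :: "'a \<Rightarrow> 'a"
  assumes f_hom: "f \<in> mop_hom C D" and g_hom: "g \<in> mop_hom D C"
    and gf: "\<And>x. x \<in> cells C \<Longrightarrow> g (f x) = x" and fg: "\<And>x. x \<in> cells D \<Longrightarrow> f (g x) = x"
begin

lemma swap: "dfc_iso D C g f"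
  using f_hom g_hom gf fg by unfold_locales auto

lemma f_cell: "x \<in> cells C \<Longrightarrow> f x \<in> cells D" using f_hom by (auto simp: mop_hom_def)

lemma f_dim: "x \<in> cells C \<Longrightarrow> dim D (f x) = dim C x" using f_hom by (simp add: mop_hom_def)

lemma f_inj: "inj_on f (cells C)" by (rule inj_on_inverseI[of _ g]) (rule gf)

lemma f_eq_iff: "x \<in> cells C \<Longrightarrow> y \<in> cells C \<Longrightarrow> f x = f y \<longleftrightarrow> x = y"
  using f_inj by (auto simp: inj_on_def)

lemma f_prec:
  assumes "prec C \<alpha> y x" shows "prec D \<alpha> (f y) (f x)"
proof -
  have x: "x \<in> cells C" "dim C x \<ge> 0" using C.precD assms by blast+
  have d: "f ` delta C x = delta D (f x)" "f ` gamma C x = gamma D (f x)"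
    using f_hom x by (auto simp: mop_hom_def bij_betw_def)
  have sub: "delta C x \<subseteq> cells C" "gamma C x \<subseteq> cells C"
    using C.boundaryD(1)[OF x(1)] by (auto simp: boundary_def)
  have y: "y \<in> cells C" using C.precD assms by blast
  have "f y \<in> delta D (f x) \<longleftrightarrow> y \<in> delta C x" "f y \<in> gamma D (f x) \<longleftrightarrow> y \<in> gamma C x"
    using d sub y f_inj inj_on_image_mem_iff by metis+
  then show ?thesis using assms f_cell x(1) by (simp add: prec_def)
qed

lemma f_prec_iff:
  assumes "x \<in> cells C" "y \<in> cells C" shows "prec D \<alpha> (f y) (f x) \<longleftrightarrow> prec C \<alpha> y x"
proof -
  interpret S: dfc_iso D C g f by (rule swap)
  show ?thesis using f_prec S.f_prec[of \<alpha> "f y" "f x"] gf assms by auto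
qed

lemma f_Lam: assumes "x \<in> Lam C" shows "f x \<in> Lam D"
proof -
  interpret S: dfc_iso D C g f by (rule swap)
  have x: "x \<in> cells C" using assms C.Lam_cells by blast
  have "\<not> D.pos (f x) a" for a
  proof
    assume "D.pos (f x) a"
    then have "C.pos x (g a)" using S.f_prec gf[OF x] by metis
    then show False using assms by (simp add: C.Lam_iff)
  qed
  then show ?thesis using f_cell[OF x] by (simp add: D.Lam_iff)
qed

lemma f_tgt:
  assumes "x \<in> cells C" "dim C x \<ge> 0" shows "f (tgt C x) = tgt D (f x)"
proof -
  have "f ` gamma C x = gamma D (f x)" using f_hom assms by (auto simp: mop_hom_def)
  then show ?thesis using C.gamma_eq[OF assms] D.gamma_eq[of "f x"] f_cell f_dim assms by auto
qed

lemma f_null: assumes "x \<in> null_cells C" shows "f x \<in> null_cells D"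
proof (cases "dim C x \<ge> 0")
  case True
  have x: "x \<in> cells C" "delta C x = {}" using assms by (auto simp: null_cells_def)
  have "f ` delta C x = delta D (f x)"
    using f_hom x True by (auto simp: mop_hom_def bij_betw_def)
  then show ?thesis using x f_cell by (simp add: null_cells_def)
next
  case False
  have x: "x \<in> cells C" using assms by (auto simp: null_cells_def)
  \<comment> \<open>Morphisms constrain faces only in dimensions at least 0; in dimension -1 there
    are no faces on either side.\<close>
  then have "delta D (f x) = {}"
    using D.boundaryD(3)[of "f x"] f_cell f_dim False by (fastforce simp: boundary_def)
  then show ?thesis using x f_cell by (simp add: null_cells_def)
qed

lemma f_lorder: "(y, y') \<in> lorder C x z \<Longrightarrow> (f y, f y') \<in> lorder D (f x) (f z)"
  using f_hom by (simp add: mop_hom_def)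

lemma f_zigzag:
  assumes c: "c \<in> cells C" and z: "zigzag C c p q b a"
  shows "zigzag D (f c) p q (f \<circ> b) (f \<circ> a)"
proof -
  interpret S: dfc_iso D C g f by (rule swap)
  note zz = z[unfolded zigzag_def]
  note z1 = conjunct1[OF zz] conjunct1[OF conjunct2[OF zz]] conjunct1[OF conjunct2[OF conjunct2[OF zz]]]
    conjunct1[OF conjunct2[OF conjunct2[OF conjunct2[OF zz]]]]
    conjunct2[OF conjunct2[OF conjunct2[OF conjunct2[OF zz]]]]
  have aC: "a ` {1..<q} \<subseteq> cells C" using z1(3) C.Lam_cells by blast
  show ?thesis unfolding zigzag_def
  proof (rule conjI[OF z1(1)], rule conjI, rule_tac [2] conjI, rule_tac [3] conjI)
    show "\<forall>i\<in>{1..q}. prec D (if i \<le> p then -1 else 1) (f c) ((f \<circ> b) i)"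
      using z1(2) f_prec by auto
    show "\<forall>i\<in>{1..<q}. (f \<circ> a) i \<in> Lam D \<and>
       (i < p \<longrightarrow> prec D (-1) ((f \<circ> b) i) ((f \<circ> a) i) \<and> prec D 1 ((f \<circ> b) (Suc i)) ((f \<circ> a) i)) \<and>
       (i = p \<longrightarrow> prec D (-1) ((f \<circ> b) i) ((f \<circ> a) i) \<and> prec D (-1) ((f \<circ> b) (Suc i)) ((f \<circ> a) i)) \<and>
       (i > p \<longrightarrow> prec D 1 ((f \<circ> b) i) ((f \<circ> a) i) \<and> prec D (-1) ((f \<circ> b) (Suc i)) ((f \<circ> a) i))"
      using z1(3) f_prec f_Lam by simp
    show "inj_on (f \<circ> a) {1..<q}"
      by (rule comp_inj_on[OF z1(4)]) (rule inj_on_subset[OF f_inj aC])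
    show "\<forall>x\<in>Lam D. \<forall>y \<alpha> \<beta>. \<alpha> \<noteq> 0 \<and> \<beta> \<noteq> 0 \<and> prec D \<beta> (f c) y \<and> prec D \<alpha> y x \<longrightarrow>
       (\<exists>i\<in>{1..<q}. x = (f \<circ> a) i \<and> (y = (f \<circ> b) i \<or> y = (f \<circ> b) (Suc i)))"
    proof (intro ballI allI impI)
      fix x y \<alpha> \<beta>
      assume x: "x \<in> Lam D" and h: "\<alpha> \<noteq> 0 \<and> \<beta> \<noteq> 0 \<and> prec D \<beta> (f c) y \<and> prec D \<alpha> y x"
      \<comment> \<open>Exhaustiveness of the image is exhaustiveness of the original, pulled back
        along \<open>g\<close>.\<close>
      have "prec C \<beta> c (g y)" using S.f_prec[of \<beta> "f c" y] gf[OF c] h by simp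
      moreover have "prec C \<alpha> (g y) (g x)" using S.f_prec h by blast
      moreover have "g x \<in> Lam C" using S.f_Lam x .
      ultimately obtain i where i: "i \<in> {1..<q}" "g x = a i" "g y = b i \<or> g y = b (Suc i)"
        using z1(5) h by blast
      have "f (g x) = x" "f (g y) = y" using fg D.precD h by blast+
      then show "\<exists>i\<in>{1..<q}. x = (f \<circ> a) i \<and> (y = (f \<circ> b) i \<or> y = (f \<circ> b) (Suc i))"
        using i by (intro bexI[of _ i]) auto
    qed
  qed
qed

lemma f_loop_subset: "loop_subset C c u v \<Longrightarrow> loop_subset D (f c) (f u) (f v)"
  unfolding loop_subset_def
proof (induction rule: rtranclp_induct)
  case (step x y)
  have "loop_subset1 D (f c) (f x) (f y)"
    using step.hyps(2) f_prec f_Lam unfolding loop_subset1_def by blast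
  then show ?case using step.IH by (rule rtranclp.rtrancl_into_rtrancl[rotated])
qed simp

lemma f_before1:
  assumes "before1 C c u u'" shows "before1 D (f c) (f u) (f u')"
proof -
  obtain p q b a i j v v' where z: "zigzag C c p q b a" and ij: "i \<in> {1..<q}" "j \<in> {1..<q}" "i < j" and
    v: "prec C 0 c v" "prec C (-1) v (a i)" "prec C 0 c v'" "prec C (-1) v' (a j)"
    "loop_subset C c u v" "loop_subset C c u' v'"
    using assms unfolding before1_def by blast
  have c: "c \<in> cells C" using C.precD v(1) by blast
  show ?thesis unfolding before1_def
    by (rule exI[of _ p], rule exI[of _ q], rule exI[of _ "f \<circ> b"], rule exI[of _ "f \<circ> a"], rule exI[of _ i],
       rule exI[of _ j], rule exI[of _ "f v"], rule exI[of _ "f v'"])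
      (use f_zigzag[OF c z] ij f_prec[OF v(1)] f_prec[OF v(2)] f_prec[OF v(3)] f_prec[OF v(4)]
        f_loop_subset[OF v(5)] f_loop_subset[OF v(6)] in simp)
qed

lemma f_before1_iff:
  assumes "c \<in> cells C" "u \<in> cells C" "u' \<in> cells C"
  shows "before1 D (f c) (f u) (f u') \<longleftrightarrow> before1 C c u u'"
proof -
  interpret S: dfc_iso D C g f by (rule swap)
  show ?thesis using f_before1 S.f_before1[of "f c" "f u" "f u'"] gf assms by auto
qed

lemma f_null_loops: "u \<in> null_loops C c \<Longrightarrow> f u \<in> null_loops D (f c)"
  using f_prec f_Lam f_null unfolding null_loops_def by blast

lemma f_loop_path:
  "loop_path C c p a b \<Longrightarrow> loop_path D (f c) p (f \<circ> a) (f \<circ> b)"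
  using f_prec f_Lam unfolding loop_path_def by simp

text \<open>\<open>before2\<close> contains negated instances of \<open>before1\<close>, so its
  preservation rests on the equivalence \<open>f_before1_iff\<close>.\<close>

lemma f_before:
  assumes "before C c u u'" shows "before D (f c) (f u) (f u')"
proof -
  have n: "u \<in> null_loops C c" "u' \<in> null_loops C c" using assms by (auto simp: before_def)
  then have cu: "c \<in> cells C" "u \<in> cells C" "u' \<in> cells C"
    unfolding null_loops_def using C.precD by blast+
  have "before2 D (f c) (f u) (f u')" if b: "before2 C c u u'"
  proof -
    have b1: "u \<noteq> u'" "\<not> before1 C c u u'" "\<not> before1 C c u' u"
      using b unfolding before2_def by blast+
    obtain p q b a b' a' where p: "p \<ge> 1" "q \<ge> 1"
       "loop_path C c p a b" "b 0 = u" "a 0 \<in> Lam C \<inter> null_cells C"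
       "loop_path C c q a' b'" "b' 0 = u'" "a' 0 \<in> Lam C \<inter> null_cells C"
       "a p = a' q" "b (p - 1) \<noteq> b' (q - 1)"
       "(b (p - 1), b' (q - 1)) \<in> lorder C (a p) c"
      using b unfolding before2_def by (elim conjE exE)
    have "prec C 0 c (b (p - 1))" "prec C 0 c (b' (q - 1))"
      using p(1,2,3,6) unfolding loop_path_def by (metis One_nat_def diff_less less_le_trans zero_less_one)+
    then have "b (p - 1) \<in> cells C" "b' (q - 1) \<in> cells C" using C.precD by blast+
    then have ne: "f (b (p - 1)) \<noteq> f (b' (q - 1))" using p(10) f_eq_iff by blast
    show ?thesis unfolding before2_def
    proof (intro conjI)
      show "f u \<noteq> f u'" using b1(1) f_eq_iff cu by blast
      show "\<not> before1 D (f c) (f u) (f u')" "\<not> before1 D (f c) (f u') (f u)"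
        using b1 f_before1_iff cu by blast+
      show "\<exists>p q a b a' b'. p \<ge> 1 \<and> q \<ge> 1 \<and>
       loop_path D (f c) p a b \<and> b 0 = f u \<and> a 0 \<in> Lam D \<inter> null_cells D \<and>
       loop_path D (f c) q a' b' \<and> b' 0 = f u' \<and> a' 0 \<in> Lam D \<inter> null_cells D \<and>
       a p = a' q \<and> b (p - 1) \<noteq> b' (q - 1) \<and>
       (b (p - 1), b' (q - 1)) \<in> lorder D (a p) (f c)"
        by (rule exI[of _ p], rule exI[of _ q], rule exI[of _ "f \<circ> a"], rule exI[of _ "f \<circ> b"],
            rule exI[of _ "f \<circ> a'"], rule exI[of _ "f \<circ> b'"])
          (use p ne f_loop_path[OF p(3)] f_loop_path[OF p(6)] f_lorder[OF p(11)] f_Lam f_null in simp)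
    qed
  qed
  then show ?thesis using assms f_before1 n f_null_loops unfolding before_def by blast
qed

lemma f_before_iff:
  assumes "c \<in> cells C" "u \<in> cells C" "u' \<in> cells C"
  shows "before D (f c) (f u) (f u') \<longleftrightarrow> before C c u u'"
proof -
  interpret S: dfc_iso D C g f by (rule swap)
  show ?thesis using f_before S.f_before[of "f c" "f u" "f u'"] gf assms by auto
qed

lemma f_omega: "f (omega C) = omega D" and f_dfc_dim: "dfc_dim C = dfc_dim D"
proof -
  interpret S: dfc_iso D C g f by (rule swap)
  have "int (dfc_dim C) \<le> int (dfc_dim D)"
    using D.dim_le[OF f_cell[OF C.omega_cell]] f_dim[OF C.omega_cell] C.dim_omega by simp
  moreover have "int (dfc_dim D) \<le> int (dfc_dim C)"
    using C.dim_le[OF S.f_cell[OF D.omega_cell]] S.f_dim[OF D.omega_cell] D.dim_omega by simp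
  ultimately show d: "dfc_dim C = dfc_dim D" by simp
  show "f (omega C) = omega D"
    by (rule D.dim_top[OF f_cell[OF C.omega_cell]]) (simp add: f_dim[OF C.omega_cell] C.dim_omega d)
qed

lemma f_iter_tgt:
  assumes "k \<le> dfc_dim C" shows "f (iter_tgt C k) = iter_tgt D k"
  using assms
proof (induction rule: inc_induct)
  case base then show ?case using C.iter_tgt_top D.iter_tgt_top f_omega f_dfc_dim by simp
next
  case (step k)
  then have "iter_tgt C (Suc k) \<in> cells C" "dim C (iter_tgt C (Suc k)) \<ge> 0"
    using C.iter_tgt_cell[of "Suc k"] by auto
  then show ?case using f_tgt step C.iter_tgt_Suc D.iter_tgt_Suc f_dfc_dim by simp
qed

lemma f_image_cells: "f ` {x \<in> cells C. dim C x = d} = {x \<in> cells D. dim D x = d}"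
proof -
  interpret S: dfc_iso D C g f by (rule swap)
  show ?thesis
  proof (intro set_eqI iffI)
    fix x assume "x \<in> {x \<in> cells D. dim D x = d}"
    then have "g x \<in> {x \<in> cells C. dim C x = d}" "x = f (g x)" using S.f_cell S.f_dim fg by auto
    then show "x \<in> f ` {x \<in> cells C. dim C x = d}" by blast
  qed (use f_cell f_dim in auto)
qed

lemma f_image_Lam: "f ` {x \<in> Lam C. dim C x = d} = {x \<in> Lam D. dim D x = d}"
proof -
  interpret S: dfc_iso D C g f by (rule swap)
  show ?thesis
  proof (intro set_eqI iffI)
    fix x assume "x \<in> {x \<in> Lam D. dim D x = d}"
    then have "g x \<in> {x \<in> Lam C. dim C x = d}" "x = f (g x)"
      using S.f_Lam S.f_dim fg D.Lam_cells by auto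
    then show "x \<in> f ` {x \<in> Lam C. dim C x = d}" by blast
  qed (use f_Lam f_dim C.Lam_cells in auto)
qed

lemma f_Z_dots:
  assumes "2 \<le> k" "w \<in> Z_dots C k c" shows "f w \<in> Z_dots D k (f c)"
proof -
  note w = C.Z_dotsD[OF assms]
  have "f (tgt C (tgt C w)) = tgt D (tgt D (f w))"
    using f_tgt[of "tgt C w"] f_tgt[of w] w(1,3,8) C.Lam_cells[OF w(1)] C.precD(2)[OF w(5)] assms(1) by simp
  then show ?thesis using w(1-4) f_Lam f_null f_dim C.Lam_cells by (simp add: Z_dots_def)
qed

lemma tree_iso_Z_tree_cells:
  assumes "2 \<le> k" "k \<le> dfc_dim C"
  shows "tree_iso (map_zelt f) (map_zelt f) (Z_tree_cells C k) (Z_tree_cells D k)"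
  unfolding tree_iso_def
proof (intro conjI ballI)
  show "bij_betw (map_zelt f) (nodes (Z_tree_cells C k)) (nodes (Z_tree_cells D k))"
    unfolding C.Z_tree_cells_simps D.Z_tree_cells_simps
    by (rule bij_betw_Cell[OF _ f_image_Lam]) (rule inj_on_subset[OF f_inj], use C.Lam_cells in blast)
  show "bij_betw (map_zelt f) (edges (Z_tree_cells C k)) (edges (Z_tree_cells D k))"
    unfolding C.Z_tree_cells_simps D.Z_tree_cells_simps
    by (rule bij_betw_Cell[OF _ f_image_cells]) (rule inj_on_subset[OF f_inj], blast)
  show "map_zelt f (root (Z_tree_cells C k)) = root (Z_tree_cells D k)"
    unfolding C.Z_tree_cells_simps D.Z_tree_cells_simps using f_iter_tgt[of "k - 2"] assms by simp
  fix b a assume "b \<in> edges (Z_tree_cells C k)" "a \<in> nodes (Z_tree_cells C k)"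
  then obtain y x where yx: "b = Cell y" "y \<in> cells C" "dim C y = int k - 2" "a = Cell x" "x \<in> Lam C"
    by (auto simp: C.Z_tree_cells_simps)
  have x: "x \<in> cells C" using yx C.Lam_cells by blast
  show "is_src (Z_tree_cells D k) (map_zelt f b) (map_zelt f a) = is_src (Z_tree_cells C k) b a"
    "is_tgt (Z_tree_cells D k) (map_zelt f b) (map_zelt f a) = is_tgt (Z_tree_cells C k) b a"
    unfolding C.Z_tree_cells_simps D.Z_tree_cells_simps
    using yx f_prec_iff[OF x yx(2)] f_dim[OF yx(2)] f_Lam[OF yx(5)] by simp_all
qed

lemma leaves_Z_tree_cells_iso:
  "bij_betw (map_zelt f) (leaves (Z_tree_cells C 2)) (leaves (Z_tree_cells D 2))"
proof -
  have "leaves (Z_tree_cells C 2) = Cell ` {x \<in> Lam C. dim C x = 0}"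
    "leaves (Z_tree_cells D 2) = Cell ` {x \<in> Lam D. dim D x = 0}"
    using C.leaves_Z_tree_cells[of 2] D.leaves_Z_tree_cells[of 2] by auto
  then show ?thesis using bij_betw_Cell[OF _ f_image_Lam[of 0]] inj_on_subset[OF f_inj]
    C.Lam_cells by (metis (no_types, lifting) mem_Collect_eq subsetI)
qed

lemma tree_iso_Z_tree:
  assumes "k \<le> dfc_dim C"
  shows "tree_iso (map_zelt f) (map_zelt f) (Z_tree C k) (Z_tree D k)"
proof -
  consider "k = 0" | "k = 1" | "2 \<le> k" by linarith
  then show ?thesis
  proof cases
    case 1
    then show ?thesis by (auto simp: Z_tree_def tree_iso_def bij_betw_def inj_on_def)
  next
    case 2
    have "map_zelt f x \<in> leaves (Z_tree_cells D 2)" if "x \<in> leaves (Z_tree_cells C 2)" for x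
      using leaves_Z_tree_cells_iso that by (auto simp: bij_betw_def)
    then show ?thesis using 2 leaves_Z_tree_cells_iso
      by (auto simp: Z_tree_def tree_iso_def bij_betw_def inj_on_def)
  next
    case 3
    then show ?thesis using tree_iso_Z_tree_cells assms by (simp add: Z_tree_def)
  qed
qed

lemma subdiv_iso_Z_sub:
  assumes "k < dfc_dim C"
  shows "subdiv_iso (map_zelt f) (map_prod (map_zelt f) (map_zelt f))
    (Z_tree C k) (Z_sub C k) (Z_tree D k) (Z_sub D k)"
proof (cases "2 \<le> k")
  case False
  then show ?thesis by (simp add: subdiv_iso_def Z_sub_def white_dots_def bij_betw_def)
next
  case k: True
  interpret S: dfc_iso D C g f by (rule swap)
  have T: "Z_tree C k = Z_tree_cells C k" "Z_tree D k = Z_tree_cells D k" using k by (simp_all add: Z_tree_def)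
  let ?h = "map_zelt f"
  show ?thesis unfolding subdiv_iso_def T
  proof (intro conjI)
    show "bij_betw (map_prod ?h ?h) (white_dots (Z_tree_cells C k) (Z_sub C k))
      (white_dots (Z_tree_cells D k) (Z_sub D k))"
      unfolding C.white_dots_Z[OF k] D.white_dots_Z[OF k] bij_betw_def
    proof
      show "inj_on (map_prod ?h ?h) {(Cell c, Cell w) |c w. w \<in> Z_dots C k c}"
        using f_eq_iff C.Z_dotsD(1,10)[OF k] C.Lam_cells by (auto simp: inj_on_def)
      show "map_prod ?h ?h ` {(Cell c, Cell w) |c w. w \<in> Z_dots C k c} = {(Cell c, Cell w) |c w. w \<in> Z_dots D k c}"
      proof (intro set_eqI iffI)
        fix d assume "d \<in> {(Cell c, Cell w) |c w. w \<in> Z_dots D k c}"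
        then obtain c w where d: "d = (Cell c, Cell w)" "w \<in> Z_dots D k c" by blast
        have "d = map_prod ?h ?h (Cell (g c), Cell (g w))"
          using d D.Z_dotsD(1,10)[OF k d(2)] D.Lam_cells fg by simp
        then show "d \<in> map_prod ?h ?h ` {(Cell c, Cell w) |c w. w \<in> Z_dots C k c}"
          using S.f_Z_dots[OF k d(2)] by blast
      qed (use f_Z_dots[OF k] in auto)
    qed
    show "\<forall>(b, w)\<in>white_dots (Z_tree_cells C k) (Z_sub C k). fst (map_prod ?h ?h (b, w)) = ?h b" by auto
    show "\<forall>b\<in>edges (Z_tree_cells C k). \<forall>w\<in>wset (Z_sub C k) b. \<forall>w'\<in>wset (Z_sub C k) b.
       ((w, w') \<in> wless (Z_sub C k) b) = ((snd (map_prod ?h ?h (b, w)), snd (map_prod ?h ?h (b, w'))) \<in> wless (Z_sub D k) (?h b))"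
    proof (intro ballI)
      fix b w w' assume "b \<in> edges (Z_tree_cells C k)" and w: "w \<in> wset (Z_sub C k) b" "w' \<in> wset (Z_sub C k) b"
      then obtain c where c: "b = Cell c" "c \<in> cells C" by (auto simp: C.Z_tree_cells_simps)
      obtain v v' where v: "w = Cell v" "w' = Cell v'" "v \<in> Z_dots C k c" "v' \<in> Z_dots C k c"
        using w C.Z_sub_simps(1)[OF k] c by auto
      note d = C.Z_dotsD[OF k v(3)] and d' = C.Z_dotsD[OF k v(4)]
      have "f (tgt C v) = tgt D (f v)" "f (tgt C v') = tgt D (f v')"
        using f_tgt d(1,3) d'(1,3) C.Lam_cells by simp_all
      moreover have "tgt C v \<in> cells C" "tgt C v' \<in> cells C" using C.precD(2) d(5) d'(5) by blast+
      ultimately show "((w, w') \<in> wless (Z_sub C k) b) = ((snd (map_prod ?h ?h (b, w)), snd (map_prod ?h ?h (b, w'))) \<in> wless (Z_sub D k) (?h b))"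
        using c v C.Z_sub_simps(2)[OF k] D.Z_sub_simps(2)[OF k] f_Z_dots[OF k v(3)] f_Z_dots[OF k v(4)]
          f_before_iff[of c "tgt C v" "tgt C v'"] by simp
    qed
  qed
qed

end

section \<open>The categories of dendritic face complexes and of opetopes\<close>

lemma mop_delta_gamma_cells:
  assumes "is_mop C" "x \<in> cells C"
  shows "delta C x \<subseteq> cells C" "gamma C x \<subseteq> cells C"
  using assms unfolding is_mop_def by auto

lemma mop_lorder_cells:
  assumes "is_mop C" "(y, y') \<in> lorder C x z"
  shows "x \<in> cells C" "y \<in> cells C" "y' \<in> cells C" "z \<in> cells C"
proof -
  have x: "x \<in> Lam C" "z \<in> boundary2 C x" using assms unfolding is_mop_def by (metis empty_iff)+
  then have "strict_total_order {y. prec C 0 z y \<and> prec C (-1) y x} (lorder C x z)"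
    using assms(1) unfolding is_mop_def by blast
  then have "prec C 0 z y" "prec C 0 z y'" using assms(2) by (auto simp: strict_total_order_def)
  then show "y \<in> cells C" "y' \<in> cells C" "z \<in> cells C" using prec_cells[OF assms(1)] by blast+
  show "x \<in> cells C" using x by (simp add: Lam_def)
qed

lemma mop_hom_id:
  assumes "is_mop C" shows "restrict id (cells C) \<in> mop_hom C C"
proof -
  have "restrict id (cells C) ` A = A" if "A \<subseteq> cells C" for A using that by (auto simp: image_iff)
  moreover have "inj_on (restrict id (cells C)) A" if "A \<subseteq> cells C" for A using that by (auto simp: inj_on_def)
  ultimately show ?thesis
    using mop_delta_gamma_cells[OF assms] mop_lorder_cells[OF assms]
    by (simp add: mop_hom_def bij_betw_def)
qed

lemma mop_hom_comp:
  assumes "is_mop C" "f \<in> mop_hom C D" "g \<in> mop_hom D E"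
  shows "compose (cells C) g f \<in> mop_hom C E"
proof -
  have f: "f x \<in> cells D" "dim D (f x) = dim C x" if "x \<in> cells C" for x
    using assms(2) that by (auto simp: mop_hom_def)
  have im: "compose (cells C) g f ` A = g ` f ` A" if "A \<subseteq> cells C" for A
    using that by (force simp: compose_def)
  show ?thesis
    unfolding mop_hom_def
  proof (intro CollectI conjI ballI allI impI)
    show "compose (cells C) g f \<in> cells C \<rightarrow>\<^sub>E cells E"
      using assms f by (auto simp: mop_hom_def compose_def)
    fix x assume x: "x \<in> cells C"
    then show "dim E (compose (cells C) g f x) = dim C x"
      using assms(3) f by (simp add: mop_hom_def compose_eq)
    assume d: "dim C x \<ge> 0"
    have bf: "bij_betw f (delta C x) (delta D (f x))" "f ` gamma C x = gamma D (f x)"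
      using assms(2) x d by (auto simp: mop_hom_def)
    have bg: "bij_betw g (delta D (f x)) (delta E (g (f x)))" "g ` gamma D (f x) = gamma E (g (f x))"
      using assms(3) f[OF x] d by (auto simp: mop_hom_def)
    have "bij_betw (g \<circ> f) (delta C x) (delta E (g (f x)))" using bij_betw_trans[OF bf(1) bg(1)] .
    moreover have "compose (cells C) g f y = (g \<circ> f) y" if "y \<in> delta C x" for y
      using mop_delta_gamma_cells[OF assms(1) x] that by (auto simp: compose_eq)
    ultimately have "bij_betw (compose (cells C) g f) (delta C x) (delta E (g (f x)))"
      using bij_betw_cong[of "delta C x" "compose (cells C) g f" "g \<circ> f"] by blast
    then show "bij_betw (compose (cells C) g f) (delta C x) (delta E (compose (cells C) g f x))"
      using x by (simp add: compose_eq)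
    show "compose (cells C) g f ` gamma C x = gamma E (compose (cells C) g f x)"
      using im[OF mop_delta_gamma_cells(2)[OF assms(1) x]] bf bg x by (simp add: compose_eq)
  next
    fix x z y y' assume o: "(y, y') \<in> lorder C x z"
    have "(g (f y), g (f y')) \<in> lorder E (g (f x)) (g (f z))"
      using assms(2,3) o by (simp add: mop_hom_def)
    then show "(compose (cells C) g f y, compose (cells C) g f y')
        \<in> lorder E (compose (cells C) g f x) (compose (cells C) g f z)"
      using mop_lorder_cells[OF assms(1) o] by (simp add: compose_eq)
  qed
qed

lemma DFC_core_simps:
  "C \<in> Obj DFC_core \<longleftrightarrow> is_dfc C"
  "Idn DFC_core C = restrict id (cells C)"
  "Cmp DFC_core C D E g f = compose (cells C) g f"
  "f \<in> Hom DFC_core C D \<longleftrightarrow> f \<in> mop_hom C D \<and>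
    (\<exists>g\<in>mop_hom D C. compose (cells C) g f = restrict id (cells C) \<and> compose (cells D) f g = restrict id (cells D))"
  by (auto simp: DFC_core_def core_def DFC_def full_subcategory_def MOP_def is_dfc_def)

lemma DFC_core_iso:
  assumes "is_dfc C" "is_dfc D" "f \<in> Hom DFC_core C D"
  obtains g where "dfc_iso C D f g"
proof -
  obtain g where g: "f \<in> mop_hom C D" "g \<in> mop_hom D C"
    "compose (cells C) g f = restrict id (cells C)" "compose (cells D) f g = restrict id (cells D)"
    using assms(3) unfolding DFC_core_simps by blast
  have "g (f x) = x" if "x \<in> cells C" for x using fun_cong[OF g(3), of x] that by (simp add: compose_eq)
  moreover have "f (g x) = x" if "x \<in> cells D" for x using fun_cong[OF g(4), of x] that by (simp add: compose_eq)
  ultimately have "dfc_iso C D f g" using assms g(1,2) by unfold_locales auto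
  then show ?thesis using that by blast
qed

lemma (in dfc_iso) iso_Hom: "f \<in> Hom DFC_core C D"
proof -
  interpret S: dfc_iso D C g f by (rule swap)
  have "compose (cells C) g f = restrict id (cells C)" "compose (cells D) f g = restrict id (cells D)"
    using gf fg by (auto simp: compose_def fun_eq_iff)
  then show ?thesis using f_hom g_hom unfolding DFC_core_simps by blast
qed

lemma extensional_compose_id:
  "f \<in> extensional A \<Longrightarrow> compose A f (restrict id A) = f"
  "f \<in> extensional A \<Longrightarrow> f ` A \<subseteq> B \<Longrightarrow> compose A (restrict id B) f = f"
  by (auto simp: compose_def fun_eq_iff extensional_def)

lemma compose_assoc_image:
  "f ` A \<subseteq> B \<Longrightarrow> compose A h (compose A g f) = compose A (compose B h g) f"
  by (auto simp: compose_def fun_eq_iff)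

lemma is_category_DFC_core: "is_category DFC_core"
  unfolding is_category_def
proof (intro conjI ballI)
  fix C :: "'a mop" assume C: "C \<in> Obj DFC_core"
  then have c: "is_dfc C" "is_mop C" by (auto simp: DFC_core_simps is_dfc_def)
  have "compose (cells C) (restrict id (cells C)) (restrict id (cells C)) = restrict id (cells C)"
    by (auto simp: compose_def fun_eq_iff)
  then show "Idn DFC_core C \<in> Hom DFC_core C C" using mop_hom_id[OF c(2)] unfolding DFC_core_simps by blast
  fix D :: "'a mop" assume D: "D \<in> Obj DFC_core"
  then have d: "is_dfc D" "is_mop D" by (auto simp: DFC_core_simps is_dfc_def)
  {
    fix f assume "f \<in> Hom DFC_core C D"
    then have "f \<in> cells C \<rightarrow>\<^sub>E cells D" by (simp add: DFC_core_simps mop_hom_def)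
    then have "f \<in> extensional (cells C)" "f ` cells C \<subseteq> cells D" by (auto simp: PiE_def)
    then show "Cmp DFC_core C C D f (Idn DFC_core C) = f" "Cmp DFC_core C D D (Idn DFC_core D) f = f"
      by (simp_all add: DFC_core_simps extensional_compose_id)
  }
  fix E :: "'a mop" assume E: "E \<in> Obj DFC_core"
  then have e: "is_dfc E" "is_mop E" by (auto simp: DFC_core_simps is_dfc_def)
  {
    fix f g assume f: "f \<in> Hom DFC_core C D" and g: "g \<in> Hom DFC_core D E"
    obtain f' where "dfc_iso C D f f'" using DFC_core_iso[OF c(1) d(1) f] .
    then interpret F: dfc_iso C D f f' .
    obtain g' where "dfc_iso D E g g'" using DFC_core_iso[OF d(1) e(1) g] .
    then interpret G: dfc_iso D E g g' .
    have "compose (cells C) g f \<in> mop_hom C E" "compose (cells E) f' g' \<in> mop_hom E C"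
      using mop_hom_comp[OF c(2) F.f_hom G.f_hom] mop_hom_comp[OF e(2) G.g_hom F.g_hom] .
    moreover have "g' x \<in> cells D" if "x \<in> cells E" for x
      using G.g_hom that by (auto simp: mop_hom_def)
    moreover have "f' x \<in> cells C" if "x \<in> cells D" for x
      using F.g_hom that by (auto simp: mop_hom_def)
    ultimately have "dfc_iso C E (compose (cells C) g f) (compose (cells E) f' g')"
      using F.gf F.fg G.gf G.fg F.f_cell G.f_cell by unfold_locales (auto simp: compose_eq)
    then show "Cmp DFC_core C D E g f \<in> Hom DFC_core C E"
      unfolding DFC_core_simps(3) by (rule dfc_iso.iso_Hom)
  }
  fix V :: "'a mop" and f g h assume "V \<in> Obj DFC_core" and f: "f \<in> Hom DFC_core C D"
    and "g \<in> Hom DFC_core D E" "h \<in> Hom DFC_core E V"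
  have "f ` cells C \<subseteq> cells D" using f by (auto simp: DFC_core_simps mop_hom_def)
  then show "Cmp DFC_core C E V h (Cmp DFC_core C D E g f) = Cmp DFC_core C D V (Cmp DFC_core D E V h g) f"
    unfolding DFC_core_simps by (rule compose_assoc_image)
qed

section \<open>Isomorphisms of trees, subdivisions and opetopes\<close>

lemma tree_iso_id: "tree_iso (restrict id (nodes T)) (restrict id (edges T)) T T" if "root T \<in> edges T"
  using that by (auto simp: tree_iso_def bij_betw_def inj_on_def)

lemma tree_iso_comp:
  assumes "tree_iso fn fe T U" "tree_iso gn ge U V" "root T \<in> edges T"
  shows "tree_iso (compose (nodes T) gn fn) (compose (edges T) ge fe) T V"
proof -
  have n: "bij_betw fn (nodes T) (nodes U)" "bij_betw gn (nodes U) (nodes V)"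
    and e: "bij_betw fe (edges T) (edges U)" "bij_betw ge (edges U) (edges V)"
    using assms by (auto simp: tree_iso_def)
  have "bij_betw (compose (nodes T) gn fn) (nodes T) (nodes V)"
    "bij_betw (compose (edges T) ge fe) (edges T) (edges V)"
    using bij_betw_trans[OF n] bij_betw_trans[OF e] by (simp_all add: compose_eq cong: bij_betw_cong)
  moreover have "fe b \<in> edges U" if "b \<in> edges T" for b using e(1) that by (auto simp: bij_betw_def)
  moreover have "fn a \<in> nodes U" if "a \<in> nodes T" for a using n(1) that by (auto simp: bij_betw_def)
  ultimately show ?thesis using assms by (simp add: tree_iso_def compose_eq)
qed

lemma subdiv_iso_id:
  "subdiv_iso (restrict id (edges T)) (restrict id (white_dots T W)) T W T W"
  by (auto simp: subdiv_iso_def bij_betw_def inj_on_def white_dots_def)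

lemma subdiv_iso_comp:
  assumes f: "subdiv_iso fe fw T W U V" and g: "subdiv_iso ge gw U V X Y"
    and e: "fe ` edges T \<subseteq> edges U"
  shows "subdiv_iso (compose (edges T) ge fe) (compose (white_dots T W) gw fw) T W X Y"
proof -
  have bf: "bij_betw fw (white_dots T W) (white_dots U V)" and bg: "bij_betw gw (white_dots U V) (white_dots X Y)"
    using f g by (auto simp: subdiv_iso_def)
  have w: "fw (b, w) = (fe b, snd (fw (b, w))) \<and> fe b \<in> edges U \<and> snd (fw (b, w)) \<in> wset V (fe b)"
    if "b \<in> edges T" "w \<in> wset W b" for b w
  proof -
    have d: "(b, w) \<in> white_dots T W" using that by (simp add: white_dots_def)
    then have "fst (fw (b, w)) = fe b" using f by (auto simp: subdiv_iso_def)
    moreover have "fw (b, w) \<in> white_dots U V" using bf d by (auto simp: bij_betw_def)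
    ultimately show ?thesis by (cases "fw (b, w)") (auto simp: white_dots_def)
  qed
  have of_f: "(w, w') \<in> wless W b \<longleftrightarrow> (snd (fw (b, w)), snd (fw (b, w'))) \<in> wless V (fe b)"
    if "b \<in> edges T" "w \<in> wset W b" "w' \<in> wset W b" for b w w'
    using f that by (simp add: subdiv_iso_def)
  have of_g: "(w, w') \<in> wless V b \<longleftrightarrow> (snd (gw (b, w)), snd (gw (b, w'))) \<in> wless Y (ge b)"
    if "b \<in> edges U" "w \<in> wset V b" "w' \<in> wset V b" for b w w'
    using g that by (simp add: subdiv_iso_def)
  have fst_g: "fst (gw (b, w)) = ge b" if "b \<in> edges U" "w \<in> wset V b" for b w
    using g that by (auto simp: subdiv_iso_def white_dots_def)
  show ?thesis unfolding subdiv_iso_def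
  proof (intro conjI ballI)
    show "bij_betw (compose (white_dots T W) gw fw) (white_dots T W) (white_dots X Y)"
      using bij_betw_trans[OF bf bg] by (simp add: compose_eq cong: bij_betw_cong)
    fix d assume d: "d \<in> white_dots T W"
    obtain b w' where bw: "d = (b, w')" by (cases d)
    have "b \<in> edges T" "w' \<in> wset W b" using d bw by (auto simp: white_dots_def)
    note 1 = w[OF this] this
    then have "fst (gw (fw (b, w'))) = ge (fe b)" using fst_g by metis
    then show "case d of (b, w) \<Rightarrow> fst (compose (white_dots T W) gw fw (b, w)) = compose (edges T) ge fe b"
      using d bw 1 by (simp add: compose_eq)
  next
    fix b w1 w2 assume b: "b \<in> edges T" "w1 \<in> wset W b" "w2 \<in> wset W b"
    have "(b, w1) \<in> white_dots T W" "(b, w2) \<in> white_dots T W" using b by (auto simp: white_dots_def)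
    moreover have "(w1, w2) \<in> wless W b \<longleftrightarrow> (snd (gw (fw (b, w1))), snd (gw (fw (b, w2)))) \<in> wless Y (ge (fe b))"
      using of_f[OF b] of_g[of "fe b" "snd (fw (b, w1))" "snd (fw (b, w2))"] w[OF b(1,2)] w[OF b(1,3)] by simp
    ultimately show "(w1, w2) \<in> wless W b \<longleftrightarrow>
      (snd (compose (white_dots T W) gw fw (b, w1)), snd (compose (white_dots T W) gw fw (b, w2)))
        \<in> wless Y (compose (edges T) ge fe b)"
      using b by (simp add: compose_eq)
  qed
qed

text \<open>Because the constellations are exact, nodes are edges of the next tree and white dots
  give nodes of it; this places the arguments in the compatibility clauses inside the domains of the
  restricted maps.\<close>

lemma opetope_sub:
  assumes "is_opetope P" "k < odim P"
  shows "nodes (otree P k) \<subseteq> edges (otree P (Suc k))"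
    "d \<in> white_dots (otree P k) (osub P k) \<Longrightarrow> snd d \<in> nodes (otree P (Suc k))"
proof -
  have "constellation (otree P k) (osub P k) id snd (otree P (Suc k))"
    using assms by (simp add: is_opetope_def exact_constellation_def)
  then have "bij_betw id (nodes (otree P k)) (leaves (otree P (Suc k)))"
    "bij_betw snd (white_dots (otree P k) (osub P k)) (null_dots (otree P (Suc k)))"
    by (auto simp: constellation_def)
  then show "nodes (otree P k) \<subseteq> edges (otree P (Suc k))"
    "d \<in> white_dots (otree P k) (osub P k) \<Longrightarrow> snd d \<in> nodes (otree P (Suc k))"
    by (auto simp: bij_betw_def leaves_def null_dots_def)
qed

lemma opetope_root: "is_opetope P \<Longrightarrow> k \<le> odim P \<Longrightarrow> root (otree P k) \<in> edges (otree P k)"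
  by (simp add: is_opetope_def rooted_tree_def)

lemma opetope_iso_image:
  assumes "f \<in> opetope_iso P Q"
  shows "nmap f k ` onodes P k \<subseteq> onodes Q k" "emap f k ` oedges P k \<subseteq> oedges Q k"
    "wmap f k ` owhite P k \<subseteq> owhite Q k"
  using assms by (auto simp: opetope_iso_def onodes_def oedges_def owhite_def tree_iso_def subdiv_iso_def bij_betw_def)

lemma KJBM_simps:
  "P \<in> Obj KJBM \<longleftrightarrow> is_opetope P"
  "Hom KJBM P Q = opetope_iso P Q"
  "Idn KJBM P = \<lparr>nmap = (\<lambda>k. restrict id (onodes P k)), emap = (\<lambda>k. restrict id (oedges P k)),
       wmap = (\<lambda>k. restrict id (owhite P k))\<rparr>"
  "Cmp KJBM P Q R g f = \<lparr>nmap = (\<lambda>k. compose (onodes P k) (nmap g k) (nmap f k)),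
       emap = (\<lambda>k. compose (oedges P k) (emap g k) (emap f k)),
       wmap = (\<lambda>k. compose (owhite P k) (wmap g k) (wmap f k))\<rparr>"
  by (simp_all add: KJBM_def)

lemma opetope_iso_id:
  assumes "is_opetope P" shows "Idn KJBM P \<in> opetope_iso P P"
  unfolding opetope_iso_def KJBM_simps
proof (intro CollectI conjI allI impI ballI; (unfold opmap.simps)?)
  show "odim P = odim P" ..
next
  fix k show "restrict id (onodes P k) \<in> extensional (onodes P k)"
    "restrict id (oedges P k) \<in> extensional (oedges P k)"
    "restrict id (owhite P k) \<in> extensional (owhite P k)" by simp_all
next
  fix k assume k: "k \<le> odim P"
  show "tree_iso (restrict id (onodes P k)) (restrict id (oedges P k)) (otree P k) (otree P k)"
    using tree_iso_id[OF opetope_root[OF assms k]] k by (simp add: onodes_def oedges_def)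
next
  fix k assume "k < odim P"
  then show "subdiv_iso (restrict id (oedges P k)) (restrict id (owhite P k)) (otree P k) (osub P k) (otree P k) (osub P k)"
    using subdiv_iso_id by (simp add: owhite_def oedges_def)
next
  fix k a assume "k < odim P" "a \<in> nodes (otree P k)"
  then show "restrict id (oedges P (Suc k)) (id a) = id (restrict id (onodes P k) a)"
    using opetope_sub(1)[OF assms, of k] by (auto simp: onodes_def oedges_def)
next
  fix k d assume "k < odim P" "d \<in> white_dots (otree P k) (osub P k)"
  then show "restrict id (onodes P (Suc k)) (snd d) = snd (restrict id (owhite P k) d)"
    using opetope_sub(2)[OF assms, of k] by (auto simp: onodes_def owhite_def)
qed

lemma opetope_iso_comp:
  assumes P: "is_opetope P" and f: "f \<in> opetope_iso P Q" and g: "g \<in> opetope_iso Q R"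
  shows "Cmp KJBM P Q R g f \<in> opetope_iso P R"
proof -
  have dims: "odim P = odim Q" "odim Q = odim R" using f g by (auto simp: opetope_iso_def)
  have tf: "tree_iso (nmap f k) (emap f k) (otree P k) (otree Q k)"
    and tg: "tree_iso (nmap g k) (emap g k) (otree Q k) (otree R k)" if "k \<le> odim P" for k
    using f g that dims by (auto simp: opetope_iso_def)
  have sf: "subdiv_iso (emap f k) (wmap f k) (otree P k) (osub P k) (otree Q k) (osub Q k)"
    and sg: "subdiv_iso (emap g k) (wmap g k) (otree Q k) (osub Q k) (otree R k) (osub R k)" if "k < odim P" for k
    using f g that dims by (auto simp: opetope_iso_def)
  have nf: "emap f (Suc k) a = nmap f k a" if "k < odim P" "a \<in> nodes (otree P k)" for k a
    using f that by (simp add: opetope_iso_def)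
  have ng: "emap g (Suc k) a = nmap g k a" if "k < odim P" "a \<in> nodes (otree Q k)" for k a
    using g that dims by (simp add: opetope_iso_def)
  have wf: "nmap f (Suc k) (snd d) = snd (wmap f k d)" if "k < odim P" "d \<in> white_dots (otree P k) (osub P k)" for k d
    using f that by (simp add: opetope_iso_def)
  have wg: "nmap g (Suc k) (snd d) = snd (wmap g k d)" if "k < odim P" "d \<in> white_dots (otree Q k) (osub Q k)" for k d
    using g that dims by (simp add: opetope_iso_def)
  show ?thesis
    unfolding opetope_iso_def KJBM_simps
  proof (intro CollectI conjI allI impI ballI; (unfold opmap.simps)?)
    show "odim P = odim R" using dims by simp
  next
    fix k show "compose (onodes P k) (nmap g k) (nmap f k) \<in> extensional (onodes P k)"
      "compose (oedges P k) (emap g k) (emap f k) \<in> extensional (oedges P k)"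
      "compose (owhite P k) (wmap g k) (wmap f k) \<in> extensional (owhite P k)" by (rule compose_extensional)+
  next
    fix k assume k: "k \<le> odim P"
    show "tree_iso (compose (onodes P k) (nmap g k) (nmap f k)) (compose (oedges P k) (emap g k) (emap f k))
        (otree P k) (otree R k)"
      using tree_iso_comp[OF tf[OF k] tg[OF k] opetope_root[OF P k]] k by (simp add: onodes_def oedges_def)
  next
    fix k assume k: "k < odim P"
    have "emap f k ` edges (otree P k) \<subseteq> edges (otree Q k)"
      using tf[of k] k by (auto simp: tree_iso_def bij_betw_def)
    from subdiv_iso_comp[OF sf[OF k] sg[OF k] this]
    show "subdiv_iso (compose (oedges P k) (emap g k) (emap f k)) (compose (owhite P k) (wmap g k) (wmap f k))
        (otree P k) (osub P k) (otree R k) (osub R k)" using k by (simp add: oedges_def owhite_def)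
  next
    fix k a assume k: "k < odim P" and a: "a \<in> nodes (otree P k)"
    have "a \<in> oedges P (Suc k)" "a \<in> onodes P k" using opetope_sub(1)[OF P k] k a by (auto simp: onodes_def oedges_def)
    moreover have "nmap f k a \<in> nodes (otree Q k)" using tf[of k] k a by (auto simp: tree_iso_def bij_betw_def)
    ultimately show "compose (oedges P (Suc k)) (emap g (Suc k)) (emap f (Suc k)) (id a)
        = id (compose (onodes P k) (nmap g k) (nmap f k) a)"
      using nf[OF k a] ng[OF k] by (simp add: compose_eq)
  next
    fix k d assume k: "k < odim P" and d: "d \<in> white_dots (otree P k) (osub P k)"
    have "snd d \<in> onodes P (Suc k)" "d \<in> owhite P k" using opetope_sub(2)[OF P k d] k d by (auto simp: onodes_def owhite_def)
    moreover have "wmap f k d \<in> white_dots (otree Q k) (osub Q k)"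
      using sf[OF k] d by (auto simp: subdiv_iso_def bij_betw_def)
    ultimately show "compose (onodes P (Suc k)) (nmap g (Suc k)) (nmap f (Suc k)) (snd d)
        = snd (compose (owhite P k) (wmap g k) (wmap f k) d)"
      using wf[OF k d] wg[OF k] by (simp add: compose_eq)
  qed
qed

lemma is_category_KJBM: "is_category KJBM"
  unfolding is_category_def
proof (intro conjI ballI)
  fix P :: "'a opetope" assume "P \<in> Obj KJBM"
  then have P: "is_opetope P" by (simp add: KJBM_simps)
  show "Idn KJBM P \<in> Hom KJBM P P" using opetope_iso_id[OF P] by (simp add: KJBM_simps(2))
  fix Q :: "'a opetope" assume "Q \<in> Obj KJBM"
  {
    fix f assume "f \<in> Hom KJBM P Q"
    then have f: "f \<in> opetope_iso P Q" by (simp add: KJBM_simps)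
    have "nmap f k \<in> extensional (onodes P k)" "emap f k \<in> extensional (oedges P k)"
      "wmap f k \<in> extensional (owhite P k)" for k using f by (auto simp: opetope_iso_def)
    then show "Cmp KJBM P P Q f (Idn KJBM P) = f" "Cmp KJBM P Q Q (Idn KJBM Q) f = f"
      using opetope_iso_image[OF f] by (simp_all add: KJBM_simps extensional_compose_id)
  }
  fix R :: "'a opetope" assume "R \<in> Obj KJBM"
  {
    fix f g assume "f \<in> Hom KJBM P Q" "g \<in> Hom KJBM Q R"
    then show "Cmp KJBM P Q R g f \<in> Hom KJBM P R" using opetope_iso_comp[OF P] by (simp add: KJBM_simps(2))
  }
  fix V :: "'a opetope" and f g h assume "V \<in> Obj KJBM" and f: "f \<in> Hom KJBM P Q"
    and "g \<in> Hom KJBM Q R" "h \<in> Hom KJBM R V"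
  have f: "f \<in> opetope_iso P Q" using f by (simp add: KJBM_simps)
  show "Cmp KJBM P R V h (Cmp KJBM P Q R g f) = Cmp KJBM P Q V (Cmp KJBM Q R V h g) f"
    by (simp add: KJBM_simps compose_assoc_image[OF opetope_iso_image(1)[OF f]]
      compose_assoc_image[OF opetope_iso_image(2)[OF f]] compose_assoc_image[OF opetope_iso_image(3)[OF f]])
qed

section \<open>The functor\<close>

lemma (in dfc_iso) Z_map_iso: "Z_map C D f \<in> opetope_iso (Z_obj C) (Z_obj D)"
proof -
  let ?h = "map_zelt f" and ?P = "Z_obj C" and ?Q = "Z_obj D"
  have simps: "odim ?P = dfc_dim C" "otree ?P = Z_tree C" "osub ?P = Z_sub C"
    "odim ?Q = dfc_dim D" "otree ?Q = Z_tree D" "osub ?Q = Z_sub D" by (simp_all add: Z_obj_def)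
  have "is_opetope ?P" using C.is_opetope_Z_obj .
  note sub = opetope_sub[OF this, unfolded simps] and rt = opetope_root[OF this, unfolded simps]
  have tree_cong: "tree_iso (restrict ?h (nodes T)) (restrict ?h (edges T)) T U"
    if "tree_iso ?h ?h T U" "root T \<in> edges T" for T U
    using that by (simp add: tree_iso_def cong: bij_betw_cong)
  have sub_cong: "subdiv_iso (restrict ?h (edges T)) (restrict (map_prod ?h ?h) (white_dots T W)) T W U V"
    if "subdiv_iso ?h (map_prod ?h ?h) T W U V" for T W U V
  proof -
    have "bij_betw (restrict (map_prod ?h ?h) (white_dots T W)) (white_dots T W) (white_dots U V)
      \<longleftrightarrow> bij_betw (map_prod ?h ?h) (white_dots T W) (white_dots U V)"
      by (rule bij_betw_cong) simp
    moreover have "(b, w) \<in> white_dots T W \<longleftrightarrow> b \<in> edges T \<and> w \<in> wset W b" for b w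
      by (simp add: white_dots_def)
    ultimately show ?thesis using that by (auto simp: subdiv_iso_def)
  qed
  show ?thesis
    unfolding opetope_iso_def Z_map_def simps
  proof (intro CollectI conjI allI impI ballI; (unfold opmap.simps simps)?)
    show "dfc_dim C = dfc_dim D" by (rule f_dfc_dim)
  next
    fix k show "restrict ?h (onodes ?P k) \<in> extensional (onodes ?P k)"
      "restrict ?h (oedges ?P k) \<in> extensional (oedges ?P k)"
      "restrict (map_prod ?h ?h) (owhite ?P k) \<in> extensional (owhite ?P k)" by simp_all
  next
    fix k assume "k \<le> dfc_dim C"
    then show "tree_iso (restrict ?h (onodes ?P k)) (restrict ?h (oedges ?P k)) (Z_tree C k) (Z_tree D k)"
      using tree_cong[OF tree_iso_Z_tree rt] by (simp add: onodes_def oedges_def simps)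
  next
    fix k assume "k < dfc_dim C"
    then show "subdiv_iso (restrict ?h (oedges ?P k)) (restrict (map_prod ?h ?h) (owhite ?P k))
        (Z_tree C k) (Z_sub C k) (Z_tree D k) (Z_sub D k)"
      using sub_cong[OF subdiv_iso_Z_sub] by (simp add: oedges_def owhite_def simps)
  next
    fix k a assume "k < dfc_dim C" "a \<in> nodes (Z_tree C k)"
    then show "restrict ?h (oedges ?P (Suc k)) (id a) = id (restrict ?h (onodes ?P k) a)"
      using sub(1)[of k] by (auto simp: onodes_def oedges_def simps)
  next
    fix k d assume "k < dfc_dim C" "d \<in> white_dots (Z_tree C k) (Z_sub C k)"
    then show "restrict ?h (onodes ?P (Suc k)) (snd d) = snd (restrict (map_prod ?h ?h) (owhite ?P k) d)"
      using sub(2)[of k d] by (simp add: onodes_def owhite_def simps)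
  qed
qed

text \<open>A common container for all nodes and edges of the trees of \<open>Z_obj C\<close>, on
  which \<open>map_zelt f\<close> depends only on the values of \<open>f\<close> on cells.\<close>

definition zelts :: "'a mop \<Rightarrow> 'a zelt set" where
  "zelts C = Cell ` cells C \<union> {Leaf0, Root0, Leaf1, Root1}"

lemma Z_obj_zelts:
  "onodes (Z_obj C) k \<subseteq> zelts C" "oedges (Z_obj C) k \<subseteq> zelts C" "owhite (Z_obj C) k \<subseteq> zelts C \<times> zelts C"
proof -
  have "leaves (Z_tree_cells C 2) \<subseteq> zelts C"
    by (auto simp: leaves_def Z_tree_cells_def Let_def zelts_def)
  then show "onodes (Z_obj C) k \<subseteq> zelts C" "oedges (Z_obj C) k \<subseteq> zelts C"
    by (auto simp: onodes_def oedges_def Z_obj_def Z_tree_def Z_tree_cells_def Let_def zelts_def Lam_def)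
  have "wset (Z_sub C k) b \<subseteq> zelts C" for b
    by (auto simp: Z_sub_def Z_dots_def zelts_def Lam_def)
  then have "white_dots (Z_tree C k) (Z_sub C k) \<subseteq> zelts C \<times> zelts C" if "edges (Z_tree C k) \<subseteq> zelts C"
    using that unfolding white_dots_def by blast
  then show "owhite (Z_obj C) k \<subseteq> zelts C \<times> zelts C"
    using \<open>oedges (Z_obj C) k \<subseteq> zelts C\<close> by (cases "k < dfc_dim C") (auto simp: owhite_def oedges_def Z_obj_def)
qed

lemma map_zelt_id: "e \<in> zelts C \<Longrightarrow> map_zelt (restrict id (cells C)) e = e"
  by (auto simp: zelts_def)

lemma map_zelt_comp: "e \<in> zelts C \<Longrightarrow> map_zelt (compose (cells C) g f) e = map_zelt g (map_zelt f e)"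
  by (auto simp: zelts_def compose_eq)

lemma Z_map_id: "Z_map C C (restrict id (cells C)) = Idn KJBM (Z_obj C)"
proof -
  let ?h = "map_zelt (restrict id (cells C))"
  have "restrict ?h (onodes (Z_obj C) k) = restrict id (onodes (Z_obj C) k)"
    "restrict ?h (oedges (Z_obj C) k) = restrict id (oedges (Z_obj C) k)"
    "restrict (map_prod ?h ?h) (owhite (Z_obj C) k) = restrict id (owhite (Z_obj C) k)" for k
    using Z_obj_zelts[of C k] map_zelt_id[of _ C] by (intro restrict_ext, auto)+
  then show ?thesis by (simp add: Z_map_def KJBM_simps)
qed

lemma compose_restrict:
  assumes "f ` A \<subseteq> B" "\<And>x. x \<in> A \<Longrightarrow> h x = g (f x)"
  shows "restrict h A = compose A (restrict g B) (restrict f A)"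
  using assms by (auto simp: compose_def fun_eq_iff)

text \<open>The hypothesis ensures that \<open>f\<close> carries nodes, edges and white dots into
  those of \<open>Z_obj D\<close>, where the restricted maps of \<open>g\<close> have their intended
  values.\<close>

lemma Z_map_comp:
  assumes f: "Z_map C D f \<in> opetope_iso (Z_obj C) (Z_obj D)"
  shows "Z_map C E (compose (cells C) g f) = Cmp KJBM (Z_obj C) (Z_obj D) (Z_obj E) (Z_map D E g) (Z_map C D f)"
proof -
  let ?hf = "map_zelt f" and ?hg = "map_zelt g" and ?h = "map_zelt (compose (cells C) g f)"
  have im: "?hf ` onodes (Z_obj C) k \<subseteq> onodes (Z_obj D) k" "?hf ` oedges (Z_obj C) k \<subseteq> oedges (Z_obj D) k"
    "map_prod ?hf ?hf ` owhite (Z_obj C) k \<subseteq> owhite (Z_obj D) k" for k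
    using opetope_iso_image[OF f, of k] by (simp_all add: Z_map_def)
  have pair: "map_prod ?h ?h d = map_prod ?hg ?hg (map_prod ?hf ?hf d)" if "d \<in> zelts C \<times> zelts C" for d
    using that map_zelt_comp[of _ C g f] by (cases d) simp
  have "restrict ?h (onodes (Z_obj C) k) = compose (onodes (Z_obj C) k) (restrict ?hg (onodes (Z_obj D) k)) (restrict ?hf (onodes (Z_obj C) k))"
    "restrict ?h (oedges (Z_obj C) k) = compose (oedges (Z_obj C) k) (restrict ?hg (oedges (Z_obj D) k)) (restrict ?hf (oedges (Z_obj C) k))"
    "restrict (map_prod ?h ?h) (owhite (Z_obj C) k) = compose (owhite (Z_obj C) k) (restrict (map_prod ?hg ?hg) (owhite (Z_obj D) k)) (restrict (map_prod ?hf ?hf) (owhite (Z_obj C) k))" for k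
    by (rule compose_restrict[OF im(1)], use Z_obj_zelts(1)[of C k] map_zelt_comp in blast,
        rule compose_restrict[OF im(2)], use Z_obj_zelts(2)[of C k] map_zelt_comp in blast,
        rule compose_restrict[OF im(3)], use Z_obj_zelts(3)[of C k] pair in blast)
  then show ?thesis by (simp add: Z_map_def KJBM_simps)
qed

theorem theorem4p30:
  shows "is_functor (DFC_core :: ('a mop, 'a \<Rightarrow> 'a) category) KJBM Z_obj Z_map"
  unfolding is_functor_def
proof (intro conjI ballI)
  show "is_category (DFC_core :: ('a mop, 'a \<Rightarrow> 'a) category)" by (rule is_category_DFC_core)
  show "is_category (KJBM :: ('a zelt opetope, 'a zelt opmap) category)" by (rule is_category_KJBM)
  fix C :: "'a mop" assume "C \<in> Obj DFC_core"
  then have C: "is_dfc C" by (simp add: DFC_core_simps)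
  then show "Z_obj C \<in> Obj KJBM" using dfc.is_opetope_Z_obj[OF dfc.intro] by (simp add: KJBM_simps)
  show "Z_map C C (Idn DFC_core C) = Idn KJBM (Z_obj C)" by (simp add: DFC_core_simps Z_map_id)
  fix D :: "'a mop" assume "D \<in> Obj DFC_core"
  then have D: "is_dfc D" by (simp add: DFC_core_simps)
  have hom: "Z_map C D f \<in> opetope_iso (Z_obj C) (Z_obj D)" if "f \<in> Hom DFC_core C D" for f
    using DFC_core_iso[OF C D that] dfc_iso.Z_map_iso by metis
  show "Z_map C D f \<in> Hom KJBM (Z_obj C) (Z_obj D)" if "f \<in> Hom DFC_core C D" for f
    using hom[OF that] by (simp add: KJBM_simps)
  fix E :: "'a mop" and f g assume "E \<in> Obj DFC_core" "f \<in> Hom DFC_core C D" "g \<in> Hom DFC_core D E"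
  then show "Z_map C E (Cmp DFC_core C D E g f) = Cmp KJBM (Z_obj C) (Z_obj D) (Z_obj E) (Z_map D E g) (Z_map C D f)"
    using Z_map_comp[OF hom] by (simp add: DFC_core_simps)
qed

end
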